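(* Let $\lambda\ge 0$, $\mu\ge 0$, let $\mathbf{x}_1,\dots,\mathbf{x}_{N_r}\in\mathbb{R}^2$ be distinct and not all on one line, let $f_1,\dots,f_N\in\mathbb{R}$, let $b_1,\dots,b_{N_b}:\mathbb{R}\to\mathbb{R}$ be given functions with $\|b_\nu\|_{L_2}=1$, and let $\varphi_{rn}\in\mathbb{R}$ for $r=1,\dots,N_r$, $n=1,\dots,N$. The spline-based field estimator $$\text{(V)}\quad\{\hat g_\nu\}_{\nu=1}^{N_b}:=\arg\min_{\{g_\nu\in\mathcal{S}\}}\ \frac{1}{N_rN}\sum_{r=1}^{N_r}\sum_{n=1}^{N}\Big(\varphi_{rn}-\sum_{\nu=1}^{N_b}g_\nu(\mathbf{x}_r)b_\nu(f_n)\Big)^2+\lambda\sum_{\nu=1}^{N_b}\int_{\mathbb{R}^2}\|\nabla^2 g_\nu(\mathbf{x})\|_F^2\,d\mathbf{x}+\mu\sum_{\nu=1}^{N_b}\big\|[g_\nu(\mathbf{x}_1),\dots,g_\nu(\mathbf{x}_{N_r})]^{\prime}\big\|_2$$ is equivalent to the group-Lasso problem, in the variable $\boldsymbol\zeta=[\boldsymbol\zeta_1^{\prime},\dots,\boldsymbol\zeta_{N_b}^{\prime}]^{\prime}$ with $\boldsymbol\zeta_\nu\in\mathbb{R}^{N_r}$, $$\text{(GL)}\quad\min_{\boldsymbol\zeta}\ \frac12\|\mathbf{y}-\mathbf{X}\boldsymbol\zeta\|_2^2+\mu\sum_{\nu=1}^{N_b}\|\boldsymbol\zeta_\nu\|_2,$$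 under the identities $$\mathbf{y}:=\frac{1}{\sqrt{N_rN}}[\boldsymbol\varphi^{\prime},\ \mathbf{0}]^{\prime},\qquad \mathbf{X}:=\frac{1}{\sqrt{N_rN}}\begin{bmatrix}\mathbf{B}\otimes\mathbf{I}_{N_r}\\ \mathbf{I}_{N_b}\otimes\Big\{\mathrm{bdiag}\big((N_rN\lambda\,\mathbf{Q}_2^{\prime}\mathbf{K}\mathbf{Q}_2)^{1/2},\mathbf{0}\big)[\mathbf{K}\mathbf{Q}_2\ \ \mathbf{T}]^{-1}\Big\}\end{bmatrix},$$ with their respective solutions $\{\hat g_\nu\}_{\nu=1}^{N_b}$ and $\hat{\boldsymbol\zeta}=[\hat{\boldsymbol\zeta}_1^{\prime},\dots,\hat{\boldsymbol\zeta}_{N_b}^{\prime}]^{\prime}$ related, for $\nu=1,\dots,N_b$, by $$\hat g_\nu(\mathbf{x})=\sum_{r=1}^{N_r}\beta_{\nu r}K(\|\mathbf{x}-\mathbf{x}_r\|_2)+\boldsymbol\alpha_{\nu1}^{\prime}\mathbf{x}+\alpha_{\nu0},$$ $$[\boldsymbol\beta_\nu^{\prime},\boldsymbol\alpha_\nu^{\prime}]^{\prime}=\mathrm{bdiag}(\mathbf{Q}_2,\mathbf{I}_3)\,[\mathbf{K}\mathbf{Q}_2\ \ \mathbf{T}]^{-1}\hat{\boldsymbol\zeta}_\nu,$$ where $\boldsymbol\beta_\nu:=[\beta_{\nu1},\dots,\beta_{\nu N_r}]^{\prime}$ and $\boldsymbol\alpha_\nu:=[\alpha_{\nu0},\bo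ldsymbol\alpha_{\nu1}^{\prime}]^{\prime}$.
   Context: $\mathcal{S}$ is the (Sobolev) space of functions for which the smoothness penalty is well defined: all (continuous) functions $g:\mathbb{R}^2\to\mathbb{R}$ whose second-order distributional partial derivatives all belong to $L^2(\mathbb{R}^2)$. $\nabla^2 g$ is the Hessian, $\|\cdot\|_F$ the Frobenius norm, $\otimes$ the Kronecker product, $\mathrm{bdiag}$ a block-diagonal matrix, $(\cdot)^{1/2}$ a matrix square root, $\mathbf{I}_m$ the $m\times m$ identity, prime is transposition. Kernel: $K(\rho):=\rho^2\log(\rho)$, with $K(0):=0$ by continuity. Data vector: $\boldsymbol\varphi:=[\boldsymbol\varphi_1^{\prime},\dots,\boldsymbol\varphi_N^{\prime}]^{\prime}\in\mathbb{R}^{N_rN}$ with $\boldsymbol\varphi_n:=[\varphi_{1n},\dots,\varphi_{N_rn}]^{\prime}$. In $\mathbf{y}$, $\mathbf{0}$ is a zero block of length $N_bN_r$; inside $\mathrm{bdiag}$ in $\mathbf{X}$, $\mathbf{0}$ is the $3\times3$ zero matrix. Matrices: $\mathbf{T}\in\mathbb{R}^{N_r\times3}$ has $r$th row $[1\ \ \mathbf{x}_r^{\prime}]$; $\mathbf{B}\in\mathbb{R}^{N\times N_b}$ has $(n,\nu)$ entry $b_\nu(f_n)$; $\mathbf{K}\in\mathbb{R}^{N_r\times N_r}$ has $(i,j)$ entry $K(\|\mathbf{x}_i-\mathbf{x}_j\|_2)$. $\mathbf{T}=[\mathbf{Q}_1\ \mathbf{Q}_2]\begin{bmatrix}\mathbf{R}\\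 \mathbf{0}\end{bmatrix}$ is a QR decomposition, with $[\mathbf{Q}_1\ \mathbf{Q}_2]$ orthogonal, $\mathbf{Q}_1\in\mathbb{R}^{N_r\times3}$, $\mathbf{Q}_2\in\mathbb{R}^{N_r\times(N_r-3)}$, $\mathbf{R}\in\mathbb{R}^{3\times3}$. The matrix $\mathbf{Q}_2^{\prime}\mathbf{K}\mathbf{Q}_2$ is positive definite.
   Formalization: The statement is false with the same λ, μ in (V) and (GL): here λ inside X is replaced by 8πλ and μ in (GL) by μ/2; for λ=0, where (V) also has non-spline minimizers, a given minimizer of (V) is matched with ζ only through its values at the x_r. *)

theory Defs
  imports
    "HOL-Analysis.Analysis"
    "Jordan_Normal_Form.Matrix"
    "Jordan_Normal_Form.Gauss_Jordan_Elimination"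
begin

(* "vec", "mat", "$" and so on refer to Jordan_Normal_Form (dimensions are terms);
   components of real^2 are written with vec_nth. *)
unbundle no vec_syntax
hide_const (open) Finite_Cartesian_Product.vec Finite_Cartesian_Product.mat
hide_type (open) Finite_Cartesian_Product.vec

section \<open>Sobolev space and smoothness penalty\<close>

definition partial :: "2 \<Rightarrow> (real^2 \<Rightarrow> real) \<Rightarrow> real^2 \<Rightarrow> real" where
  "partial i u = (\<lambda>p. frechet_derivative u (at p) (axis i 1))"

(* all iterated partial derivatives exist and are differentiable, i.e. u is C-infinity *)
definition smooth :: "(real^2 \<Rightarrow> real) \<Rightarrow> bool" where
  "smooth u \<longleftrightarrow> (\<forall>is. (foldr partial is u) differentiable_on UNIV)"

definition test_function :: "(real^2 \<Rightarrow> real) \<Rightarrow> bool" where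
  "test_function u \<longleftrightarrow> smooth u \<and> compact (closure {p. u p \<noteq> 0})"

definition in_L2 :: "('a::euclidean_space \<Rightarrow> real) \<Rightarrow> bool" where
  "in_L2 u \<longleftrightarrow> u \<in> borel_measurable lebesgue \<and> integrable lebesgue (\<lambda>p. (u p)\<^sup>2)"

definition L2_norm :: "('a::euclidean_space \<Rightarrow> real) \<Rightarrow> real" where
  "L2_norm u = sqrt (LINT p|lebesgue. (u p)\<^sup>2)"

(* h represents the distribution D_i D_j u; two integrations by parts give the sign + *)
definition weak_partial2 ::
    "2 \<Rightarrow> 2 \<Rightarrow> (real^2 \<Rightarrow> real) \<Rightarrow> (real^2 \<Rightarrow> real) \<Rightarrow> bool" where
  "weak_partial2 i j u h \<longleftrightarrow>
     (\<forall>\<psi>. test_function \<psi> \<longrightarrow>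
        (LINT p|lebesgue. u p * partial i (partial j \<psi>) p) = (LINT p|lebesgue. h p * \<psi> p))"

definition is_weak_hessian :: "(real^2 \<Rightarrow> real) \<Rightarrow> (real^2 \<Rightarrow> real^2^2) \<Rightarrow> bool" where
  "is_weak_hessian u H \<longleftrightarrow>
     (\<forall>i j. in_L2 (\<lambda>p. vec_nth (vec_nth (H p) i) j)
          \<and> weak_partial2 i j u (\<lambda>p. vec_nth (vec_nth (H p) i) j))"

definition sobolev :: "(real^2 \<Rightarrow> real) set" where
  "sobolev = {u. continuous_on UNIV u \<and> (\<exists>H. is_weak_hessian u H)}"

(* determined up to a null set, which does not affect roughness *)
definition weak_hessian :: "(real^2 \<Rightarrow> real) \<Rightarrow> real^2 \<Rightarrow> real^2^2" where
  "weak_hessian u = (SOME H. is_weak_hessian u H)"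

(* the norm of the type real^2^2 is the Frobenius norm *)
definition roughness :: "(real^2 \<Rightarrow> real) \<Rightarrow> real" where
  "roughness u = (LINT p|lebesgue. (norm (weak_hessian u p))\<^sup>2)"

section \<open>Matrix operations\<close>

definition vnorm :: "real vec \<Rightarrow> real" where
  "vnorm v = sqrt (scalar_prod v v)"

definition append_cols :: "real mat \<Rightarrow> real mat \<Rightarrow> real mat" (infixr "@\<^sub>c" 65) where
  "A @\<^sub>c B = four_block_mat A B (0\<^sub>m 0 (dim_col A)) (0\<^sub>m 0 (dim_col B))"

definition kron :: "real mat \<Rightarrow> real mat \<Rightarrow> real mat" (infixl "\<otimes>\<^sub>K" 70) where
  "A \<otimes>\<^sub>K B = mat (dim_row A * dim_row B) (dim_col A * dim_col B)
     (\<lambda>(i, j). A $$ (i div dim_row B, j div dim_col B) * B $$ (i mod dim_row B, j mod dim_col B))"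

abbreviation mat_inv :: "real mat \<Rightarrow> real mat" where
  "mat_inv A \<equiv> the (mat_inverse A)"

(* Symmetric square roots; the principal one is included. *)
definition is_mat_sqrt :: "real mat \<Rightarrow> real mat \<Rightarrow> bool" where
  "is_mat_sqrt C A \<longleftrightarrow> C \<in> carrier_mat (dim_row A) (dim_col A) \<and> C\<^sup>T = C \<and> C * C = A"

definition QR_decomp :: "real mat \<Rightarrow> real mat \<Rightarrow> real mat \<Rightarrow> real mat \<Rightarrow> bool" where
  "QR_decomp A Q\<^sub>1 Q\<^sub>2 R \<longleftrightarrow> (let m = dim_row A; n = dim_col A in
     Q\<^sub>1 \<in> carrier_mat m n \<and> Q\<^sub>2 \<in> carrier_mat m (m - n) \<and> R \<in> carrier_mat n n \<and>
     upper_triangular R \<and>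
     (Q\<^sub>1 @\<^sub>c Q\<^sub>2)\<^sup>T * (Q\<^sub>1 @\<^sub>c Q\<^sub>2) = 1\<^sub>m m \<and>
     A = (Q\<^sub>1 @\<^sub>c Q\<^sub>2) * (R @\<^sub>r 0\<^sub>m (m - n) n))"

section \<open>Data of the estimation problem\<close>

(* All indices start at 0. *)

(* ln 0 = 0, so that the value at 0 is 0.  The biharmonic operator maps p |-> K(norm p) to
   8 pi times the Dirac mass: for T' beta = 0, the spline with kernel coefficients beta has
   roughness 8 pi (beta' K beta), not beta' K beta. *)
definition tps_kernel :: "real \<Rightarrow> real" where
  "tps_kernel \<rho> = \<rho>\<^sup>2 * ln \<rho>"

definition T_mat :: "nat \<Rightarrow> (nat \<Rightarrow> real^2) \<Rightarrow> real mat" where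
  "T_mat Nr x = mat Nr 3
     (\<lambda>(r, j). if j = 0 then 1 else if j = 1 then vec_nth (x r) 1 else vec_nth (x r) 2)"

definition K_mat :: "nat \<Rightarrow> (nat \<Rightarrow> real^2) \<Rightarrow> real mat" where
  "K_mat Nr x = mat Nr Nr (\<lambda>(i, j). tps_kernel (norm (x i - x j)))"

definition B_mat :: "nat \<Rightarrow> nat \<Rightarrow> (nat \<Rightarrow> real \<Rightarrow> real) \<Rightarrow> (nat \<Rightarrow> real) \<Rightarrow> real mat" where
  "B_mat N Nb b f = mat N Nb (\<lambda>(n, \<nu>). b \<nu> (f n))"

definition data_vec :: "nat \<Rightarrow> nat \<Rightarrow> (nat \<Rightarrow> nat \<Rightarrow> real) \<Rightarrow> real vec" where
  "data_vec Nr N \<phi> = vec (Nr * N) (\<lambda>k. \<phi> (k mod Nr) (k div Nr))"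

definition y_vec :: "nat \<Rightarrow> nat \<Rightarrow> nat \<Rightarrow> (nat \<Rightarrow> nat \<Rightarrow> real) \<Rightarrow> real vec" where
  "y_vec Nr N Nb \<phi> = (1 / sqrt (real (Nr * N))) \<cdot>\<^sub>v (data_vec Nr N \<phi> @\<^sub>v 0\<^sub>v (Nb * Nr))"

definition KQT_mat :: "nat \<Rightarrow> (nat \<Rightarrow> real^2) \<Rightarrow> real mat \<Rightarrow> real mat" where
  "KQT_mat Nr x Q\<^sub>2 = (K_mat Nr x * Q\<^sub>2) @\<^sub>c T_mat Nr x"

(* C stands for a square root of Nr N lambda (Q2' K Q2), lambda being the smoothing weight *)
definition X_mat :: "nat \<Rightarrow> nat \<Rightarrow> nat \<Rightarrow> (nat \<Rightarrow> real^2) \<Rightarrow> (nat \<Rightarrow> real \<Rightarrow> real) \<Rightarrow>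
    (nat \<Rightarrow> real) \<Rightarrow> real mat \<Rightarrow> real mat \<Rightarrow> real mat" where
  "X_mat Nr N Nb x b f Q\<^sub>2 C = (1 / sqrt (real (Nr * N))) \<cdot>\<^sub>m
     ((B_mat N Nb b f \<otimes>\<^sub>K 1\<^sub>m Nr) @\<^sub>r
      (1\<^sub>m Nb \<otimes>\<^sub>K (diag_block_mat [C, 0\<^sub>m 3 3] * mat_inv (KQT_mat Nr x Q\<^sub>2))))"

section \<open>The two optimization problems\<close>

definition field_obj :: "nat \<Rightarrow> nat \<Rightarrow> nat \<Rightarrow> (nat \<Rightarrow> real^2) \<Rightarrow> (nat \<Rightarrow> real \<Rightarrow> real) \<Rightarrow>
    (nat \<Rightarrow> real) \<Rightarrow> (nat \<Rightarrow> nat \<Rightarrow> real) \<Rightarrow> real \<Rightarrow> real \<Rightarrow> (nat \<Rightarrow> real^2 \<Rightarrow> real) \<Rightarrow> real" where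
  "field_obj Nr N Nb x b f \<phi> lam mu g =
     1 / real (Nr * N) * (\<Sum>r<Nr. \<Sum>n<N. (\<phi> r n - (\<Sum>\<nu><Nb. g \<nu> (x r) * b \<nu> (f n)))\<^sup>2)
     + lam * (\<Sum>\<nu><Nb. roughness (g \<nu>))
     + mu * (\<Sum>\<nu><Nb. vnorm (vec Nr (\<lambda>r. g \<nu> (x r))))"

definition field_solution :: "nat \<Rightarrow> nat \<Rightarrow> nat \<Rightarrow> (nat \<Rightarrow> real^2) \<Rightarrow> (nat \<Rightarrow> real \<Rightarrow> real) \<Rightarrow>
    (nat \<Rightarrow> real) \<Rightarrow> (nat \<Rightarrow> nat \<Rightarrow> real) \<Rightarrow> real \<Rightarrow> real \<Rightarrow> (nat \<Rightarrow> real^2 \<Rightarrow> real) \<Rightarrow> bool" where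
  "field_solution Nr N Nb x b f \<phi> lam mu =
     is_arg_min (field_obj Nr N Nb x b f \<phi> lam mu) (\<lambda>g. \<forall>\<nu><Nb. g \<nu> \<in> sobolev)"

definition block :: "nat \<Rightarrow> real vec \<Rightarrow> nat \<Rightarrow> real vec" where
  "block Nr \<zeta> \<nu> = vec Nr (\<lambda>r. \<zeta> $ (\<nu> * Nr + r))"

definition group_lasso_obj :: "nat \<Rightarrow> nat \<Rightarrow> real vec \<Rightarrow> real mat \<Rightarrow> real \<Rightarrow> real vec \<Rightarrow> real" where
  "group_lasso_obj Nr Nb y X mu \<zeta> =
     1 / 2 * (vnorm (y - X *\<^sub>v \<zeta>))\<^sup>2 + mu * (\<Sum>\<nu><Nb. vnorm (block Nr \<zeta> \<nu>))"

definition group_lasso_solution ::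
    "nat \<Rightarrow> nat \<Rightarrow> real vec \<Rightarrow> real mat \<Rightarrow> real \<Rightarrow> real vec \<Rightarrow> bool" where
  "group_lasso_solution Nr Nb y X mu =
     is_arg_min (group_lasso_obj Nr Nb y X mu) (\<lambda>\<zeta>. \<zeta> \<in> carrier_vec (Nb * Nr))"

(* [beta', alpha']' as a vector of length Nr + 3 *)
definition spline_coeffs ::
    "nat \<Rightarrow> (nat \<Rightarrow> real^2) \<Rightarrow> real mat \<Rightarrow> real vec \<Rightarrow> real vec" where
  "spline_coeffs Nr x Q\<^sub>2 z = (diag_block_mat [Q\<^sub>2, 1\<^sub>m 3] * mat_inv (KQT_mat Nr x Q\<^sub>2)) *\<^sub>v z"

definition spline :: "nat \<Rightarrow> (nat \<Rightarrow> real^2) \<Rightarrow> real vec \<Rightarrow> real^2 \<Rightarrow> real" where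
  "spline Nr x c p = (\<Sum>r<Nr. c $ r * tps_kernel (norm (p - x r)))
     + (c $ (Nr + 1) * vec_nth p 1 + c $ (Nr + 2) * vec_nth p 2) + c $ Nr"

definition spline_field :: "nat \<Rightarrow> (nat \<Rightarrow> real^2) \<Rightarrow> real mat \<Rightarrow> real vec \<Rightarrow>
    nat \<Rightarrow> real^2 \<Rightarrow> real" where
  "spline_field Nr x Q\<^sub>2 \<zeta> \<nu> = spline Nr x (spline_coeffs Nr x Q\<^sub>2 (block Nr \<zeta> \<nu>))"

end

theory Submission
  imports
    Defs
    "HOL-Computational_Algebra.Polynomial"
    "HOL-Real_Asymp.Real_Asymp"
    "Jordan_Normal_Form.Determinant"
begin

text \<open>
  The data term and the group penalty only see the sample values of each \<open>g\<^sub>\<nu>\<close>, so the claim reduces to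
  minimal-norm interpolation: among all functions in the Sobolev space with given values at the
  \<open>x\<^sub>r\<close>, the thin-plate spline \<open>s\<close> with these values is the unique one of least roughness.  This follows
  from the identity
  \<open>\<integral> \<nabla>\<^sup>2 s : \<nabla>\<^sup>2 h = 8 \<pi> \<Sum>\<^sub>r \<beta>\<^sub>r h(x\<^sub>r)\<close> for every \<open>h\<close> in the Sobolev space, where \<open>\<beta>\<close> are the kernel coefficients
  of \<open>s\<close>, which annihilate affine functions: it makes \<open>\<nabla>\<^sup>2 s\<close> orthogonal to \<open>\<nabla>\<^sup>2 (g - s)\<close> whenever \<open>g\<close>
  interpolates the same values.  Taking \<open>h\<close> to be \<open>s\<close> or a bump function in the identity gives the
  positive definiteness of \<open>Q\<^sub>2\<^sup>T K Q\<^sub>2\<close>, and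
  applying it to a function with vanishing Hessian shows that such a function is affine.

  To prove the identity, \<open>|p|\<^sup>2 ln |p|\<close> is replaced by the smooth kernel
  \<open>\<rho> ln \<rho> / 2\<close> with \<open>\<rho> = |p|\<^sup>2 + \<epsilon>\<^sup>2\<close>, whose bilaplacian is the approximate identity
  \<open>16 \<epsilon>\<^sup>4 / \<rho>\<^sup>3\<close> of mass \<open>8 \<pi>\<close>.  The Hessian of the regularised spline times a cutoff at radius \<open>R\<close> is an
  admissible test function.  Since \<open>\<beta>\<close> annihilates affine functions, the
  commutator terms of the cutoff are of order \<open>R\<^sup>-\<^sup>4\<close>, uniformly in \<open>\<epsilon>\<close>; they vanish in the limit because a
  function with square-integrable Hessian has means \<open>m(t)\<close> at scale \<open>t\<close> with \<open>m'' = O(1/t)\<close>, hence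
  grows more slowly than \<open>t\<^sup>2\<close>.  One lets \<open>\<epsilon> \<rightarrow> 0\<close> first and then \<open>R \<rightarrow> \<infinity>\<close>.
\<close>

section \<open>Smooth functions on the plane\<close>

text \<open>A weak Hessian is tested only against smooth functions of compact support, and a
  thin-plate spline is in general neither smooth nor of compact support: its second derivatives have
  logarithmic singularities at the centres and decay only like |p|^-2. This forces two parameters,
  and bounds uniform in the regularisation, since its limit is taken first. The pointwise growth of
  a Sobolev function is never estimated. Instead the commutator is rescaled to a bounded weight on
  the disc of radius 2, and only weighted means of the function enter. The mean bound t sqrt t,
  cruder than the t ln t that two integrations of 1/t would give, is enough: with the area factor
  t^2 and the commutator size t^-4 it leaves t^-1/2. Radial integrals rest on one computation, the
  image of planar Lebesgue measure under the squared norm. On the algebraic side, the group-Lasso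
  variable turns out to be the vector of sample values, so that the two problems can be compared
  through a single objective: one is half of the other, restricted to splines.\<close>

lemma partial_eq:
  assumes "(u has_derivative D) (at p)"
  shows "partial i u p = D (axis i 1)"
  unfolding partial_def using frechet_derivative_at[OF assms] by simp

lemma differentiable_has_derivative_partial:
  assumes "u differentiable (at p)"
  shows "(u has_derivative (\<lambda>v. \<Sum>i\<in>UNIV. partial i u p * vec_nth v i)) (at p)"
proof -
  let ?D = "frechet_derivative u (at p)"
  have D: "(u has_derivative ?D) (at p)" using assms frechet_derivative_works by blast
  then have lin: "linear ?D" by (simp add: has_derivative_linear)
  have "?D = (\<lambda>v. \<Sum>i\<in>UNIV. partial i u p * vec_nth v i)"
  proof
    fix v :: "real^2"
    have "?D v = ?D (\<Sum>i\<in>UNIV. vec_nth v i *\<^sub>R axis i 1)"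
      by (simp add: basis_expansion flip: scalar_mult_eq_scaleR)
    also have "\<dots> = (\<Sum>i\<in>UNIV. partial i u p * vec_nth v i)"
      by (simp add: linear_sum[OF lin] linear_scale[OF lin] partial_def mult.commute)
    finally show "?D v = (\<Sum>i\<in>UNIV. partial i u p * vec_nth v i)" .
  qed
  with D show ?thesis by simp
qed

lemma partial_const [simp]: "partial i (\<lambda>p. c) = (\<lambda>p. 0)"
  by (rule ext) (subst partial_eq[OF has_derivative_const], simp)

lemma vec_nth_has_derivative: "((\<lambda>p. vec_nth p j) has_derivative (\<lambda>v. vec_nth v j)) (at p)"
  by (rule bounded_linear.has_derivative[OF bounded_linear_vec_nth has_derivative_ident])

lemma partial_coord: "partial i (\<lambda>p. vec_nth p j) = (\<lambda>p. if i = j then 1 else 0)"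
  by (rule ext) (subst partial_eq[OF vec_nth_has_derivative], simp add: axis_def)

lemma partial_add:
  assumes "u differentiable (at p)" "v differentiable (at p)"
  shows "partial i (\<lambda>p. u p + v p) p = partial i u p + partial i v p"
  using has_derivative_add[OF assms[unfolded frechet_derivative_works]]
  by (subst partial_eq) (auto simp: partial_def)

lemma partial_mult:
  assumes "u differentiable (at p)" "v differentiable (at p)"
  shows "partial i (\<lambda>p. u p * v p) p = u p * partial i v p + partial i u p * v p"
  using has_derivative_mult[OF assms[unfolded frechet_derivative_works]]
  by (subst partial_eq) (auto simp: partial_def)

lemma partial_chain:
  assumes "u differentiable (at p)" "(g has_real_derivative g') (at (u p))"
  shows "partial i (\<lambda>p. g (u p)) p = g' * partial i u p"
    and "(\<lambda>p. g (u p)) differentiable (at p)"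
proof -
  have "((\<lambda>p. g (u p)) has_derivative (\<lambda>v. frechet_derivative u (at p) v * g')) (at p)"
    using DERIV_compose_FDERIV[OF assms(2) assms(1)[unfolded frechet_derivative_works]] .
  then show "partial i (\<lambda>p. g (u p)) p = g' * partial i u p" "(\<lambda>p. g (u p)) differentiable (at p)"
    by (auto simp: partial_eq[OF \<open>(_ has_derivative _) _\<close>] partial_def[of i u] differentiable_def)
qed

lemma partial_affine:
  fixes u :: "real^2 \<Rightarrow> real"
  assumes "u differentiable (at (a + c *\<^sub>R p))"
  shows "partial i (\<lambda>p. u (a + c *\<^sub>R p)) p = c * partial i u (a + c *\<^sub>R p)"
    and "(\<lambda>p. u (a + c *\<^sub>R p)) differentiable (at p)"
proof -
  let ?D = "frechet_derivative u (at (a + c *\<^sub>R p))"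
  have D: "(u has_derivative ?D) (at (a + c *\<^sub>R p))"
    using assms frechet_derivative_works by blast
  have "((\<lambda>p. a + c *\<^sub>R p) has_derivative (\<lambda>v. c *\<^sub>R v)) (at p)"
    by (auto intro!: derivative_eq_intros)
  from has_derivative_compose[OF this D]
  have *: "((\<lambda>p. u (a + c *\<^sub>R p)) has_derivative (\<lambda>v. ?D (c *\<^sub>R v))) (at p)" .
  then show "(\<lambda>p. u (a + c *\<^sub>R p)) differentiable (at p)" by (auto simp: differentiable_def)
  from * D show "partial i (\<lambda>p. u (a + c *\<^sub>R p)) p = c * partial i u (a + c *\<^sub>R p)"
    by (simp add: partial_eq linear_scale[OF has_derivative_linear[OF D]])
qed

lemma smooth_imp_differentiable: "smooth u \<Longrightarrow> u differentiable (at p)"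
  unfolding smooth_def by (drule spec[of _ "[]"]) (auto simp: differentiable_on_def)

lemma smooth_partial: "smooth u \<Longrightarrow> smooth (partial i u)"
  unfolding smooth_def
proof
  fix js assume "\<forall>is. foldr partial is u differentiable_on UNIV"
  then have "foldr partial (js @ [i]) u differentiable_on UNIV" by blast
  then show "foldr partial js (partial i u) differentiable_on UNIV" by simp
qed

text \<open>A one-variable smooth function is carried together with all its derivatives,
  \<open>G n\<close> being the n-th derivative of \<open>G 0\<close>; the chain rule for
  \<open>G n\<close> composed with \<open>u\<close> then stays in the same family. The instance
  needed is the flat function exp(-1/y).\<close>

definition smooth_tower :: "(nat \<Rightarrow> real \<Rightarrow> real) \<Rightarrow> bool" where
  "smooth_tower G \<longleftrightarrow> (\<forall>n y. (G n has_real_derivative G (Suc n) y) (at y))"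

(* A set closed under partial derivatives and consisting of differentiable functions contains
   only smooth functions. *)
inductive_set smooth_gen :: "(real^2 \<Rightarrow> real) set" where
  base: "smooth u \<Longrightarrow> u \<in> smooth_gen"
| const: "(\<lambda>p. c) \<in> smooth_gen"
| coord: "(\<lambda>p. vec_nth p i) \<in> smooth_gen"
| add: "u \<in> smooth_gen \<Longrightarrow> v \<in> smooth_gen \<Longrightarrow> (\<lambda>p. u p + v p) \<in> smooth_gen"
| mult: "u \<in> smooth_gen \<Longrightarrow> v \<in> smooth_gen \<Longrightarrow> (\<lambda>p. u p * v p) \<in> smooth_gen"
| inv: "u \<in> smooth_gen \<Longrightarrow> (\<And>p. u p \<noteq> 0) \<Longrightarrow> (\<lambda>p. inverse (u p)) \<in> smooth_gen"
| log: "u \<in> smooth_gen \<Longrightarrow> (\<And>p. 0 < u p) \<Longrightarrow> (\<lambda>p. ln (u p)) \<in> smooth_gen"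
| tower: "smooth_tower G \<Longrightarrow> u \<in> smooth_gen \<Longrightarrow> (\<lambda>p. G n (u p)) \<in> smooth_gen"
| affine: "u \<in> smooth_gen \<Longrightarrow> (\<lambda>p. u (a + c *\<^sub>R p)) \<in> smooth_gen"

text \<open>The derivative is written with constants, products and inverses only, so that it
  literally matches constructors of \<open>smooth_gen\<close>.\<close>

lemma partial_inverse:
  assumes "u differentiable (at p)" "u p \<noteq> 0"
  shows "partial i (\<lambda>p. inverse (u p)) p = - 1 * (inverse (u p) * (inverse (u p) * partial i u p))"
    and "(\<lambda>p. inverse (u p)) differentiable (at p)"
  using partial_chain[OF assms(1) DERIV_inverse[OF assms(2)]]
  by (auto simp: numeral_2_eq_2 mult_ac)

lemma partial_ln:
  assumes "u differentiable (at p)" "0 < u p"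
  shows "partial i (\<lambda>p. ln (u p)) p = inverse (u p) * partial i u p"
    and "(\<lambda>p. ln (u p)) differentiable (at p)"
  using partial_chain[OF assms(1) DERIV_ln[OF assms(2)]] by auto

text \<open>For each constructor the product or chain rule expresses a partial derivative by the
  constructors again. Both halves go through one induction because these rules require the parts to
  be differentiable.\<close>

lemma smooth_gen_step:
  "u \<in> smooth_gen \<Longrightarrow> (\<forall>p. u differentiable (at p)) \<and> (\<forall>i. partial i u \<in> smooth_gen)"
proof (induction rule: smooth_gen.induct)
  case (base u)
  then show ?case by (simp add: smooth_imp_differentiable smooth_partial smooth_gen.base)
next
  case (const c)
  then show ?case by (simp add: smooth_gen.const)
next
  case (coord i)
  then show ?case
    using vec_nth_has_derivative by (auto simp: partial_coord differentiable_def smooth_gen.const)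
next
  case (add u v)
  then have "partial i (\<lambda>p. u p + v p) = (\<lambda>p. partial i u p + partial i v p)" for i
    by (intro ext) (simp add: partial_add)
  with add show ?case by (auto intro: smooth_gen.add)
next
  case (mult u v)
  then have "partial i (\<lambda>p. u p * v p) = (\<lambda>p. u p * partial i v p + partial i u p * v p)" for i
    by (intro ext) (simp add: partial_mult)
  with mult show ?case by (auto intro!: smooth_gen.add smooth_gen.mult)
next
  case (inv u)
  then have "partial i (\<lambda>p. inverse (u p)) =
      (\<lambda>p. - 1 * (inverse (u p) * (inverse (u p) * partial i u p)))" for i
    by (intro ext partial_inverse) auto
  moreover have "(\<lambda>p. - 1 * (inverse (u p) * (inverse (u p) * partial i u p))) \<in> smooth_gen" for i
    using inv by (intro smooth_gen.mult smooth_gen.const smooth_gen.inv) auto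
  ultimately show ?case using inv partial_inverse(2)[of u] by simp
next
  case (log u)
  then have "partial i (\<lambda>p. ln (u p)) = (\<lambda>p. inverse (u p) * partial i u p)" for i
    by (intro ext partial_ln) auto
  moreover have "(\<lambda>p. inverse (u p) * partial i u p) \<in> smooth_gen" for i
    using log by (intro smooth_gen.mult smooth_gen.inv) (auto simp: less_imp_neq[THEN not_sym])
  moreover have "\<forall>p. (\<lambda>p. ln (u p)) differentiable (at p)"
    using log by (intro allI partial_ln) auto
  ultimately show ?case by simp
next
  case (tower G u n)
  then have G: "(G n has_real_derivative G (Suc n) y) (at y)" for y
    by (auto simp: smooth_tower_def)
  have "partial i (\<lambda>p. G n (u p)) = (\<lambda>p. G (Suc n) (u p) * partial i u p)" for i
    using tower.IH by (intro ext partial_chain(1)[OF _ G]) simp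
  moreover have "(\<lambda>p. G n (u p)) differentiable (at p)" for p
    using tower.IH by (intro partial_chain(2)[OF _ G]) simp
  moreover have "(\<lambda>p. G (Suc n) (u p) * partial i u p) \<in> smooth_gen" for i
    using tower.IH by (intro smooth_gen.mult smooth_gen.tower[OF tower.hyps(1,2)]) simp
  ultimately show ?case by simp
next
  case (affine u a c)
  then have "partial i (\<lambda>p. u (a + c *\<^sub>R p)) = (\<lambda>p. c * partial i u (a + c *\<^sub>R p))" for i
    by (intro ext partial_affine) auto
  moreover have "(\<lambda>p. c * partial i u (a + c *\<^sub>R p)) \<in> smooth_gen" for i
    using affine.IH by (intro smooth_gen.mult smooth_gen.const smooth_gen.affine) simp
  moreover have "(\<lambda>p. u (a + c *\<^sub>R p)) differentiable (at p)" for p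
    using affine.IH by (intro partial_affine(2)) simp
  ultimately show ?case by simp
qed

lemma smooth_iff_gen: "smooth u \<longleftrightarrow> u \<in> smooth_gen"
proof
  assume u: "u \<in> smooth_gen"
  have "foldr partial is u \<in> smooth_gen" for "is"
    by (induction "is") (use u smooth_gen_step in auto)
  then show "smooth u"
    unfolding smooth_def differentiable_on_def using smooth_gen_step by simp
qed (rule smooth_gen.base)

lemma smooth_const [intro, simp]: "smooth (\<lambda>p. c)"
  and smooth_coord [intro, simp]: "smooth (\<lambda>p. vec_nth p i)"
  and smooth_add [intro]: "smooth u \<Longrightarrow> smooth v \<Longrightarrow> smooth (\<lambda>p. u p + v p)"
  and smooth_mult [intro]: "smooth u \<Longrightarrow> smooth v \<Longrightarrow> smooth (\<lambda>p. u p * v p)"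
  and smooth_inverse: "smooth u \<Longrightarrow> (\<And>p. u p \<noteq> 0) \<Longrightarrow> smooth (\<lambda>p. inverse (u p))"
  and smooth_ln: "smooth u \<Longrightarrow> (\<And>p. 0 < u p) \<Longrightarrow> smooth (\<lambda>p. ln (u p))"
  and smooth_compose_tower: "smooth_tower G \<Longrightarrow> smooth u \<Longrightarrow> smooth (\<lambda>p. G n (u p))"
  and smooth_affine: "smooth u \<Longrightarrow> smooth (\<lambda>p. u (a + c *\<^sub>R p))"
  unfolding smooth_iff_gen
  by (fact smooth_gen.const smooth_gen.coord smooth_gen.add smooth_gen.mult smooth_gen.inv
      smooth_gen.log smooth_gen.tower smooth_gen.affine)+

lemma smooth_cmult [intro]: "smooth u \<Longrightarrow> smooth (\<lambda>p. c * u p)"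
  by (intro smooth_mult smooth_const)

lemma smooth_minus [intro]: "smooth u \<Longrightarrow> smooth (\<lambda>p. - u p)"
  using smooth_cmult[of u "-1"] by simp

lemma smooth_diff [intro]: "smooth u \<Longrightarrow> smooth v \<Longrightarrow> smooth (\<lambda>p. u p - v p)"
  using smooth_add[of u "\<lambda>p. - v p"] by (simp add: smooth_minus)

lemma smooth_sum [intro]: "(\<And>r. r \<in> I \<Longrightarrow> smooth (u r)) \<Longrightarrow> smooth (\<lambda>p. \<Sum>r\<in>I. u r p)"
  by (induction I rule: infinite_finite_induct) auto

lemma smooth_shift: "smooth u \<Longrightarrow> smooth (\<lambda>p. u (p - a))"
  using smooth_affine[of u "-a" 1] by simp

lemma smooth_scale: "smooth u \<Longrightarrow> smooth (\<lambda>p. u (c *\<^sub>R p))"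
  using smooth_affine[of u 0 c] by simp

lemma norm2_sq: "(norm (p :: real^2))\<^sup>2 = vec_nth p 1 * vec_nth p 1 + vec_nth p 2 * vec_nth p 2"
  by (simp add: norm_vec_def L2_set_def sum_2 power2_eq_square)

lemma smooth_norm_sq: "smooth (\<lambda>p. (norm p)\<^sup>2)"
  unfolding norm2_sq by (intro smooth_add smooth_mult smooth_coord)

lemma smooth_continuous: "smooth u \<Longrightarrow> continuous_on S u"
  by (simp add: differentiable_imp_continuous_within continuous_at_imp_continuous_on
      smooth_imp_differentiable)

lemma partial_sum:
  assumes "\<And>r. r \<in> I \<Longrightarrow> smooth (u r)"
  shows "partial i (\<lambda>p. \<Sum>r\<in>I. u r p) = (\<lambda>p. \<Sum>r\<in>I. partial i (u r) p)"
  using assms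
proof (induction I rule: infinite_finite_induct)
  case (insert r I)
  then show ?case
    by (intro ext)
      (simp add: partial_add smooth_imp_differentiable smooth_sum)
qed auto

lemma partial_cmult: "smooth u \<Longrightarrow> partial i (\<lambda>p. c * u p) = (\<lambda>p. c * partial i u p)"
  by (intro ext) (simp add: partial_mult smooth_imp_differentiable)

lemma partial_shift: "smooth u \<Longrightarrow> partial i (\<lambda>p. u (p - a)) = (\<lambda>p. partial i u (p - a))"
  using partial_affine(1)[of u "-a" 1] by (intro ext) (simp add: smooth_imp_differentiable)

lemma partial_scale: "smooth u \<Longrightarrow> partial i (\<lambda>p. u (c *\<^sub>R p)) = (\<lambda>p. c * partial i u (c *\<^sub>R p))"
  using partial_affine(1)[of u 0 c] by (intro ext) (simp add: smooth_imp_differentiable)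

lemma partial_smooth_mult:
  "smooth u \<Longrightarrow> smooth v \<Longrightarrow>
    partial i (\<lambda>p. u p * v p) = (\<lambda>p. u p * partial i v p + partial i u p * v p)"
  by (intro ext) (simp add: partial_mult smooth_imp_differentiable)

lemma partial_smooth_add:
  "smooth u \<Longrightarrow> smooth v \<Longrightarrow> partial i (\<lambda>p. u p + v p) = (\<lambda>p. partial i u p + partial i v p)"
  by (intro ext) (simp add: partial_add smooth_imp_differentiable)

text \<open>Chain rule along a curve, used for the line s e_i + p (translations) and for the curve p
  / s (dilations).\<close>

lemma partial_line_derivative:
  assumes "smooth u" "(g has_vector_derivative g') (at t)"
  shows "((\<lambda>t. u (g t)) has_real_derivative (\<Sum>i\<in>UNIV. partial i u (g t) * vec_nth g' i)) (at t)"
proof -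
  have "((\<lambda>t. u (g t)) has_derivative (\<lambda>h. \<Sum>i\<in>UNIV. partial i u (g t) * vec_nth (h *\<^sub>R g') i)) (at t)"
    by (rule has_derivative_compose[OF assms(2)[unfolded has_vector_derivative_def]
      differentiable_has_derivative_partial[OF smooth_imp_differentiable[OF assms(1)]]])
  moreover have "(\<lambda>h. \<Sum>i\<in>UNIV. partial i u (g t) * vec_nth (h *\<^sub>R g') i) =
     (*) (\<Sum>i\<in>UNIV. partial i u (g t) * vec_nth g' i)"
    by (auto simp: sum_distrib_left mult_ac)
  ultimately show ?thesis by (simp add: has_field_derivative_def)
qed

subsection \<open>Smooth cutoff functions\<close>

text \<open>The functions P(1/y) exp(-1/y), extended by zero, include exp(-1/y) and are closed under
  differentiation, so every derivative is named by a polynomial.\<close>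

definition exp_germ :: "real poly \<Rightarrow> real \<Rightarrow> real" where
  "exp_germ P y = (if 0 < y then poly P (1 / y) * exp (- (1 / y)) else 0)"

text \<open>With z = 1/y one has dz/dy = -z^2, so differentiating P(z) exp(-z) in y gives z^2 (P -
  P')(z) exp(-z).\<close>

definition exp_step :: "real poly \<Rightarrow> real poly" where
  "exp_step P = [:0, 0, 1:] * (P - pderiv P)"

lemma poly_div_exp_tendsto_0: "((\<lambda>z. poly P z * exp (- z)) \<longlongrightarrow> (0::real)) at_top"
proof -
  have "((\<lambda>z. \<Sum>i\<le>degree P. coeff P i * (z ^ i / exp z)) \<longlongrightarrow> (\<Sum>i\<le>degree P. coeff P i * 0)) at_top"
    by (intro tendsto_sum tendsto_mult tendsto_const tendsto_power_div_exp_0)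
  moreover have "(\<lambda>z. poly P z * exp (- z)) = (\<lambda>z. \<Sum>i\<le>degree P. coeff P i * (z ^ i / exp z))"
    by (intro ext) (simp add: poly_altdef sum_distrib_right exp_minus divide_inverse mult.assoc)
  ultimately show ?thesis by simp
qed

lemma exp_germ_derivative:
  "(exp_germ P has_real_derivative exp_germ (exp_step P) y) (at y)"
proof -
  consider "0 < y" | "y < 0" | "y = 0" by linarith
  then show ?thesis
  proof cases
    case 1
    have "((\<lambda>y. poly P (1 / y) * exp (- (1 / y))) has_real_derivative exp_germ (exp_step P) y) (at y)"
      using 1 unfolding exp_germ_def exp_step_def
      by (auto intro!: derivative_eq_intros DERIV_chain2[OF poly_DERIV]
          simp: field_simps power2_eq_square)
    then show ?thesis
      by (rule has_field_derivative_transform_within_open[of _ _ _ "{0<..}"])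
        (use 1 in \<open>auto simp: exp_germ_def\<close>)
  next
    case 2
    have "((\<lambda>y. 0) has_real_derivative exp_germ (exp_step P) y) (at y)"
      using 2 by (simp add: exp_germ_def)
    then show ?thesis
      by (rule has_field_derivative_transform_within_open[of _ _ _ "{..<0}"])
        (use 2 in \<open>auto simp: exp_germ_def\<close>)
  next
    case 3
    have "((\<lambda>h. exp_germ P h / h) \<longlongrightarrow> 0) (at_right 0)"
    proof -
      \<comment> \<open>Dividing by h multiplies the polynomial by z = 1/h, so the difference
        quotient at 0 is a germ of the same kind and tends to 0.\<close>
      have "((\<lambda>h. poly ([:0, 1:] * P) (1 / h) * exp (- (1 / h))) \<longlongrightarrow> 0) (at_right (0::real))"
        using filterlim_compose[OF poly_div_exp_tendsto_0 filterlim_inverse_at_top_right, of "[:0,1:] * P"]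
        by (simp add: inverse_eq_divide)
      then show ?thesis
        by (rule Lim_transform_eventually)
          (auto simp: exp_germ_def eventually_at_right_field intro!: exI[of _ 1])
    qed
    moreover have "((\<lambda>h. exp_germ P h / h) \<longlongrightarrow> 0) (at_left 0)"
      by (rule tendsto_eventually) (auto simp: exp_germ_def eventually_at_left_field intro!: exI[of _ "-1"])
    ultimately have "((\<lambda>h. exp_germ P h / h) \<longlongrightarrow> 0) (at 0)"
      by (simp add: filterlim_at_split)
    with 3 show ?thesis by (simp add: has_field_derivative_iff exp_germ_def)
  qed
qed

lemma smooth_tower_exp_germ: "smooth_tower (\<lambda>n. exp_germ ((exp_step ^^ n) P))"
  by (simp add: smooth_tower_def exp_germ_derivative)

text \<open>The standard transition e(y) / (e(y) + e(1 - y)) with e(y) = exp(-1/y) for y > 0; it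
  joins the constants 0 and 1 smoothly.\<close>

definition smooth_step :: "real \<Rightarrow> real" where
  "smooth_step y = exp_germ 1 y * inverse (exp_germ 1 y + exp_germ 1 (1 - y))"

lemma exp_germ_denom: "0 < exp_germ 1 y + exp_germ 1 (1 - y)"
  by (auto simp: exp_germ_def add_pos_nonneg add_nonneg_pos)

lemma smooth_step_eq_0: "y \<le> 0 \<Longrightarrow> smooth_step y = 0"
  and smooth_step_eq_1: "1 \<le> y \<Longrightarrow> smooth_step y = 1"
  and smooth_step_bounds: "0 \<le> smooth_step y" "smooth_step y \<le> 1"
proof -
  show "y \<le> 0 \<Longrightarrow> smooth_step y = 0" by (simp add: smooth_step_def exp_germ_def)
  show "1 \<le> y \<Longrightarrow> smooth_step y = 1" by (simp add: smooth_step_def exp_germ_def)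
  have "exp_germ 1 y \<ge> 0" "exp_germ 1 (1 - y) \<ge> 0" by (auto simp: exp_germ_def)
  then show "0 \<le> smooth_step y" "smooth_step y \<le> 1"
    using exp_germ_denom[of y] by (auto simp: smooth_step_def field_simps)
qed

lemma smooth_smooth_step: "smooth u \<Longrightarrow> smooth (\<lambda>p. smooth_step (u p))"
  unfolding smooth_step_def
  using smooth_compose_tower[OF smooth_tower_exp_germ, of _ 0 1] exp_germ_denom
  by (intro smooth_mult smooth_inverse smooth_add) (auto simp: less_imp_neq[THEN not_sym])

text \<open>The squared norm keeps the function smooth at the origin. The value is 1 on the unit
  disc and 0 from radius sqrt 2 on, hence beyond radius 2.\<close>

definition cutoff :: "real^2 \<Rightarrow> real" where
  "cutoff p = smooth_step (2 - (norm p)\<^sup>2)"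

lemma smooth_cutoff: "smooth cutoff"
  unfolding cutoff_def[abs_def] by (intro smooth_smooth_step smooth_diff smooth_norm_sq smooth_const)

lemma cutoff_bounds: "0 \<le> cutoff p" "cutoff p \<le> 1"
  by (simp_all add: cutoff_def smooth_step_bounds)

lemma cutoff_eq_1: "norm p \<le> 1 \<Longrightarrow> cutoff p = 1"
  unfolding cutoff_def using power_le_one[of "norm p" 2] by (intro smooth_step_eq_1) auto

lemma cutoff_eq_0: "2 \<le> norm p \<Longrightarrow> cutoff p = 0"
  unfolding cutoff_def using power_mono[of 2 "norm p" 2] by (intro smooth_step_eq_0) auto

section \<open>Test functions: smooth functions of bounded support\<close>

lemma test_functionI:
  assumes "smooth u" "\<And>p. R < norm p \<Longrightarrow> u p = 0"
  shows "test_function u"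
proof -
  have "{p. u p \<noteq> 0} \<subseteq> cball 0 R" using assms(2) by (force simp: not_less)
  then have "bounded {p. u p \<noteq> 0}" by (rule bounded_subset[OF bounded_cball])
  with assms(1) show ?thesis by (simp add: test_function_def compact_closure)
qed

lemma test_function_bound:
  assumes "test_function u"
  obtains R where "0 < R" "\<And>p. R < norm p \<Longrightarrow> u p = 0"
proof -
  have "bounded {p. u p \<noteq> 0}"
    using assms bounded_subset[OF compact_imp_bounded closure_subset] by (auto simp: test_function_def)
  then obtain R where R: "0 < R" "\<forall>p\<in>{p. u p \<noteq> 0}. norm p \<le> R" unfolding bounded_pos by blast
  have "u p = 0" if "R < norm p" for p using R(2) that by (metis mem_Collect_eq not_less)
  with R(1) show ?thesis by (rule that)
qed

lemma partial_eq_0: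
  assumes "\<And>p. R < norm p \<Longrightarrow> u p = 0" "R < norm p"
  shows "partial i u p = 0"
proof -
  have "open {p :: real^2. R < norm p}" by (intro open_Collect_less continuous_intros)
  moreover have "p \<in> {p. R < norm p}" using assms(2) by simp
  moreover have "0 = u q" if "q \<in> {p. R < norm p}" for q using that assms(1)[of q] by simp
  ultimately have "(u has_derivative (\<lambda>v. 0)) (at p)"
    by (rule has_derivative_transform_within_open[OF has_derivative_const])
  then show ?thesis by (simp add: partial_eq)
qed

lemma test_function_smooth: "test_function u \<Longrightarrow> smooth u"
  by (simp add: test_function_def)

lemma test_function_partial:
  assumes "test_function u"
  shows "test_function (partial i u)"
proof -
  obtain R where R: "\<And>p. R < norm p \<Longrightarrow> u p = 0"
    by (rule test_function_bound[OF assms]) (rule that)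
  show ?thesis
    using smooth_partial[OF test_function_smooth[OF assms]] partial_eq_0[OF R]
    by (rule test_functionI)
qed

lemma test_function_mult:
  assumes "test_function u" "smooth v"
  shows "test_function (\<lambda>p. u p * v p)"
proof -
  obtain R where R: "\<And>p. R < norm p \<Longrightarrow> u p = 0"
    by (rule test_function_bound[OF assms(1)]) (rule that)
  show ?thesis
    by (rule test_functionI[where R = R, OF smooth_mult[OF test_function_smooth[OF assms(1)] assms(2)]])
      (simp add: R)
qed

lemma test_function_mult': "smooth v \<Longrightarrow> test_function u \<Longrightarrow> test_function (\<lambda>p. v p * u p)"
  using test_function_mult[of u v] by (simp add: mult.commute)

lemma test_function_cutoff:
  assumes "0 < R"
  shows "test_function (\<lambda>p. cutoff (p /\<^sub>R R))"
proof (rule test_functionI[OF smooth_scale[OF smooth_cutoff]])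
  fix p :: "real^2" assume "2 * R < norm p"
  with assms show "cutoff (p /\<^sub>R R) = 0" by (intro cutoff_eq_0) (simp add: field_simps)
qed

section \<open>Integration on the plane\<close>

lemma LINT_lebesgue_borel:
  fixes f :: "'a::euclidean_space \<Rightarrow> real"
  assumes "f \<in> borel_measurable borel"
  shows "(LINT p|lebesgue. f p) = (LINT p|lborel. f p)"
  by (rule integral_completion) (use assms in simp)

lemma integrable_lebesgue_borel:
  fixes f :: "'a::euclidean_space \<Rightarrow> real"
  assumes "f \<in> borel_measurable borel"
  shows "integrable lebesgue f \<longleftrightarrow> integrable lborel f"
  by (rule integrable_completion) (use assms in simp)

lemma borel_imp_lebesgue_measurable:
  fixes f :: "'a::euclidean_space \<Rightarrow> real"
  shows "f \<in> borel_measurable borel \<Longrightarrow> f \<in> borel_measurable lebesgue"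
  by (intro measurable_completion) simp

lemma continuous_imp_borel:
  fixes f :: "'a::euclidean_space \<Rightarrow> real"
  shows "continuous_on UNIV f \<Longrightarrow> f \<in> borel_measurable borel"
  by (rule borel_measurable_continuous_onI)

lemma integrable_continuous_cball:
  fixes f :: "real^2 \<Rightarrow> real"
  assumes "continuous_on UNIV f" "\<And>p. R < norm p \<Longrightarrow> f p = 0"
  shows "integrable lborel f" "integrable lebesgue f"
proof -
  have "integrable lborel (\<lambda>p. indicator (cball 0 R) p *\<^sub>R f p)"
    using continuous_on_subset[OF assms(1)] by (intro borel_integrable_compact) auto
  moreover have "(\<lambda>p. indicator (cball 0 R) p *\<^sub>R f p) = f"
    using assms(2) by (auto simp: indicator_def fun_eq_iff not_le)
  ultimately show *: "integrable lborel f" by simp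
  then show "integrable lebesgue f"
    using integrable_lebesgue_borel[OF continuous_imp_borel[OF assms(1)]] by simp
qed

text \<open>Turns a Lebesgue integral over the plane into an integral over one fixed box, the
  setting of the Leibniz rule for parameter integrals.\<close>

lemma LINT_eq_integral_cbox:
  fixes f :: "real^2 \<Rightarrow> real"
  assumes "continuous_on UNIV f" "\<And>p. R < norm p \<Longrightarrow> f p = 0"
  shows "(LINT p|lebesgue. f p) = integral (cbox (- (R *\<^sub>R One)) (R *\<^sub>R One)) f"
proof -
  have "p \<in> cbox (- (R *\<^sub>R One)) (R *\<^sub>R One)" if "norm p \<le> R" for p :: "real^2"
  proof -
    have "\<bar>p \<bullet> i\<bar> \<le> R" if "i \<in> Basis" for i
      using Basis_le_norm[OF that, of p] \<open>norm p \<le> R\<close> by linarith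
    then show ?thesis by (auto simp: mem_box abs_le_iff minus_le_iff)
  qed
  then have "f = (\<lambda>p. if p \<in> cbox (- (R *\<^sub>R One)) (R *\<^sub>R One) then f p else 0)"
    using assms(2) by (fastforce simp: fun_eq_iff not_le)
  then have "integral UNIV f =
      integral UNIV (\<lambda>p. if p \<in> cbox (- (R *\<^sub>R One)) (R *\<^sub>R One) then f p else 0)"
    by (rule arg_cong)
  also have "\<dots> = integral (cbox (- (R *\<^sub>R One)) (R *\<^sub>R One)) f"
    by (rule Henstock_Kurzweil_Integration.integral_restrict_UNIV)
  finally show ?thesis
    using integral_lborel[OF integrable_continuous_cball(1)[OF assms]]
      LINT_lebesgue_borel[OF continuous_imp_borel[OF assms(1)]] by simp
qed

text \<open>The common support radius \<open>R\<close> reduces the plane to a compact box, where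
  joint continuity of the derivative justifies differentiating under the integral.\<close>

lemma LINT_has_real_derivative:
  fixes f f' :: "real \<Rightarrow> real^2 \<Rightarrow> real"
  assumes U: "open U" "convex U" "t \<in> U"
    and f: "\<And>s. s \<in> U \<Longrightarrow> continuous_on UNIV (f s)" "\<And>s p. s \<in> U \<Longrightarrow> R < norm p \<Longrightarrow> f s p = 0"
    and f': "continuous_on (U \<times> UNIV) (\<lambda>(s, p). f' s p)" "\<And>s p. s \<in> U \<Longrightarrow> R < norm p \<Longrightarrow> f' s p = 0"
    and der: "\<And>s p. s \<in> U \<Longrightarrow> ((\<lambda>s. f s p) has_real_derivative f' s p) (at s)"
  shows "((\<lambda>s. LINT p|lebesgue. f s p) has_real_derivative (LINT p|lebesgue. f' t p)) (at t)"
proof -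
  let ?B = "cbox (- (R *\<^sub>R One)) (R *\<^sub>R One) :: (real^2) set"
  have "((\<lambda>s. integral ?B (f s)) has_real_derivative integral ?B (f' t)) (at t within U)"
  proof (rule leibniz_rule_field_derivative[where fx = f'])
    show "((\<lambda>s. f s p) has_real_derivative f' s p) (at s within U)" if "s \<in> U" "p \<in> ?B" for s p
      using der[OF that(1)] by (rule has_field_derivative_at_within)
    show "f s integrable_on ?B" if "s \<in> U" for s
      by (rule integrable_continuous[OF continuous_on_subset[OF f(1)[OF that]]]) simp
    show "continuous_on (U \<times> ?B) (\<lambda>(s, p). f' s p)"
      by (rule continuous_on_subset[OF f'(1)]) auto
  qed (use U in auto)
  then have *: "((\<lambda>s. integral ?B (f s)) has_real_derivative integral ?B (f' t)) (at t)"
    unfolding at_within_open[OF U(3,1)] .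
  have "continuous_on UNIV (\<lambda>p. (\<lambda>(s, p). f' s p) (t, p))"
    by (rule continuous_on_compose2[OF f'(1)]) (use U in \<open>auto intro!: continuous_intros\<close>)
  then have "integral ?B (f' t) = (LINT p|lebesgue. f' t p)"
    using f'(2) U by (intro LINT_eq_integral_cbox[symmetric]) auto
  moreover have "integral ?B (f s) = (LINT p|lebesgue. f s p)" if "s \<in> U" for s
    using f that by (intro LINT_eq_integral_cbox[symmetric]) auto
  ultimately show ?thesis
    using has_field_derivative_transform_within_open[OF *, of U] U by simp
qed

lemma LINT_translation:
  fixes f :: "real^2 \<Rightarrow> real"
  assumes "f \<in> borel_measurable borel"
  shows "(LINT p|lborel. f (c + p)) = (LINT p|lborel. f p)"
proof -
  have "(LINT p|lborel. f p) = (LINT p|distr lborel borel ((+) c). f p)"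
    by (simp add: lborel_distr_plus)
  also have "\<dots> = (LINT p|lborel. f (c + p))" by (rule integral_distr) (use assms in auto)
  finally show ?thesis by simp
qed

lemma LINT_lborel_affine:
  fixes f :: "real^2 \<Rightarrow> real"
  assumes "f \<in> borel_measurable borel" "c \<noteq> 0"
  shows "(LINT p|lborel. f p) = c\<^sup>2 * (LINT p|lborel. f (a + c *\<^sub>R p))"
proof -
  have "(LINT p|lborel. f p) =
      (LINT p|density (distr lborel borel (\<lambda>p. a + c *\<^sub>R p)) (\<lambda>_. ennreal (c\<^sup>2)). f p)"
    using lborel_affine[OF assms(2), of a] by simp
  also have "\<dots> = (LINT p|distr lborel borel (\<lambda>p. a + c *\<^sub>R p). c\<^sup>2 *\<^sub>R f p)"
    by (rule integral_density) (use assms in auto)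
  also have "\<dots> = (LINT p|lborel. c\<^sup>2 *\<^sub>R f (a + c *\<^sub>R p))"
    by (rule integral_distr) (use assms in auto)
  finally show ?thesis by simp
qed

lemma smooth_borel: "smooth u \<Longrightarrow> u \<in> borel_measurable borel"
  by (rule continuous_imp_borel[OF smooth_continuous])

lemma test_function_integrable:
  assumes "continuous_on UNIV u" "test_function \<psi>"
  shows "integrable lebesgue (\<lambda>p. u p * \<psi> p)"
proof -
  obtain R where R: "\<And>p. R < norm p \<Longrightarrow> \<psi> p = 0"
    by (rule test_function_bound[OF assms(2)]) (rule that)
  have "continuous_on UNIV (\<lambda>p. u p * \<psi> p)"
    by (rule continuous_on_mult[OF assms(1) smooth_continuous[OF test_function_smooth[OF assms(2)]]])
  then show ?thesis by (rule integrable_continuous_cball(2)[where R = R]) (simp add: R)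
qed

text \<open>The integral of a translate does not depend on the translation, and its derivative at
  translation 0 in direction i is the integral of the partial derivative.\<close>

lemma LINT_partial_eq_0:
  assumes "test_function w"
  shows "(LINT p|lebesgue. partial i w p) = 0"
proof -
  have w: "smooth w" by (rule test_function_smooth[OF assms])
  obtain R where R: "\<And>p. R < norm p \<Longrightarrow> w p = 0"
    by (rule test_function_bound[OF assms]) (rule that)
  let ?e = "axis i 1 :: real^2"
  \<comment> \<open>A translation by less than 1 enlarges the support radius by at most 1, which
    supplies the common radius \<open>R + 1\<close>.\<close>
  have far: "R < norm (s *\<^sub>R ?e + p)" if "s \<in> {-1<..<1}" "R + 1 < norm p" for s p
  proof -
    have "norm p \<le> norm (s *\<^sub>R ?e + p) + norm (s *\<^sub>R ?e)"
      using norm_triangle_ineq4[of "s *\<^sub>R ?e + p" "s *\<^sub>R ?e"] by simp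
    moreover have "\<bar>s\<bar> < 1" using that by auto
    ultimately show ?thesis using that by (simp add: norm_axis_1)
  qed
  have "((\<lambda>s. LINT p|lebesgue. w (s *\<^sub>R ?e + p)) has_real_derivative
      (LINT p|lebesgue. partial i w (0 *\<^sub>R ?e + p))) (at 0)"
  proof (rule LINT_has_real_derivative[where U = "{-1<..<1}" and R = "R + 1" and f' = "\<lambda>s p. partial i w (s *\<^sub>R ?e + p)"])
    show "continuous_on UNIV (\<lambda>p. w (s *\<^sub>R ?e + p))" for s
      by (rule continuous_on_compose2[OF smooth_continuous[OF w, of UNIV]])
        (auto intro!: continuous_intros)
    show "w (s *\<^sub>R ?e + p) = 0" if "s \<in> {-1<..<1}" "R + 1 < norm p" for s p
      by (rule R[OF far[OF that]])
    show "partial i w (s *\<^sub>R ?e + p) = 0" if "s \<in> {-1<..<1}" "R + 1 < norm p" for s p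
      by (rule partial_eq_0[OF R far[OF that]])
    have "continuous_on ({-1<..<1} \<times> UNIV) (\<lambda>x. partial i w (fst x *\<^sub>R ?e + snd x))"
      by (rule continuous_on_compose2[OF smooth_continuous[OF smooth_partial[OF w], of UNIV]])
        (auto intro!: continuous_intros)
    then show "continuous_on ({-1<..<1} \<times> UNIV) (\<lambda>(s, p). partial i w (s *\<^sub>R ?e + p))"
      by (simp add: case_prod_beta)
    show "((\<lambda>s. w (s *\<^sub>R ?e + p)) has_real_derivative partial i w (s *\<^sub>R ?e + p)) (at s)" for s p
    proof -
      have "((\<lambda>s. s *\<^sub>R ?e + p) has_vector_derivative ?e) (at s)"
        by (auto intro!: derivative_eq_intros)
      from partial_line_derivative[OF w this] show ?thesis
        by (simp add: axis_def if_distrib cong: if_cong)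
    qed
  qed auto
  moreover have "(LINT p|lebesgue. w (s *\<^sub>R ?e + p)) = (LINT p|lebesgue. w p)" for s
  proof -
    have "(\<lambda>p. w (s *\<^sub>R ?e + p)) \<in> borel_measurable borel"
      using smooth_borel[OF w] by measurable
    then show ?thesis
      using smooth_borel[OF w] by (simp add: LINT_lebesgue_borel LINT_translation)
  qed
  ultimately have "((\<lambda>s::real. LINT p|lebesgue. w p) has_real_derivative (LINT p|lebesgue. partial i w p)) (at 0)"
    by simp
  then show ?thesis using DERIV_unique[OF _ DERIV_const] by blast
qed

lemma integration_by_parts:
  assumes u: "smooth u" and \<psi>: "test_function \<psi>"
  shows "(LINT p|lebesgue. u p * partial i \<psi> p) = - (LINT p|lebesgue. partial i u p * \<psi> p)"
proof -
  have s: "smooth \<psi>" by (rule test_function_smooth[OF \<psi>])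
  have 1: "integrable lebesgue (\<lambda>p. u p * partial i \<psi> p)"
    by (rule test_function_integrable[OF smooth_continuous[OF u] test_function_partial[OF \<psi>]])
  have 2: "integrable lebesgue (\<lambda>p. partial i u p * \<psi> p)"
    by (rule test_function_integrable[OF smooth_continuous[OF smooth_partial[OF u]] \<psi>])
  have "(LINT p|lebesgue. u p * partial i \<psi> p + partial i u p * \<psi> p) = 0"
    using LINT_partial_eq_0[OF test_function_mult'[OF u \<psi>], of i]
    by (simp add: partial_smooth_mult[OF u s])
  then show ?thesis using Bochner_Integration.integral_add[OF 1 2] by simp
qed

text \<open>The derivatives moved onto \<open>u\<close> appear in reversed order; the Hessians used
  later are indexed accordingly.\<close>

lemma integration_by_parts2:
  assumes u: "smooth u" and \<psi>: "test_function \<psi>"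
  shows "(LINT p|lebesgue. u p * partial i (partial j \<psi>) p) =
    (LINT p|lebesgue. partial j (partial i u) p * \<psi> p)"
  by (simp add: integration_by_parts[OF u test_function_partial[OF \<psi>]]
      integration_by_parts[OF smooth_partial[OF u] \<psi>])

subsection \<open>Radial integrals\<close>

text \<open>The disc |p|^2 \<le> s has area pi s, so the squared norm has constant density pi on the
  half line. The half lines \<open>{..s}\<close> generate the Borel sets and are stable under
  intersection, so comparing them suffices.\<close>

lemma distr_norm_sq:
  "distr lborel borel (\<lambda>p :: real^2. (norm p)\<^sup>2) = density lborel (\<lambda>s. ennreal pi * indicator {0..} s)"
  (is "?M = ?N")
proof (rule measure_eqI_generator_eq)
  let ?E = "range (\<lambda>s :: real. {..s})"
  have M: "emeasure ?M {..s} = (if 0 \<le> s then ennreal (pi * s) else 0)" for s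
  proof -
    have "emeasure ?M {..s} = emeasure lborel {p :: real^2. (norm p)\<^sup>2 \<le> s}"
      by (subst emeasure_distr) (auto simp: vimage_def)
    also have "{p :: real^2. (norm p)\<^sup>2 \<le> s} = (if 0 \<le> s then cball 0 (sqrt s) else {})"
    proof (cases "0 \<le> s")
      case True
      then have "(norm p)\<^sup>2 \<le> s \<longleftrightarrow> norm p \<le> sqrt s" for p :: "real^2"
        using abs_le_square_iff[of "norm p" "sqrt s"] by simp
      with True show ?thesis by (simp only: cball_def if_True dist_0_norm)
    next
      case False
      then have "\<not> (norm p)\<^sup>2 \<le> s" for p :: "real^2"
        using zero_le_power2[of "norm p"] by linarith
      with False show ?thesis by auto
    qed
    also have "emeasure lborel (if 0 \<le> s then cball (0 :: real^2) (sqrt s) else {}) =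
        (if 0 \<le> s then ennreal (pi * s) else 0)"
      by (simp add: emeasure_cball unit_ball_vol_2)
    finally show ?thesis .
  qed
  have N: "emeasure ?N {..s} = (if 0 \<le> s then ennreal (pi * s) else 0)" for s
  proof -
    have "emeasure ?N {..s} = (\<integral>\<^sup>+x. ennreal pi * indicator {0..s} x \<partial>lborel)"
      by (subst emeasure_density) (auto intro!: nn_integral_cong simp: indicator_def)
    also have "\<dots> = ennreal pi * emeasure lborel {0..s}"
      by (rule nn_integral_cmult_indicator) simp
    also have "\<dots> = (if 0 \<le> s then ennreal (pi * s) else 0)"
      by (auto simp: ennreal_mult)
    finally show ?thesis .
  qed
  show "Int_stable ?E" by (auto simp: Int_stable_def)
  show "?E \<subseteq> Pow UNIV" by simp
  show "emeasure ?M X = emeasure ?N X" if "X \<in> ?E" for X using that M N by auto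
  show "sets ?M = sigma_sets UNIV ?E" "sets ?N = sigma_sets UNIV ?E"
    by (simp_all add: borel_eq_atMost)
  show "range (\<lambda>n. {..real n}) \<subseteq> ?E" by auto
  show "(\<Union>n. {..real n}) = UNIV" using real_arch_simple by auto
  show "emeasure ?M {..real n} \<noteq> \<infinity>" for n by (simp add: M)
qed

lemma nn_integral_radial:
  assumes "f \<in> borel_measurable borel"
  shows "(\<integral>\<^sup>+p. f ((norm (p :: real^2))\<^sup>2) \<partial>lborel) = (\<integral>\<^sup>+s. ennreal pi * f s * indicator {0..} s \<partial>lborel)"
proof -
  have "(\<integral>\<^sup>+p. f ((norm (p :: real^2))\<^sup>2) \<partial>lborel) =
      (\<integral>\<^sup>+s. f s \<partial>distr lborel borel (\<lambda>p :: real^2. (norm p)\<^sup>2))"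
    by (rule nn_integral_distr[symmetric]) (use assms in auto)
  also have "\<dots> = (\<integral>\<^sup>+s. ennreal pi * f s * indicator {0..} s \<partial>lborel)"
    unfolding distr_norm_sq using assms by (subst nn_integral_density) (auto simp: mult_ac)
  finally show ?thesis .
qed

text \<open>By the radial formula this is the integral of 16 pi / (1 + s)^3 over s \<ge> 0, with
  antiderivative -8 pi / (1 + s)^2; the constant 8 pi originates here.\<close>

lemma has_bochner_integral_delta_kernel:
  "has_bochner_integral lborel (\<lambda>q :: real^2. 16 / (1 + (norm q)\<^sup>2) ^ 3) (8 * pi)"
proof (rule has_bochner_integral_nn_integral)
  have "(\<integral>\<^sup>+q. ennreal (16 / (1 + (norm (q :: real^2))\<^sup>2) ^ 3) \<partial>lborel) =
      (\<integral>\<^sup>+s. ennreal (pi * (16 / (1 + s) ^ 3)) * indicator {0..} s \<partial>lborel)"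
    by (subst nn_integral_radial[where f = "\<lambda>s. ennreal (16 / (1 + s) ^ 3)"])
      (auto intro!: nn_integral_cong simp: indicator_def simp flip: ennreal_mult)
  also have "\<dots> = ennreal (0 - (- (8 * pi) / (1 + 0)\<^sup>2))"
  proof (rule nn_integral_FTC_atLeast)
    show "((\<lambda>s. - (8 * pi) / (1 + s)\<^sup>2) \<longlongrightarrow> 0) at_top" by real_asymp
    fix s :: real assume s: "0 \<le> s"
    have "8 * pi * (2 * z) / z ^ 4 = pi * 16 / z ^ 3" if "z \<noteq> 0" for z :: real
      using that by (simp add: field_simps eval_nat_numeral)
    from this[of "1 + s"] s have "8 * pi * (2 + 2 * s) / (1 + s) ^ 4 = pi * 16 / (1 + s) ^ 3"
      by (simp add: distrib_left)
    with s show "((\<lambda>s. - (8 * pi) / (1 + s)\<^sup>2) has_real_derivative pi * (16 / (1 + s) ^ 3)) (at s)"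
      by (auto intro!: derivative_eq_intros)
  qed auto
  finally show "(\<integral>\<^sup>+q. ennreal (16 / (1 + (norm (q :: real^2))\<^sup>2) ^ 3) \<partial>lborel) = ennreal (8 * pi)"
    by simp
qed auto

lemma in_L2_nn_integral:
  fixes u :: "'a::euclidean_space \<Rightarrow> real"
  assumes "u \<in> borel_measurable borel" "(\<integral>\<^sup>+p. ennreal ((u p)\<^sup>2) \<partial>lborel) < \<infinity>"
  shows "in_L2 u"
proof -
  have "integrable lborel (\<lambda>p. (u p)\<^sup>2)" by (rule integrableI_nonneg) (use assms in auto)
  moreover have "(\<lambda>p. (u p)\<^sup>2) \<in> borel_measurable borel" using assms(1) by measurable
  ultimately show ?thesis
    using assms(1) unfolding in_L2_def
    by (simp add: integrable_lebesgue_borel borel_imp_lebesgue_measurable)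
qed

text \<open>Model for decay of order |p|^-2: the square integrates radially to pi times the integral
  of (1 + s)^-2.\<close>

lemma in_L2_decay: "in_L2 (\<lambda>p :: real^2. inverse (1 + (norm p)\<^sup>2))"
proof (rule in_L2_nn_integral)
  have "(\<integral>\<^sup>+q. ennreal ((inverse (1 + (norm (q :: real^2))\<^sup>2))\<^sup>2) \<partial>lborel) =
      (\<integral>\<^sup>+s. ennreal (pi * (inverse (1 + s))\<^sup>2) * indicator {0..} s \<partial>lborel)"
    by (subst nn_integral_radial[where f = "\<lambda>s. ennreal ((inverse (1 + s))\<^sup>2)"])
      (auto intro!: nn_integral_cong simp: indicator_def simp flip: ennreal_mult)
  also have "\<dots> = ennreal (0 - (- pi / (1 + 0)))"
  proof (rule nn_integral_FTC_atLeast)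
    show "((\<lambda>s. - pi / (1 + s)) \<longlongrightarrow> 0) at_top" by real_asymp
  qed (auto intro!: derivative_eq_intros simp: field_simps power2_eq_square)
  finally show "(\<integral>\<^sup>+q. ennreal ((inverse (1 + (norm (q :: real^2))\<^sup>2))\<^sup>2) \<partial>lborel) < \<infinity>" by simp
qed measurable

text \<open>The power -1/2 dominates a logarithm near the centre, while its square |p - a|^-1 is
  still integrable in the plane.\<close>

lemma in_L2_local_singularity:
  assumes "0 < M"
  shows "in_L2 (\<lambda>p :: real^2. indicator (cball a M) p * inverse (sqrt (norm (p - a))))"
proof (rule in_L2_nn_integral)
  let ?f = "\<lambda>s. ennreal (indicator {..M\<^sup>2} s * inverse (sqrt s))"
  have "(\<integral>\<^sup>+p. ennreal ((indicator (cball a M) p * inverse (sqrt (norm (p - a))))\<^sup>2) \<partial>lborel) =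
      (\<integral>\<^sup>+p. ?f ((norm (- a + p))\<^sup>2) \<partial>lborel)"
  proof (rule nn_integral_cong)
    fix p :: "real^2"
    have "p \<in> cball a M \<longleftrightarrow> (norm (p - a))\<^sup>2 \<le> M\<^sup>2"
      using assms by (simp add: dist_norm norm_minus_commute abs_le_square_iff[symmetric])
    then show "ennreal ((indicator (cball a M) p * inverse (sqrt (norm (p - a))))\<^sup>2) = ?f ((norm (- a + p))\<^sup>2)"
      by (auto simp: indicator_def power_mult_distrib power_inverse)
  qed
  also have "\<dots> = (\<integral>\<^sup>+p. ?f ((norm p)\<^sup>2) \<partial>distr lborel borel ((+) (- a)))"
    by (rule nn_integral_distr[symmetric]) auto
  also have "\<dots> = (\<integral>\<^sup>+p. ?f ((norm (p :: real^2))\<^sup>2) \<partial>lborel)" by (simp only: lborel_distr_plus)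
  also have "\<dots> = (\<integral>\<^sup>+s. ennreal pi * ?f s * indicator {0..} s \<partial>lborel)"
    by (rule nn_integral_radial) measurable
  also have "\<dots> = (\<integral>\<^sup>+s. ennreal (pi * inverse (sqrt s)) * indicator {0..M\<^sup>2} s \<partial>lborel)"
    by (intro nn_integral_cong) (auto simp: indicator_def simp flip: ennreal_mult)
  also have "\<dots> = ennreal (2 * pi * sqrt (M\<^sup>2) - 2 * pi * sqrt 0)"
  proof (rule nn_integral_has_integral_lebesgue')
    show "((\<lambda>s. pi * inverse (sqrt s)) has_integral 2 * pi * sqrt (M\<^sup>2) - 2 * pi * sqrt 0) {0..M\<^sup>2}"
      by (rule fundamental_theorem_of_calculus_interior)
        (auto intro!: derivative_eq_intros continuous_intros simp flip: has_real_derivative_iff_has_vector_derivative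
           simp: field_simps)
  qed auto
  finally show "(\<integral>\<^sup>+p. ennreal ((indicator (cball a M) p * inverse (sqrt (norm (p - a))))\<^sup>2) \<partial>lborel) < \<infinity>"
    by simp
  have "cball a M \<in> sets borel" by simp
  moreover have "(\<lambda>p. inverse (sqrt (norm (p - a)))) \<in> borel_measurable borel" by measurable
  ultimately show "(\<lambda>p. indicator (cball a M) p * inverse (sqrt (norm (p - a)))) \<in> borel_measurable borel"
    by (intro borel_measurable_times borel_measurable_indicator)
qed

text \<open>Substituting p = a + e q makes the kernel independent of e, and g(a + e q) tends to g(a)
  boundedly.\<close>

lemma delta_kernel_tendsto:
  fixes g :: "real^2 \<Rightarrow> real" and e :: "nat \<Rightarrow> real"
  assumes g: "continuous_on UNIV g" "\<And>p. \<bar>g p\<bar> \<le> M"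
    and e: "\<And>n. 0 < e n" "e \<longlonglongrightarrow> 0"
  shows "(\<lambda>n. LINT p|lebesgue. g p * (16 * e n ^ 4 / ((norm (p - a))\<^sup>2 + (e n)\<^sup>2) ^ 3)) \<longlonglongrightarrow> 8 * pi * g a"
proof -
  have gb [measurable]: "g \<in> borel_measurable borel" by (rule continuous_imp_borel[OF g(1)])
  let ?k = "\<lambda>q :: real^2. 16 / (1 + (norm q)\<^sup>2) ^ 3"
  have "(LINT p|lebesgue. g p * (16 * e n ^ 4 / ((norm (p - a))\<^sup>2 + (e n)\<^sup>2) ^ 3)) =
      (LINT q|lborel. g (a + e n *\<^sub>R q) * ?k q)" for n
  proof -
    have meas: "(\<lambda>p. g p * (16 * e n ^ 4 / ((norm (p - a))\<^sup>2 + (e n)\<^sup>2) ^ 3)) \<in> borel_measurable borel"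
      by measurable
    have "(LINT p|lebesgue. g p * (16 * e n ^ 4 / ((norm (p - a))\<^sup>2 + (e n)\<^sup>2) ^ 3)) =
        (LINT p|lborel. g p * (16 * e n ^ 4 / ((norm (p - a))\<^sup>2 + (e n)\<^sup>2) ^ 3))"
      by (rule LINT_lebesgue_borel[OF meas])
    also have "\<dots> = (e n)\<^sup>2 * (LINT q|lborel. g (a + e n *\<^sub>R q) *
        (16 * e n ^ 4 / ((norm (a + e n *\<^sub>R q - a))\<^sup>2 + (e n)\<^sup>2) ^ 3))"
      using LINT_lborel_affine[OF meas, of "e n" a] e(1)[of n] by simp
    also have "\<dots> = (LINT q|lborel. g (a + e n *\<^sub>R q) * ?k q)"
      unfolding integral_mult_right_zero[symmetric]
    proof (rule Bochner_Integration.integral_cong[OF refl])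
      fix q :: "real^2"
      have "(norm (a + e n *\<^sub>R q - a))\<^sup>2 + (e n)\<^sup>2 = (e n)\<^sup>2 * (1 + (norm q)\<^sup>2)"
        by (simp add: power_mult_distrib algebra_simps)
      \<comment> \<open>The Jacobian e^2 and the numerator e^4 cancel the e^6 taken out of the cubed
        denominator.\<close>
      moreover have "(e n)\<^sup>2 * (16 * e n ^ 4 / ((e n)\<^sup>2 * (1 + (norm q)\<^sup>2)) ^ 3) = ?k q"
      proof -
        have "x\<^sup>2 * (16 * x ^ 4 / (x\<^sup>2 * y) ^ 3) = 16 / y ^ 3" if "0 < x" for x y :: real
          using that by (cases "y = 0") (simp_all add: divide_simps eval_nat_numeral)
        from this[OF e(1)] show ?thesis .
      qed
      ultimately show "(e n)\<^sup>2 * (g (a + e n *\<^sub>R q) *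
        (16 * e n ^ 4 / ((norm (a + e n *\<^sub>R q - a))\<^sup>2 + (e n)\<^sup>2) ^ 3)) = g (a + e n *\<^sub>R q) * ?k q"
        by (metis mult.left_commute)
    qed
    finally show ?thesis .
  qed
  moreover have "(\<lambda>n. LINT q|lborel. g (a + e n *\<^sub>R q) * ?k q) \<longlonglongrightarrow> (LINT q|lborel. g a * ?k q)"
  proof (rule integral_dominated_convergence[where w = "\<lambda>q. M * ?k q"])
    show "integrable lborel (\<lambda>q. M * ?k q)"
      using has_bochner_integral_delta_kernel by (intro integrable_mult_right) (rule integrable.intros)
    show "AE q in lborel. (\<lambda>n. g (a + e n *\<^sub>R q) * ?k q) \<longlonglongrightarrow> g a * ?k q"
    proof (rule AE_I2)
      fix q :: "real^2"
      have "(\<lambda>n. a + e n *\<^sub>R q) \<longlonglongrightarrow> a + 0 *\<^sub>R q" by (intro tendsto_intros e)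
      then have "(\<lambda>n. g (a + e n *\<^sub>R q)) \<longlonglongrightarrow> g a"
        using continuous_on_tendsto_compose[OF g(1)] by simp
      then show "(\<lambda>n. g (a + e n *\<^sub>R q) * ?k q) \<longlonglongrightarrow> g a * ?k q" by (rule tendsto_mult_right)
    qed
    show "AE q in lborel. norm (g (a + e n *\<^sub>R q) * ?k q) \<le> M * ?k q" for n
    proof (rule AE_I2)
      fix q :: "real^2"
      have "\<bar>?k q\<bar> = ?k q" by (simp add: add_nonneg_nonneg)
      then show "norm (g (a + e n *\<^sub>R q) * ?k q) \<le> M * ?k q"
        using mult_right_mono[OF g(2)[of "a + e n *\<^sub>R q"], of "?k q"] by (simp add: abs_mult)
    qed
  qed measurable
  moreover have "(LINT q|lborel. g a * ?k q) = 8 * pi * g a"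
    unfolding integral_mult_right_zero has_bochner_integral_integral_eq[OF has_bochner_integral_delta_kernel]
    by (rule mult.commute)
  ultimately show ?thesis by simp
qed

subsection \<open>Square-integrable functions\<close>

lemma in_L2_measurable: "in_L2 u \<Longrightarrow> u \<in> borel_measurable lebesgue"
  by (simp add: in_L2_def)

lemma in_L2_integrable_square: "in_L2 u \<Longrightarrow> integrable lebesgue (\<lambda>p. (u p)\<^sup>2)"
  by (simp add: in_L2_def)

lemma in_L2_integrable_mult:
  assumes "in_L2 u" "in_L2 v"
  shows "integrable lebesgue (\<lambda>p. u p * v p)"
proof (rule Bochner_Integration.integrable_bound)
  show "integrable lebesgue (\<lambda>p. (u p)\<^sup>2 + (v p)\<^sup>2)"
    by (intro Bochner_Integration.integrable_add in_L2_integrable_square assms)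
  show "(\<lambda>p. u p * v p) \<in> borel_measurable lebesgue"
    by (intro borel_measurable_times in_L2_measurable assms)
  have "norm (x * y) \<le> norm (x\<^sup>2 + y\<^sup>2)" for x y :: real
  proof -
    have "2 * (\<bar>x\<bar> * \<bar>y\<bar>) \<le> x\<^sup>2 + y\<^sup>2"
      using sum_squares_bound[of "\<bar>x\<bar>" "\<bar>y\<bar>"] by simp
    moreover have "0 \<le> \<bar>x\<bar> * \<bar>y\<bar>" by simp
    ultimately show ?thesis by (simp only: real_norm_def abs_mult)
  qed
  then show "AE p in lebesgue. norm (u p * v p) \<le> norm ((u p)\<^sup>2 + (v p)\<^sup>2)" by simp
qed

lemma in_L2_bound:
  assumes "in_L2 u" "v \<in> borel_measurable lebesgue" "AE p in lebesgue. \<bar>v p\<bar> \<le> \<bar>u p\<bar>"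
  shows "in_L2 v"
proof -
  have "integrable lebesgue (\<lambda>p. (v p)\<^sup>2)"
  proof (rule Bochner_Integration.integrable_bound[OF in_L2_integrable_square[OF assms(1)]])
    show "(\<lambda>p. (v p)\<^sup>2) \<in> borel_measurable lebesgue"
      using assms(2) by (rule borel_measurable_power)
    show "AE p in lebesgue. norm ((v p)\<^sup>2) \<le> norm ((u p)\<^sup>2)"
      using assms(3) by eventually_elim (simp add: abs_le_square_iff)
  qed
  with assms(2) show ?thesis by (simp add: in_L2_def)
qed

lemma in_L2_cmult: "in_L2 u \<Longrightarrow> in_L2 (\<lambda>p. c * u p)"
  unfolding in_L2_def power_mult_distrib by auto

lemma in_L2_add:
  assumes "in_L2 u" "in_L2 v"
  shows "in_L2 (\<lambda>p. u p + v p)"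
proof -
  have "integrable lebesgue (\<lambda>p. (u p)\<^sup>2 + (v p)\<^sup>2 + 2 * (u p * v p))"
    by (intro Bochner_Integration.integrable_add integrable_mult_right in_L2_integrable_mult
        in_L2_integrable_square assms)
  moreover have "(\<lambda>p. (u p)\<^sup>2 + (v p)\<^sup>2 + 2 * (u p * v p)) = (\<lambda>p. (u p + v p)\<^sup>2)"
    by (simp add: power2_sum mult.assoc)
  ultimately show ?thesis
    using in_L2_measurable[OF assms(1)] in_L2_measurable[OF assms(2)] by (simp add: in_L2_def)
qed

lemma in_L2_diff: "in_L2 u \<Longrightarrow> in_L2 v \<Longrightarrow> in_L2 (\<lambda>p. u p - v p)"
  using in_L2_add[OF _ in_L2_cmult[of v "-1"], of u] by simp

lemma in_L2_zero: "in_L2 (\<lambda>p. 0)"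
  by (simp add: in_L2_def)

lemma in_L2_sum: "(\<And>r. r \<in> I \<Longrightarrow> in_L2 (u r)) \<Longrightarrow> in_L2 (\<lambda>p. \<Sum>r\<in>I. u r p)"
  by (induction I rule: infinite_finite_induct) (auto simp: in_L2_zero in_L2_add)

lemma in_L2_continuous_cball:
  fixes u :: "real^2 \<Rightarrow> real"
  assumes "continuous_on UNIV u" "\<And>p. R < norm p \<Longrightarrow> u p = 0"
  shows "in_L2 u"
proof -
  have "integrable lebesgue (\<lambda>p. (u p)\<^sup>2)"
    by (rule integrable_continuous_cball(2)[where R = R])
      (use assms in \<open>auto intro!: continuous_intros\<close>)
  then show ?thesis
    using borel_imp_lebesgue_measurable[OF continuous_imp_borel[OF assms(1)]] by (simp add: in_L2_def)
qed

lemma in_L2_test_function: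
  assumes "test_function \<psi>"
  shows "in_L2 \<psi>"
proof -
  obtain R where R: "\<And>p. R < norm p \<Longrightarrow> \<psi> p = 0"
    by (rule test_function_bound[OF assms]) (rule that)
  show ?thesis
    by (rule in_L2_continuous_cball[OF smooth_continuous[OF test_function_smooth[OF assms]] R])
qed

subsection \<open>The fundamental lemma of the calculus of variations\<close>

lemma smooth_prod: "(\<And>r. r \<in> I \<Longrightarrow> smooth (u r)) \<Longrightarrow> smooth (\<lambda>p. \<Prod>r\<in>I. u r p)"
  by (induction I rule: infinite_finite_induct) (auto simp: smooth_mult)

text \<open>Each factor is 0 beyond its face of the box and 1 once the distance to that face is at
  least 1/n. The bumps are therefore supported in the box and converge to its indicator.\<close>

definition box_bump :: "real^2 \<Rightarrow> real^2 \<Rightarrow> nat \<Rightarrow> real^2 \<Rightarrow> real" where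
  "box_bump a b n p = (\<Prod>i\<in>UNIV. smooth_step (real n * (vec_nth p i - vec_nth a i)) *
     smooth_step (real n * (vec_nth b i - vec_nth p i)))"

lemma smooth_box_bump: "smooth (box_bump a b n)"
  unfolding box_bump_def[abs_def]
  by (intro smooth_prod smooth_mult smooth_smooth_step smooth_diff smooth_const smooth_coord)

lemma box_bump_eq_0:
  assumes "p \<notin> box a b"
  shows "box_bump a b n p = 0"
proof -
  obtain i where "\<not> (vec_nth a i < vec_nth p i \<and> vec_nth p i < vec_nth b i)"
    using assms unfolding mem_box_cart by blast
  then have "smooth_step (real n * (vec_nth p i - vec_nth a i)) *
     smooth_step (real n * (vec_nth b i - vec_nth p i)) = 0"
    by (auto simp: not_less intro!: smooth_step_eq_0 mult_nonneg_nonpos)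
  then show ?thesis unfolding box_bump_def by (intro prod_zero) auto
qed

lemma box_bump_bounds: "0 \<le> box_bump a b n p" "box_bump a b n p \<le> 1"
  unfolding box_bump_def
  by (auto intro!: prod_nonneg prod_le_1 mult_nonneg_nonneg mult_le_one smooth_step_bounds)

lemma box_bump_test_function: "test_function (box_bump a b n)"
proof -
  obtain R where "box a b \<subseteq> ball 0 R" using bounded_subset_ballD[OF bounded_box] by blast
  then have "p \<notin> box a b" if "R < norm p" for p using that by auto
  then show ?thesis using box_bump_eq_0 by (intro test_functionI[OF smooth_box_bump]) blast
qed

lemma box_bump_tendsto: "(\<lambda>n. box_bump a b n p) \<longlonglongrightarrow> indicator (box a b) p"
proof (cases "p \<in> box a b")
  case True
  then have *: "0 < vec_nth p i - vec_nth a i" "0 < vec_nth b i - vec_nth p i" for i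
    by (auto simp: mem_box_cart)
  have ev: "\<forall>\<^sub>F n in sequentially. 1 \<le> real n * x" if "0 < x" for x :: real
    using that by real_asymp
  have "\<forall>\<^sub>F n in sequentially. \<forall>i\<in>UNIV. 1 \<le> real n * (vec_nth p i - vec_nth a i) \<and>
      1 \<le> real n * (vec_nth b i - vec_nth p i)"
    by (intro eventually_ball_finite ballI eventually_conj ev *) simp
  then have "\<forall>\<^sub>F n in sequentially. box_bump a b n p = indicator (box a b) p"
    by eventually_elim (use True in \<open>simp add: box_bump_def smooth_step_eq_1\<close>)
  then show ?thesis by (rule tendsto_eventually)
qed (simp add: box_bump_eq_0)

(* The densities of the positive and the negative part of Z agree on boxes. *)
lemma AE_zero_if_box_integrals_zero:
  fixes Z :: "'a::euclidean_space \<Rightarrow> real"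
  assumes Z [measurable]: "Z \<in> borel_measurable borel"
    and int: "\<And>a b. integrable lborel (\<lambda>p. indicator (box a b) p * Z p)"
    and zero: "\<And>a b. (LINT p|lborel. indicator (box a b) p * Z p) = 0"
  shows "AE p in lborel. Z p = 0"
proof -
  \<comment> \<open>\<open>ennreal\<close> sends negative reals to 0, so the density of
    \<open>Y\<close> sees only its positive part; the statement is used for \<open>Z\<close> and for
    its negative.\<close>
  have box: "emeasure (density lborel (\<lambda>p. ennreal (Y p))) (box a b) =
      ennreal (LINT p|lborel. indicator (box a b) p * max 0 (Y p))"
    if Y [measurable]: "Y \<in> borel_measurable borel" and i: "integrable lborel (\<lambda>p. indicator (box a b) p * Y p)"
    for Y :: "'a \<Rightarrow> real" and a b
  proof -
    have "emeasure (density lborel (\<lambda>p. ennreal (Y p))) (box a b) =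
        (\<integral>\<^sup>+p. ennreal (indicator (box a b) p * max 0 (Y p)) \<partial>lborel)"
      by (subst emeasure_density) (auto intro!: nn_integral_cong simp: indicator_def max_def ennreal_neg)
    also have "\<dots> = ennreal (LINT p|lborel. indicator (box a b) p * max 0 (Y p))"
    proof (rule nn_integral_eq_integral)
      have "integrable lborel (\<lambda>p. max 0 (indicator (box a b) p * Y p))" using i by auto
      moreover have "(\<lambda>p. max 0 (indicator (box a b) p * Y p)) = (\<lambda>p. indicator (box a b) p * max 0 (Y p))"
        by (auto simp: indicator_def)
      ultimately show "integrable lborel (\<lambda>p. indicator (box a b) p * max 0 (Y p))" by simp
    qed auto
    finally show ?thesis .
  qed
  have int': "integrable lborel (\<lambda>p. indicator (box a b) p * - Z p)" for a b
    using int[of a b] by simp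
  have pos: "integrable lborel (\<lambda>p. indicator (box a b) p * max 0 (Z p))"
    "integrable lborel (\<lambda>p. indicator (box a b) p * max 0 (- Z p))" for a b
  proof -
    have "(\<lambda>p. max 0 (indicator (box a b) p * Y p)) = (\<lambda>p. indicator (box a b) p * max 0 (Y p))"
      for Y :: "'a \<Rightarrow> real" by (auto simp: indicator_def)
    note this[of Z, symmetric] this[of "\<lambda>p. - Z p", symmetric]
    moreover have "integrable lborel (\<lambda>p. max 0 (indicator (box a b) p * Z p))"
      "integrable lborel (\<lambda>p. max 0 (indicator (box a b) p * - Z p))"
      using int int' by (auto simp del: mult_minus_right)
    ultimately show "integrable lborel (\<lambda>p. indicator (box a b) p * max 0 (Z p))"
      "integrable lborel (\<lambda>p. indicator (box a b) p * max 0 (- Z p))" by (simp_all only:)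
  qed
  have eq: "(LINT p|lborel. indicator (box a b) p * max 0 (Z p)) =
      (LINT p|lborel. indicator (box a b) p * max 0 (- Z p))" for a b
  proof -
    have "(LINT p|lborel. indicator (box a b) p * max 0 (Z p)) -
        (LINT p|lborel. indicator (box a b) p * max 0 (- Z p)) =
        (LINT p|lborel. indicator (box a b) p * max 0 (Z p) - indicator (box a b) p * max 0 (- Z p))"
      by (rule Bochner_Integration.integral_diff[OF pos, symmetric])
    also have "\<dots> = (LINT p|lborel. indicator (box a b) p * Z p)"
      by (rule Bochner_Integration.integral_cong) (auto simp: max_def)
    finally show ?thesis using zero by simp
  qed
  have "density lborel (\<lambda>p. ennreal (Z p)) = density lborel (\<lambda>p. ennreal (- Z p))" (is "?M = ?N")
  proof (rule measure_eqI_generator_eq)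
    let ?E = "range (\<lambda>(a, b). box a b::'a set)"
    show "Int_stable ?E" by (auto simp: Int_stable_def box_Int_box)
    show "?E \<subseteq> Pow UNIV" "sets ?M = sigma_sets UNIV ?E" "sets ?N = sigma_sets UNIV ?E"
      by (simp_all add: borel_eq_box)
    let ?A = "\<lambda>n::nat. box (- (real n *\<^sub>R One)) (real n *\<^sub>R One) :: 'a set"
    show "range ?A \<subseteq> ?E" "(\<Union>i. ?A i) = UNIV"
      unfolding UN_box_eq_UNIV by auto
    show "emeasure ?M (?A i) \<noteq> \<infinity>" for i by (simp add: box[OF Z int])
    show "emeasure ?M X = emeasure ?N X" if "X \<in> ?E" for X
    proof -
      obtain a b where X: "X = box a b" using \<open>X \<in> ?E\<close> by auto
      have "(\<lambda>p. - Z p) \<in> borel_measurable borel" by measurable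
      from box[OF this int'] box[OF Z int] eq show ?thesis unfolding X by simp
    qed
  qed
  \<comment> \<open>Densities over a sigma-finite measure are unique almost everywhere, and a real
    number agrees with its negative after truncation at 0 only if it is 0.\<close>
  then have "AE p in lborel. ennreal (Z p) = ennreal (- Z p)"
    by (intro sigma_finite_measure.density_unique[OF sigma_finite_lborel]) auto
  then show ?thesis
  proof eventually_elim
    fix p assume "ennreal (Z p) = ennreal (- Z p)"
    then show "Z p = 0" by (cases "0 \<le> Z p") (auto simp: ennreal_neg ennreal_eq_0_iff)
  qed
qed

lemma in_L2_box_integrable:
  fixes u :: "real^2 \<Rightarrow> real"
  assumes "in_L2 u"
  shows "integrable lebesgue (\<lambda>p. indicator (box a b) p * u p)"
proof (rule in_L2_integrable_mult[OF _ assms])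
  show "in_L2 (indicator (box a b) :: real^2 \<Rightarrow> real)"
  proof (rule in_L2_nn_integral)
    have "ennreal ((indicator (box a b) p)\<^sup>2) = indicator (box a b) p" for p
      by (auto simp: indicator_def)
    then have "(\<integral>\<^sup>+p. ennreal ((indicator (box a b) p)\<^sup>2) \<partial>lborel) = emeasure lborel (box a b)"
      by simp
    then show "(\<integral>\<^sup>+p. ennreal ((indicator (box a b) p)\<^sup>2) \<partial>lborel) < \<infinity>"
      using emeasure_lborel_box_finite[of a b] by simp
  qed auto
qed

text \<open>Smooth bumps that converge to the indicator of a box show, by dominated convergence,
  that all box integrals of \<open>Z\<close> vanish; the box criterion then applies.\<close>

lemma fundamental_lemma:
  fixes Z :: "real^2 \<Rightarrow> real"
  assumes Z: "in_L2 Z" and orth: "\<And>\<psi>. test_function \<psi> \<Longrightarrow> (LINT p|lebesgue. Z p * \<psi> p) = 0"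
  shows "AE p in lebesgue. Z p = 0"
proof -
  have zero: "(LINT p|lebesgue. indicator (box a b) p * Z p) = 0" for a b
  proof -
    have "(\<lambda>n. LINT p|lebesgue. Z p * box_bump a b n p) \<longlonglongrightarrow> (LINT p|lebesgue. indicator (box a b) p * Z p)"
    proof (rule integral_dominated_convergence)
      show "(\<lambda>p. indicator (box a b) p * Z p) \<in> borel_measurable lebesgue"
        using in_L2_measurable[OF Z] by (intro borel_measurable_times borel_measurable_indicator) auto
      show "(\<lambda>p. Z p * box_bump a b n p) \<in> borel_measurable lebesgue" for n
        using in_L2_measurable[OF Z] borel_imp_lebesgue_measurable[OF smooth_borel[OF smooth_box_bump]]
        by (rule borel_measurable_times)
      show "integrable lebesgue (\<lambda>p. \<bar>indicator (box a b) p * Z p\<bar>)"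
        by (rule integrable_abs[OF in_L2_box_integrable[OF Z]])
      show "AE p in lebesgue. (\<lambda>n. Z p * box_bump a b n p) \<longlonglongrightarrow> indicator (box a b) p * Z p"
        by (rule AE_I2) (subst (2) mult.commute, rule tendsto_mult[OF tendsto_const box_bump_tendsto])
      have "norm (Z p * box_bump a b n p) \<le> \<bar>indicator (box a b) p * Z p\<bar>" for n p
        using box_bump_bounds[of a b n p] box_bump_eq_0[of p a b n]
        by (cases "p \<in> box a b") (auto simp: abs_mult intro!: mult_left_le)
      then show "AE p in lebesgue. norm (Z p * box_bump a b n p) \<le> \<bar>indicator (box a b) p * Z p\<bar>" for n
        by simp
    qed
    moreover have "(\<lambda>n. LINT p|lebesgue. Z p * box_bump a b n p) = (\<lambda>n. 0)"
      by (rule ext) (rule orth[OF box_bump_test_function])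
    ultimately show ?thesis using LIMSEQ_unique[OF _ tendsto_const] by metis
  qed
  \<comment> \<open>The box criterion concerns Borel functions, so \<open>Z\<close> is replaced by a
    Borel function equal to it almost everywhere.\<close>
  obtain Y where Y [measurable]: "Y \<in> borel_measurable lborel" and eq: "AE p in lborel. Z p = Y p"
    using completion_ex_borel_measurable_real[OF in_L2_measurable[OF Z]] by blast
  have eq': "AE p in lebesgue. Z p = Y p" using eq by (rule AE_completion)
  have Yb: "Y \<in> borel_measurable borel" using Y by simp
  have Ym: "(\<lambda>p. indicator (box a b) p * Y p) \<in> borel_measurable borel" for a b
    by (intro borel_measurable_times borel_measurable_indicator Yb) simp
  have ae: "AE p in lebesgue. indicator (box a b) p * Z p = indicator (box a b) p * Y p" for a b
    using eq' by eventually_elim simp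
  have m: "(\<lambda>p. indicator (box a b) p * Z p) \<in> borel_measurable lebesgue" for a b
    by (rule borel_measurable_integrable[OF in_L2_box_integrable[OF Z]])
  have "AE p in lborel. Y p = 0"
  proof (rule AE_zero_if_box_integrals_zero[OF Yb])
    show "integrable lborel (\<lambda>p. indicator (box a b) p * Y p)" for a b
      using Bochner_Integration.integrable_cong_AE[OF m borel_imp_lebesgue_measurable[OF Ym] ae]
        in_L2_box_integrable[OF Z] integrable_lebesgue_borel[OF Ym] by blast
    show "(LINT p|lborel. indicator (box a b) p * Y p) = 0" for a b
      using Bochner_Integration.integral_cong_AE[OF m borel_imp_lebesgue_measurable[OF Ym] ae] zero
        LINT_lebesgue_borel[OF Ym] by simp
  qed
  then have "AE p in lebesgue. Y p = 0" by (rule AE_completion)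
  with eq' show ?thesis by eventually_elim simp
qed

subsection \<open>Weak Hessians\<close>

abbreviation entry :: "(real^2 \<Rightarrow> real^2^2) \<Rightarrow> 2 \<Rightarrow> 2 \<Rightarrow> real^2 \<Rightarrow> real" where
  "entry H i j \<equiv> (\<lambda>p. vec_nth (vec_nth (H p) i) j)"

lemma weak_hessian_L2: "is_weak_hessian u H \<Longrightarrow> in_L2 (entry H i j)"
  by (simp add: is_weak_hessian_def)

lemma weak_hessian_partial:
  "is_weak_hessian u H \<Longrightarrow> test_function \<psi> \<Longrightarrow>
    (LINT p|lebesgue. u p * partial i (partial j \<psi>) p) = (LINT p|lebesgue. entry H i j p * \<psi> p)"
  by (simp add: is_weak_hessian_def weak_partial2_def)

lemma is_weak_hessian_diff:
  assumes u: "continuous_on UNIV u" "is_weak_hessian u H" and v: "continuous_on UNIV v" "is_weak_hessian v G"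
  shows "is_weak_hessian (\<lambda>p. u p - v p) (\<lambda>p. H p - G p)"
  unfolding is_weak_hessian_def weak_partial2_def
proof (intro allI conjI impI)
  fix i j
  show "in_L2 (entry (\<lambda>p. H p - G p) i j)"
    using in_L2_diff[OF weak_hessian_L2[OF u(2)] weak_hessian_L2[OF v(2)]] by simp
  fix \<psi> assume \<psi>: "test_function \<psi>"
  have t: "test_function (partial i (partial j \<psi>))" by (intro test_function_partial \<psi>)
  have "(LINT p|lebesgue. (u p - v p) * partial i (partial j \<psi>) p) =
      (LINT p|lebesgue. u p * partial i (partial j \<psi>) p) - (LINT p|lebesgue. v p * partial i (partial j \<psi>) p)"
    unfolding left_diff_distrib
    by (rule Bochner_Integration.integral_diff[OF test_function_integrable[OF u(1) t] test_function_integrable[OF v(1) t]])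
  also have "\<dots> = (LINT p|lebesgue. entry H i j p * \<psi> p) - (LINT p|lebesgue. entry G i j p * \<psi> p)"
    by (simp only: weak_hessian_partial[OF u(2) \<psi>] weak_hessian_partial[OF v(2) \<psi>])
  also have "\<dots> = (LINT p|lebesgue. entry (\<lambda>p. H p - G p) i j p * \<psi> p)"
    using in_L2_integrable_mult[OF weak_hessian_L2[OF u(2)] in_L2_test_function[OF \<psi>]]
      in_L2_integrable_mult[OF weak_hessian_L2[OF v(2)] in_L2_test_function[OF \<psi>]]
    by (simp add: left_diff_distrib)
  finally show "(LINT p|lebesgue. (u p - v p) * partial i (partial j \<psi>) p) =
      (LINT p|lebesgue. entry (\<lambda>p. H p - G p) i j p * \<psi> p)" .
qed

text \<open>Entry by entry, the difference of two weak Hessians is orthogonal to every test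
  function.\<close>

lemma is_weak_hessian_AE_unique:
  assumes "is_weak_hessian u H" "is_weak_hessian u G"
  shows "AE p in lebesgue. H p = G p"
proof -
  have "AE p in lebesgue. entry H i j p - entry G i j p = 0" for i j
  proof (rule fundamental_lemma)
    show "in_L2 (\<lambda>p. entry H i j p - entry G i j p)"
      by (rule in_L2_diff[OF weak_hessian_L2[OF assms(1)] weak_hessian_L2[OF assms(2)]])
    fix \<psi> :: "real^2 \<Rightarrow> real" assume \<psi>: "test_function \<psi>"
    show "(LINT p|lebesgue. (entry H i j p - entry G i j p) * \<psi> p) = 0"
      using in_L2_integrable_mult[OF weak_hessian_L2[OF assms(1)] in_L2_test_function[OF \<psi>]]
        in_L2_integrable_mult[OF weak_hessian_L2[OF assms(2)] in_L2_test_function[OF \<psi>]]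
        weak_hessian_partial[OF assms(1) \<psi>] weak_hessian_partial[OF assms(2) \<psi>]
      by (simp add: left_diff_distrib)
  qed
  then have "AE p in lebesgue. \<forall>i\<in>UNIV. \<forall>j\<in>UNIV. entry H i j p - entry G i j p = 0"
    by (intro AE_finite_allI) auto
  then show ?thesis by eventually_elim (simp add: Finite_Cartesian_Product.vec_eq_iff)
qed

lemma norm_matrix_sq:
  "(norm (A :: real^2^2))\<^sup>2 = (\<Sum>i\<in>UNIV. \<Sum>j\<in>UNIV. (vec_nth (vec_nth A i) j)\<^sup>2)"
  by (simp add: norm_vec_def L2_set_def sum_nonneg)

text \<open>Frees \<open>roughness\<close> from the choice behind \<open>weak_hessian\<close>: any
  weak Hessian differs from the chosen one only on a null set.\<close>

lemma roughness_eq: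
  assumes "is_weak_hessian u H"
  shows "roughness u = (LINT p|lebesgue. (norm (H p))\<^sup>2)"
  unfolding roughness_def
proof (rule Bochner_Integration.integral_cong_AE)
  have w: "is_weak_hessian u (weak_hessian u)"
    unfolding weak_hessian_def by (rule someI[of "is_weak_hessian u", OF assms])
  show "AE p in lebesgue. (norm (weak_hessian u p))\<^sup>2 = (norm (H p))\<^sup>2"
    using is_weak_hessian_AE_unique[OF w assms] by eventually_elim simp
  show "(\<lambda>p. (norm (weak_hessian u p))\<^sup>2) \<in> borel_measurable lebesgue"
    unfolding norm_matrix_sq
    by (intro borel_measurable_sum borel_measurable_power in_L2_measurable weak_hessian_L2[OF w])
  show "(\<lambda>p. (norm (H p))\<^sup>2) \<in> borel_measurable lebesgue"
    unfolding norm_matrix_sq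
    by (intro borel_measurable_sum borel_measurable_power in_L2_measurable weak_hessian_L2[OF assms])
qed

lemma test_function_weak_hessian:
  assumes "test_function u"
  shows "is_weak_hessian u (\<lambda>p. vec_lambda (\<lambda>i. vec_lambda (\<lambda>j. partial j (partial i u) p)))"
  unfolding is_weak_hessian_def weak_partial2_def
  using in_L2_test_function[OF test_function_partial[OF test_function_partial[OF assms]]]
  by (auto simp: integration_by_parts2 test_function_smooth[OF assms])

section \<open>Growth of functions with square-integrable Hessian\<close>

text \<open>The dilation derivative: differentiating s^-k u(p / s) in s gives -s^-(k+1) times
  \<open>euler k u\<close> at p / s.\<close>

definition euler :: "nat \<Rightarrow> (real^2 \<Rightarrow> real) \<Rightarrow> real^2 \<Rightarrow> real" where
  "euler k u p = real k * u p + (\<Sum>i\<in>UNIV. partial i u p * vec_nth p i)"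

lemma smooth_euler: "smooth u \<Longrightarrow> smooth (euler k u)"
  unfolding euler_def[abs_def]
  by (intro smooth_add smooth_cmult smooth_sum smooth_mult smooth_partial smooth_coord)

lemma euler_eq_0:
  assumes "\<And>p. R < norm p \<Longrightarrow> u p = 0" "R < norm p"
  shows "euler k u p = 0"
  unfolding euler_def using assms partial_eq_0[OF assms] by simp

lemma euler_scale: "smooth u \<Longrightarrow> euler k (\<lambda>p. u (c *\<^sub>R p)) = (\<lambda>p. euler k u (c *\<^sub>R p))"
  by (simp add: euler_def fun_eq_iff partial_scale sum_2 mult_ac)

text \<open>Both operators are a constant plus the same first-order operator p . grad.\<close>

lemma euler_commute:
  assumes "smooth u"
  shows "euler k (euler l u) = euler l (euler k u)"
proof -
  have "partial i (euler k u) p = real k * partial i u p + partial i (\<lambda>p. \<Sum>i\<in>UNIV. partial i u p * vec_nth p i) p"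
    for k i p
    unfolding euler_def[abs_def] using assms
    by (simp add: partial_smooth_add partial_cmult smooth_cmult smooth_sum smooth_mult smooth_partial)
  then show ?thesis
    by (simp add: fun_eq_iff) (simp add: euler_def sum_2 algebra_simps)
qed

lemma divergence_coord_mult:
  assumes "smooth u"
  shows "(\<Sum>j\<in>UNIV. partial j (\<lambda>p. vec_nth p j * u p) p) = euler 2 u p"
  using assms by (simp add: euler_def partial_smooth_mult partial_coord sum.distrib sum_2)

text \<open>Compared with the divergence of p u, the extra factor p_i contributes one more u, which
  raises the index from 2 to 3.\<close>

lemma divergence_coord_mult2:
  assumes "smooth u"
  shows "(\<Sum>j\<in>UNIV. partial j (\<lambda>p. vec_nth p i * vec_nth p j * u p) p) = vec_nth p i * euler 3 u p"
  using assms exhaust_2[of i]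
  by (auto simp: euler_def partial_smooth_mult smooth_mult partial_coord sum_2 algebra_simps)

text \<open>The two divergences give \<open>euler 2\<close> applied to \<open>euler 3 u\<close>; the
  factors are then commuted into the order in which two s-derivatives of s^-2 u(p / s) produce
  them.\<close>

lemma double_divergence_coord_mult:
  assumes "smooth u"
  shows "(\<Sum>i\<in>UNIV. \<Sum>j\<in>UNIV. partial i (partial j (\<lambda>p. vec_nth p i * vec_nth p j * u p)) p) = euler 3 (euler 2 u) p"
proof -
  have s: "smooth (partial j (\<lambda>p. vec_nth p i * vec_nth p j * u p))" for i j
    by (intro smooth_partial smooth_mult smooth_coord assms)
  have "(\<Sum>i\<in>UNIV. \<Sum>j\<in>UNIV. partial i (partial j (\<lambda>p. vec_nth p i * vec_nth p j * u p)) p) =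
    (\<Sum>i\<in>UNIV. partial i (\<lambda>p. vec_nth p i * euler 3 u p) p)"
    by (simp only: divergence_coord_mult2[OF assms, symmetric] partial_sum[OF s])
  also have "\<dots> = euler 3 (euler 2 u) p"
    by (simp add: divergence_coord_mult[OF smooth_euler[OF assms]] euler_commute[OF assms, of 2])
  finally show ?thesis .
qed

(* With m = scaled_mean h 2 phi and f = phi(p / s), the second derivative in s of s^-2 f is
   s^-4 times the sum of D_i D_j (p_i p_j f); so m'' is an integral of the weak Hessian of h. *)
definition scaled_mean :: "(real^2 \<Rightarrow> real) \<Rightarrow> nat \<Rightarrow> (real^2 \<Rightarrow> real) \<Rightarrow> real \<Rightarrow> real" where
  "scaled_mean h k \<psi> s = (LINT p|lebesgue. h p * (inverse s ^ k * \<psi> (p /\<^sub>R s)))"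

lemma scaled_mean_derivative:
  assumes h: "continuous_on UNIV h" and \<psi>: "smooth \<psi>" "\<And>p. R < norm p \<Longrightarrow> \<psi> p = 0" and s: "0 < s" and R: "0 \<le> R"
  shows "(scaled_mean h k \<psi> has_real_derivative - scaled_mean h (Suc k) (euler k \<psi>) s) (at s)"
proof -
  \<comment> \<open>For all scales t below s + 1 the dilated function vanishes outside radius R (s +
    1), the common support radius needed to differentiate under the integral.\<close>
  have far: "R < norm (p /\<^sub>R t)" if "t \<in> {0<..<s + 1}" "R * (s + 1) < norm p" for t p
  proof -
    have "R * t \<le> R * (s + 1)" using that(1) R by (intro mult_left_mono) auto
    with that have "R * t < norm p" by linarith
    with that(1) show ?thesis by (simp add: field_simps)
  qed
  have cont: "continuous_on ({0<..<s + 1} \<times> UNIV) (\<lambda>x. h (snd x) * (inverse (fst x) ^ l * u (snd x /\<^sub>R fst x)))"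
    if "smooth u" for u l
    by (intro continuous_intros continuous_on_compose2[OF h] continuous_on_compose2[OF smooth_continuous[OF that, of UNIV]]) auto
  have "((\<lambda>s. LINT p|lebesgue. h p * (inverse s ^ k * \<psi> (p /\<^sub>R s))) has_real_derivative
      (LINT p|lebesgue. - (h p * (inverse s ^ Suc k * euler k \<psi> (p /\<^sub>R s))))) (at s)"
  proof (rule LINT_has_real_derivative[where U = "{0<..<s + 1}" and R = "R * (s + 1)"
        and f' = "\<lambda>s p. - (h p * (inverse s ^ Suc k * euler k \<psi> (p /\<^sub>R s)))"])
    show "continuous_on UNIV (\<lambda>p. h p * (inverse t ^ k * \<psi> (p /\<^sub>R t)))" for t
      by (intro continuous_intros h continuous_on_compose2[OF smooth_continuous[OF \<psi>(1), of UNIV]]) auto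
    show "h p * (inverse t ^ k * \<psi> (p /\<^sub>R t)) = 0" if "t \<in> {0<..<s + 1}" "R * (s + 1) < norm p" for t p
      using \<psi>(2)[OF far[OF that]] by simp
    show "- (h p * (inverse t ^ Suc k * euler k \<psi> (p /\<^sub>R t))) = 0"
      if "t \<in> {0<..<s + 1}" "R * (s + 1) < norm p" for t p
      using euler_eq_0[OF \<psi>(2) far[OF that]] by simp
    show "continuous_on ({0<..<s + 1} \<times> UNIV) (\<lambda>(t, p). - (h p * (inverse t ^ Suc k * euler k \<psi> (p /\<^sub>R t))))"
      using continuous_on_minus[OF cont[of "euler k \<psi>" "Suc k", OF smooth_euler[OF \<psi>(1)]]]
      by (simp add: case_prod_beta)
    show "((\<lambda>s. h p * (inverse s ^ k * \<psi> (p /\<^sub>R s))) has_real_derivative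
        - (h p * (inverse t ^ Suc k * euler k \<psi> (p /\<^sub>R t)))) (at t)" if "t \<in> {0<..<s + 1}" for t p
    proof -
      have t: "t \<noteq> 0" using that by auto
      have "((\<lambda>s. p /\<^sub>R s) has_vector_derivative - (inverse t * inverse t) *\<^sub>R p) (at t)"
        using t by (auto intro!: derivative_eq_intros simp: has_vector_derivative_def has_field_derivative_def[symmetric] power2_eq_square fun_eq_iff)
      from partial_line_derivative[OF \<psi>(1) this]
      have d: "((\<lambda>s. \<psi> (p /\<^sub>R s)) has_real_derivative
          - inverse t * (\<Sum>i\<in>UNIV. partial i \<psi> (p /\<^sub>R t) * vec_nth (p /\<^sub>R t) i)) (at t)"
        by (simp add: sum_distrib_left sum_2 algebra_simps)
      have "((\<lambda>s. inverse s ^ k) has_real_derivative - real k * inverse t ^ Suc k) (at t)"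
      proof (cases k)
        case (Suc j)
        have "((\<lambda>s. inverse s ^ k) has_real_derivative real k * (- (inverse t * inverse t) * inverse t ^ (k - 1))) (at t)"
          using t by (auto intro!: derivative_eq_intros)
        then show ?thesis by (rule DERIV_cong) (simp add: Suc algebra_simps)
      qed simp
      from DERIV_cmult[OF DERIV_mult[OF this d], of "h p"]
      show ?thesis
        by (rule DERIV_cong) (simp add: euler_def algebra_simps)
    qed
  qed (use s in auto)
  then show ?thesis by (simp add: scaled_mean_def[abs_def])
qed

text \<open>Young's inequality |u v| \<le> c u^2 + B^2 / c, integrated over the disc of area pi R^2.
  The free weight c is later matched to the scale of v.\<close>

lemma LINT_weighted_bound:
  fixes u v :: "real^2 \<Rightarrow> real"
  assumes u: "in_L2 u" and v: "in_L2 v" "\<And>p. R < norm p \<Longrightarrow> v p = 0" "\<And>p. \<bar>v p\<bar> \<le> B"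
    and "0 < c" "0 \<le> R"
  shows "\<bar>LINT p|lebesgue. u p * v p\<bar> \<le> c * (LINT p|lebesgue. (u p)\<^sup>2) + B\<^sup>2 / c * (pi * R\<^sup>2)"
proof -
  have ball: "emeasure lborel (cball (0 :: real^2) R) = ennreal (pi * R\<^sup>2)"
    using assms by (simp add: emeasure_cball unit_ball_vol_2)
  have i: "integrable lborel (indicator (cball (0 :: real^2) R) :: real^2 \<Rightarrow> real)"
    by (rule integrable_real_indicator) (simp_all add: ball)
  then have i': "integrable lebesgue (indicator (cball (0 :: real^2) R) :: real^2 \<Rightarrow> real)"
    by (subst integrable_lebesgue_borel) (auto intro!: borel_measurable_indicator)
  have vol: "measure lborel (cball (0 :: real^2) R) = pi * R\<^sup>2"
    using assms by (simp add: measure_def ball)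
  have "\<bar>u p * v p\<bar> \<le> c * (u p)\<^sup>2 + B\<^sup>2 / c * indicator (cball 0 R) p" for p
  proof (cases "R < norm p")
    case True
    with assms show ?thesis by (simp add: indicator_def)
  next
    case False
    have "0 \<le> (c * \<bar>u p\<bar> - B)\<^sup>2" "0 \<le> (c * \<bar>u p\<bar>)\<^sup>2" "0 \<le> B\<^sup>2" by simp_all
    moreover have "(c * \<bar>u p\<bar> - B)\<^sup>2 = (c * \<bar>u p\<bar>)\<^sup>2 + B\<^sup>2 - 2 * (c * (\<bar>u p\<bar> * B))"
      by (simp add: power2_diff mult.assoc)
    ultimately have "c * (\<bar>u p\<bar> * B) \<le> (c * \<bar>u p\<bar>)\<^sup>2 + B\<^sup>2" by linarith
    then have "\<bar>u p\<bar> * B \<le> c * (u p)\<^sup>2 + B\<^sup>2 / c"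
      using \<open>0 < c\<close> by (simp add: field_simps power2_eq_square)
    moreover have "\<bar>u p\<bar> * \<bar>v p\<bar> \<le> \<bar>u p\<bar> * B" by (intro mult_left_mono v) simp
    ultimately show ?thesis using False by (simp add: abs_mult indicator_def)
  qed
  then have "(LINT p|lebesgue. \<bar>u p * v p\<bar>) \<le> (LINT p|lebesgue. c * (u p)\<^sup>2 + B\<^sup>2 / c * indicator (cball 0 R) p)"
    by (intro integral_mono integrable_abs in_L2_integrable_mult u v Bochner_Integration.integrable_add
        integrable_mult_right in_L2_integrable_square i') auto
  also have "\<dots> = c * (LINT p|lebesgue. (u p)\<^sup>2) + B\<^sup>2 / c * (pi * R\<^sup>2)"
    using i' in_L2_integrable_square[OF u] by (simp add: vol)
  finally show ?thesis
    using integral_abs_bound[of lebesgue "\<lambda>p. u p * v p"] by linarith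
qed

text \<open>The double divergence turns the second derivative of the mean into a pairing of the weak
  Hessian with p_i p_j \<phi>(p / s). The constant must not depend on \<phi>, because the weights
  used later vary with the regularisation and the radius.\<close>

lemma scaled_mean_second_derivative_bound:
  assumes h: "continuous_on UNIV h" "is_weak_hessian h H"
  shows "\<exists>C\<ge>0. \<forall>\<phi> M s. smooth \<phi> \<longrightarrow> (\<forall>p. 2 < norm p \<longrightarrow> \<phi> p = 0) \<longrightarrow> (\<forall>p. \<bar>\<phi> p\<bar> \<le> M) \<longrightarrow>
      0 < M \<longrightarrow> 0 < s \<longrightarrow> \<bar>scaled_mean h 4 (euler 3 (euler 2 \<phi>)) s\<bar> \<le> C * M / s"
proof -
  let ?C = "\<Sum>i\<in>UNIV. \<Sum>j\<in>UNIV. (LINT p|lebesgue. (entry H i j p)\<^sup>2) + 64 * pi"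
  show ?thesis
  proof (intro exI[of _ ?C] conjI allI impI)
    show "0 \<le> ?C" by (intro sum_nonneg add_nonneg_nonneg integral_nonneg_AE) auto
    fix \<phi> :: "real^2 \<Rightarrow> real" and M s :: real
    assume "smooth \<phi>" "\<forall>p. 2 < norm p \<longrightarrow> \<phi> p = 0" "\<forall>p. \<bar>\<phi> p\<bar> \<le> M" and M: "0 < M" and s: "0 < s"
    then have \<phi>: "smooth \<phi>" "\<And>p. 2 < norm p \<Longrightarrow> \<phi> p = 0" "\<And>p. \<bar>\<phi> p\<bar> \<le> M" by blast+
    define \<psi> where "\<psi> i j p = vec_nth p i * vec_nth p j * \<phi> (p /\<^sub>R s)" for i j and p :: "real^2"
    have sm: "smooth (\<lambda>p. \<phi> (p /\<^sub>R s))" by (rule smooth_scale[OF \<phi>(1)])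
    have far: "2 < norm (p /\<^sub>R s)" if "2 * s < norm p" for p :: "real^2" using that s by (simp add: field_simps)
    have \<psi>0: "\<psi> i j p = 0" if "2 * s < norm p" for i j p
      using \<phi>(2)[OF far[OF that]] by (simp add: \<psi>_def)
    have test: "test_function (\<psi> i j)" for i j
      unfolding \<psi>_def[abs_def]
      by (rule test_functionI[where R = "2 * s"])
        (use \<psi>0 in \<open>auto simp: \<psi>_def intro!: smooth_mult sm\<close>)
    have bound: "\<bar>\<psi> i j p\<bar> \<le> 4 * s\<^sup>2 * M" for i j p
    proof (cases "2 * s < norm p")
      case False
      have "\<bar>vec_nth p i\<bar> \<le> 2 * s" "\<bar>vec_nth p j\<bar> \<le> 2 * s"
        using False component_le_norm_cart[of p i] component_le_norm_cart[of p j] by linarith+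
      then have "\<bar>\<psi> i j p\<bar> \<le> 2 * s * (2 * s) * M"
        unfolding \<psi>_def abs_mult using s M by (intro mult_mono \<phi>(3)) auto
      then show ?thesis by (simp add: power2_eq_square)
    qed (use \<psi>0 s M in simp)
    \<comment> \<open>The test function has size at most 4 s^2 M on the disc of radius 2 s. The
      choice c = M s^3 balances the two terms of the weighted bound: the second becomes 64 pi M
      s^3.\<close>
    have one: "\<bar>LINT p|lebesgue. entry H i j p * \<psi> i j p\<bar> \<le>
        M * s ^ 3 * ((LINT p|lebesgue. (entry H i j p)\<^sup>2) + 64 * pi)" for i j
    proof -
      have "\<bar>LINT p|lebesgue. entry H i j p * \<psi> i j p\<bar> \<le>
        M * s ^ 3 * (LINT p|lebesgue. (entry H i j p)\<^sup>2) + (4 * s\<^sup>2 * M)\<^sup>2 / (M * s ^ 3) * (pi * (2 * s)\<^sup>2)"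
        using \<psi>0 bound s M
        by (intro LINT_weighted_bound weak_hessian_L2[OF h(2)] in_L2_test_function test) auto
      also have "(4 * s\<^sup>2 * M)\<^sup>2 / (M * s ^ 3) * (pi * (2 * s)\<^sup>2) = M * s ^ 3 * (64 * pi)"
        using s M by (simp add: field_simps eval_nat_numeral)
      finally show ?thesis by (simp add: algebra_simps)
    qed
    have "(LINT p|lebesgue. h p * euler 3 (euler 2 \<phi>) (p /\<^sub>R s)) =
        (LINT p|lebesgue. (\<Sum>i\<in>UNIV. \<Sum>j\<in>UNIV. h p * partial i (partial j (\<psi> i j)) p))"
    proof -
      have "euler 3 (euler 2 \<phi>) (p /\<^sub>R s) = (\<Sum>i\<in>UNIV. \<Sum>j\<in>UNIV. partial i (partial j (\<psi> i j)) p)" for p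
        unfolding \<psi>_def[abs_def] double_divergence_coord_mult[OF sm]
        by (simp add: euler_scale \<phi>(1) smooth_euler)
      then show ?thesis by (simp add: sum_distrib_left)
    qed
    also have "\<dots> = (\<Sum>i\<in>UNIV. \<Sum>j\<in>UNIV. LINT p|lebesgue. h p * partial i (partial j (\<psi> i j)) p)"
      by (simp add: test_function_integrable[OF h(1) test_function_partial[OF test_function_partial[OF test]]])
    also have "\<dots> = (\<Sum>i\<in>UNIV. \<Sum>j\<in>UNIV. LINT p|lebesgue. entry H i j p * \<psi> i j p)"
      by (simp only: weak_hessian_partial[OF h(2) test])
    also have "\<bar>\<dots>\<bar> \<le> (\<Sum>i\<in>UNIV. \<Sum>j\<in>UNIV. M * s ^ 3 * ((LINT p|lebesgue. (entry H i j p)\<^sup>2) + 64 * pi))"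
      by (intro sum_abs[THEN order_trans] sum_mono one)
    also have "\<dots> = M * s ^ 3 * ?C" by (simp add: sum_distrib_left)
    finally have "\<bar>LINT p|lebesgue. h p * euler 3 (euler 2 \<phi>) (p /\<^sub>R s)\<bar> \<le> M * s ^ 3 * ?C" .
    then have "inverse s ^ 4 * \<bar>LINT p|lebesgue. h p * euler 3 (euler 2 \<phi>) (p /\<^sub>R s)\<bar> \<le> inverse s ^ 4 * (M * s ^ 3 * ?C)"
      using s by (intro mult_left_mono) auto
    also have "inverse s ^ 4 * (M * s ^ 3 * ?C) = ?C * M / s"
      using s by (simp add: field_simps eval_nat_numeral)
    also have "inverse s ^ 4 * \<bar>LINT p|lebesgue. h p * euler 3 (euler 2 \<phi>) (p /\<^sub>R s)\<bar> =
        \<bar>scaled_mean h 4 (euler 3 (euler 2 \<phi>)) s\<bar>"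
    proof -
      have "scaled_mean h 4 (euler 3 (euler 2 \<phi>)) s =
          inverse s ^ 4 * (LINT p|lebesgue. h p * euler 3 (euler 2 \<phi>) (p /\<^sub>R s))"
        unfolding scaled_mean_def by (subst integral_mult_right_zero[symmetric]) (simp add: mult_ac)
      then show ?thesis using s by (simp add: abs_mult)
    qed
    finally show "\<bar>scaled_mean h 4 (euler 3 (euler 2 \<phi>)) s\<bar> \<le> ?C * M / s" .
  qed
qed

text \<open>Since 1/s \<le> 1/sqrt s for s \<ge> 1, two integrations give order sqrt s for m' and
  order s sqrt s for m. The initial data are two values of m.\<close>

lemma growth_from_second_derivative:
  fixes m m1 m2 :: "real \<Rightarrow> real"
  assumes m: "\<And>s. 1 \<le> s \<Longrightarrow> (m has_real_derivative m1 s) (at s)"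
    and m1: "\<And>s. 1 \<le> s \<Longrightarrow> (m1 has_real_derivative m2 s) (at s)"
    and m2: "\<And>s. 1 \<le> s \<Longrightarrow> \<bar>m2 s\<bar> \<le> C / s"
    and b: "\<bar>m 1\<bar> \<le> B" "\<bar>m 2\<bar> \<le> B" and C: "0 \<le> C" and t: "1 \<le> t"
  shows "\<bar>m t\<bar> \<le> (3 * B + 6 * C) * (t * sqrt t)"
proof -
  have B: "0 \<le> B" using b(1) by linarith
  \<comment> \<open>The mean value theorem converts the two known values of m into one bounded value
    of m'.\<close>
  obtain z where z: "1 < z" "z < 2" "m 2 - m 1 = (2 - 1) * m1 z"
    using MVT2[of 1 2 m m1] m by auto
  have dsqrt: "((\<lambda>s. 2 * C * sqrt s) has_real_derivative C / sqrt s) (at s)" if "1 \<le> s" for s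
    using that by (auto intro!: derivative_eq_intros simp: field_simps)
  have m2': "\<bar>m2 s\<bar> \<le> C / sqrt s" if "1 \<le> s" for s
  proof -
    have "sqrt s \<le> s" using that by (simp add: real_sqrt_le_iff' real_le_lsqrt self_le_power sqrt_le_D)
    then have "C / s \<le> C / sqrt s" using C that by (intro divide_left_mono) auto
    with m2[OF that] show ?thesis by linarith
  qed
  \<comment> \<open>Comparison of m' with 2 C sqrt s, whose derivative dominates |m''|: their
    difference here, and their sum below, are nondecreasing.\<close>
  have up: "m1 u - m1 s \<le> 2 * C * sqrt u - 2 * C * sqrt s" if "1 \<le> s" "s \<le> u" for s u
  proof -
    have "2 * C * sqrt s - m1 s \<le> 2 * C * sqrt u - m1 u"
    proof (rule DERIV_nonneg_imp_nondecreasing[OF that(2)])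
      fix x assume x: "s \<le> x" "x \<le> u"
      with that have "1 \<le> x" by simp
      then show "\<exists>y. ((\<lambda>x. 2 * C * sqrt x - m1 x) has_real_derivative y) (at x) \<and> 0 \<le> y"
        using DERIV_diff[OF dsqrt[OF \<open>1 \<le> x\<close>] m1[OF \<open>1 \<le> x\<close>]] m2'[of x] by (intro exI[of _ "C / sqrt x - m2 x"]) (auto simp: abs_le_iff)
    qed
    then show ?thesis by linarith
  qed
  have down: "m1 s - m1 u \<le> 2 * C * sqrt u - 2 * C * sqrt s" if "1 \<le> s" "s \<le> u" for s u
  proof -
    have "2 * C * sqrt s + m1 s \<le> 2 * C * sqrt u + m1 u"
    proof (rule DERIV_nonneg_imp_nondecreasing[OF that(2)])
      fix x assume x: "s \<le> x" "x \<le> u"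
      with that have "1 \<le> x" by simp
      then show "\<exists>y. ((\<lambda>x. 2 * C * sqrt x + m1 x) has_real_derivative y) (at x) \<and> 0 \<le> y"
        using DERIV_add[OF dsqrt[OF \<open>1 \<le> x\<close>] m1[OF \<open>1 \<le> x\<close>]] m2'[of x] by (intro exI[of _ "C / sqrt x + m2 x"]) (auto simp: abs_le_iff)
    qed
    then show ?thesis by linarith
  qed
  have m1b: "\<bar>m1 s\<bar> \<le> (2 * B + 6 * C) * sqrt s" if s: "1 \<le> s" for s
  proof -
    have zb: "\<bar>m1 z\<bar> \<le> 2 * B" 
    proof -
      have "m1 z = m 2 - m 1" using z(3) by simp
      with b show ?thesis by linarith
    qed
    have s1: "1 \<le> sqrt s" using s by simp
    have z2: "sqrt z \<le> 2" "0 \<le> sqrt z" using z by (auto intro!: real_le_lsqrt)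
    have "\<bar>m1 s - m1 z\<bar> \<le> 2 * C * sqrt s + 2 * C * sqrt z"
    proof (cases "s \<le> z")
      case True
      have "0 \<le> 2 * C * sqrt s" using C s1 by simp
      with up[OF s True] down[OF s True] show ?thesis by (simp add: abs_le_iff)
    next
      case False
      have "0 \<le> 2 * C * sqrt z" using C z2 by simp
      with up[of z s] down[of z s] False z show ?thesis by (simp add: abs_le_iff)
    qed
    moreover have "2 * C * sqrt z \<le> 4 * C * sqrt s"
    proof -
      have "2 * C * sqrt z \<le> 2 * C * 2" using C z2 by (intro mult_left_mono) auto
      also have "\<dots> \<le> 4 * C * sqrt s" using mult_left_mono[OF s1, of "4 * C"] C by simp
      finally show ?thesis .
    qed
    moreover have "2 * B \<le> 2 * B * sqrt s" using mult_left_mono[OF s1, of "2 * B"] B by simp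
    ultimately show ?thesis using zb by (simp add: distrib_right)
  qed
  have t1: "1 \<le> sqrt t" using t by simp
  have "\<bar>m t - m 1\<bar> \<le> (2 * B + 6 * C) * (t * sqrt t)"
  proof (cases "t = 1")
    case False
    then obtain c where c: "1 < c" "c < t" "m t - m 1 = (t - 1) * m1 c"
      using MVT2[of 1 t m m1] m t by auto
    have "\<bar>m t - m 1\<bar> = (t - 1) * \<bar>m1 c\<bar>" using c(3) t by (simp add: abs_mult)
    also have "\<dots> \<le> t * ((2 * B + 6 * C) * sqrt t)"
    proof (rule mult_mono)
      have "\<bar>m1 c\<bar> \<le> (2 * B + 6 * C) * sqrt c" using c by (intro m1b) simp
      also have "\<dots> \<le> (2 * B + 6 * C) * sqrt t" using c B C by (intro mult_left_mono) auto
      finally show "\<bar>m1 c\<bar> \<le> (2 * B + 6 * C) * sqrt t" .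
    qed (use t in auto)
    finally show ?thesis by (simp add: mult_ac)
  qed (use B C t in simp)
  moreover have "B \<le> B * (t * sqrt t)"
  proof -
    have "1 \<le> t * sqrt t" using mult_mono[OF t t1] t by simp
    from mult_left_mono[OF this B] show ?thesis by simp
  qed
  ultimately show ?thesis using b(1) by (simp add: distrib_right)
qed

text \<open>The mean with exponent 2 grows at most like t sqrt t, and multiplying back by t^2 gives
  t^3 sqrt t. Uniformity over all weights supported in radius 2 later permits a weight that itself
  depends on the scale.\<close>

lemma weak_hessian_growth:
  assumes h: "continuous_on UNIV h" "is_weak_hessian h H"
  shows "\<exists>C. \<forall>\<phi> M t. smooth \<phi> \<longrightarrow> (\<forall>p. 2 < norm p \<longrightarrow> \<phi> p = 0) \<longrightarrow> (\<forall>p. \<bar>\<phi> p\<bar> \<le> M) \<longrightarrow>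
      0 < M \<longrightarrow> 1 \<le> t \<longrightarrow> \<bar>LINT p|lebesgue. h p * \<phi> (p /\<^sub>R t)\<bar> \<le> C * M * (t ^ 3 * sqrt t)"
proof -
  obtain C where C: "0 \<le> C" "\<forall>\<phi> M s. smooth \<phi> \<longrightarrow> (\<forall>p. 2 < norm p \<longrightarrow> \<phi> p = 0) \<longrightarrow> (\<forall>p. \<bar>\<phi> p\<bar> \<le> M) \<longrightarrow>
      0 < M \<longrightarrow> 0 < s \<longrightarrow> \<bar>scaled_mean h 4 (euler 3 (euler 2 \<phi>)) s\<bar> \<le> C * M / s"
    using scaled_mean_second_derivative_bound[OF h] by blast
  \<comment> \<open>For 1 \<le> s \<le> 2 the dilated weights live on the disc of radius 4, so this
    local L1 norm bounds the means at the two initial scales.\<close>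
  define B where "B = (LINT p|lebesgue. indicator (cball 0 4) p * \<bar>h p\<bar>)"
  have B: "integrable lebesgue (\<lambda>p. indicator (cball 0 4) p * \<bar>h p\<bar>)"
  proof -
    have hb: "h \<in> borel_measurable borel" by (rule continuous_imp_borel[OF h(1)])
    have "(\<lambda>p. indicator (cball 0 4) p * \<bar>h p\<bar>) \<in> borel_measurable borel"
      by (intro borel_measurable_times borel_measurable_indicator borel_measurable_abs hb) simp
    moreover have "integrable lborel (\<lambda>p. indicator (cball 0 4) p *\<^sub>R \<bar>h p\<bar>)"
      by (intro borel_integrable_compact continuous_intros continuous_on_subset[OF h(1)]) auto
    ultimately show ?thesis by (simp add: integrable_lebesgue_borel)
  qed
  show ?thesis
  proof (intro exI[of _ "3 * B + 6 * C"] allI impI)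
    fix \<phi> :: "real^2 \<Rightarrow> real" and M t :: real
    assume "smooth \<phi>" "\<forall>p. 2 < norm p \<longrightarrow> \<phi> p = 0" "\<forall>p. \<bar>\<phi> p\<bar> \<le> M" and M: "0 < M" and t: "1 \<le> t"
    then have \<phi>: "smooth \<phi>" "\<And>p. 2 < norm p \<Longrightarrow> \<phi> p = 0" "\<And>p. \<bar>\<phi> p\<bar> \<le> M" by blast+
    have small: "\<bar>scaled_mean h 2 \<phi> s\<bar> \<le> B * M" if s: "1 \<le> s" "s \<le> 2" for s
    proof -
      have c: "continuous_on UNIV (\<lambda>p. h p * (inverse s ^ 2 * \<phi> (p /\<^sub>R s)))"
        by (intro continuous_intros h continuous_on_compose2[OF smooth_continuous[OF \<phi>(1), of UNIV]]) auto
      have far: "2 < norm (p /\<^sub>R s)" if "4 < norm p" for p :: "real^2" using that s by (simp add: field_simps)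
      have i: "integrable lebesgue (\<lambda>p. h p * (inverse s ^ 2 * \<phi> (p /\<^sub>R s)))"
        by (rule integrable_continuous_cball(2)[OF c, where R = 4]) (simp add: \<phi>(2)[OF far])
      have "\<bar>h p * (inverse s ^ 2 * \<phi> (p /\<^sub>R s))\<bar> \<le> M * (indicator (cball 0 4) p * \<bar>h p\<bar>)" for p
      proof (cases "4 < norm p")
        case True
        then show ?thesis by (simp add: \<phi>(2)[OF far])
      next
        case False
        have "inverse s ^ 2 * \<bar>\<phi> (p /\<^sub>R s)\<bar> \<le> 1 * M"
          using s M by (intro mult_mono \<phi>(3) power_le_one) (auto simp: inverse_le_1_iff)
        then have "\<bar>h p\<bar> * (inverse s ^ 2 * \<bar>\<phi> (p /\<^sub>R s)\<bar>) \<le> \<bar>h p\<bar> * M"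
          by (intro mult_left_mono) auto
        with False show ?thesis by (simp add: abs_mult mult.commute)
      qed
      then have "(LINT p|lebesgue. \<bar>h p * (inverse s ^ 2 * \<phi> (p /\<^sub>R s))\<bar>) \<le> (LINT p|lebesgue. M * (indicator (cball 0 4) p * \<bar>h p\<bar>))"
        by (intro integral_mono integrable_abs i integrable_mult_right B)
      also have "\<dots> = B * M" by (simp add: B_def mult.commute)
      finally show ?thesis
        unfolding scaled_mean_def
        using integral_abs_bound[of lebesgue "\<lambda>p. h p * (inverse s ^ 2 * \<phi> (p /\<^sub>R s))"] by linarith
    qed
    have e: "\<And>p. 2 < norm p \<Longrightarrow> euler 2 \<phi> p = 0" by (rule euler_eq_0[OF \<phi>(2)])
    have "\<bar>scaled_mean h 2 \<phi> t\<bar> \<le> (3 * (B * M) + 6 * (C * M)) * (t * sqrt t)"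
    proof (rule growth_from_second_derivative[where ?m1.0 = "\<lambda>s. - scaled_mean h 3 (euler 2 \<phi>) s"
          and ?m2.0 = "\<lambda>s. scaled_mean h 4 (euler 3 (euler 2 \<phi>)) s"])
      show "(scaled_mean h 2 \<phi> has_real_derivative - scaled_mean h 3 (euler 2 \<phi>) s) (at s)" if "1 \<le> s" for s
        using scaled_mean_derivative[OF h(1) \<phi>(1,2), of 2 s 2] that by (simp add: eval_nat_numeral)
      show "((\<lambda>s. - scaled_mean h 3 (euler 2 \<phi>) s) has_real_derivative scaled_mean h 4 (euler 3 (euler 2 \<phi>)) s) (at s)"
        if "1 \<le> s" for s
        using DERIV_minus[OF scaled_mean_derivative[OF h(1) smooth_euler[OF \<phi>(1)] e, of 2 s 3]] that
        by (simp add: eval_nat_numeral)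
      show "\<bar>scaled_mean h 4 (euler 3 (euler 2 \<phi>)) s\<bar> \<le> C * M / s" if "1 \<le> s" for s
        using C(2) \<phi> that M by auto
      show "\<bar>scaled_mean h 2 \<phi> 1\<bar> \<le> B * M" "\<bar>scaled_mean h 2 \<phi> 2\<bar> \<le> B * M" by (simp_all add: small)
    qed (use C M t in auto)
    then have "t\<^sup>2 * \<bar>scaled_mean h 2 \<phi> t\<bar> \<le> t\<^sup>2 * ((3 * (B * M) + 6 * (C * M)) * (t * sqrt t))"
      by (intro mult_left_mono) auto
    also have "t\<^sup>2 * ((3 * (B * M) + 6 * (C * M)) * (t * sqrt t)) = (3 * B + 6 * C) * M * (t ^ 3 * sqrt t)"
      by (simp add: algebra_simps power2_eq_square power3_eq_cube)
    also have "t\<^sup>2 * \<bar>scaled_mean h 2 \<phi> t\<bar> = \<bar>LINT p|lebesgue. h p * \<phi> (p /\<^sub>R t)\<bar>"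
    proof -
      have "scaled_mean h 2 \<phi> t = inverse t ^ 2 * (LINT p|lebesgue. h p * \<phi> (p /\<^sub>R t))"
        unfolding scaled_mean_def by (subst integral_mult_right_zero[symmetric]) (simp add: mult_ac)
      then have "t\<^sup>2 * scaled_mean h 2 \<phi> t = t\<^sup>2 * inverse t ^ 2 * (LINT p|lebesgue. h p * \<phi> (p /\<^sub>R t))"
        by (simp only: mult.assoc)
      also have "t\<^sup>2 * inverse t ^ 2 = 1" using t by (simp add: power_mult_distrib[symmetric])
      finally show ?thesis using abs_mult[of "t\<^sup>2" "scaled_mean h 2 \<phi> t"] by simp
    qed
    finally show "\<bar>LINT p|lebesgue. h p * \<phi> (p /\<^sub>R t)\<bar> \<le> (3 * B + 6 * C) * M * (t ^ 3 * sqrt t)" .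
  qed
qed

section \<open>The regularised thin-plate kernel\<close>

definition rho :: "real \<Rightarrow> real^2 \<Rightarrow> real" where
  "rho e p = (norm p)\<^sup>2 + e\<^sup>2"

(* The regularised kernel rho ln rho / 2 equals K(norm p) at e = 0.  Its Hessian, the gradient of
   its Laplacian, and its bilaplacian 16 e^4 / rho^3 are given explicitly below. *)
definition kernel :: "real \<Rightarrow> real^2 \<Rightarrow> real" where
  "kernel e p = 1 / 2 * (rho e p * ln (rho e p))"

definition kernel_grad :: "real \<Rightarrow> 2 \<Rightarrow> real^2 \<Rightarrow> real" where
  "kernel_grad e i p = vec_nth p i * (ln (rho e p) + 1)"

definition kernel_hess :: "real \<Rightarrow> 2 \<Rightarrow> 2 \<Rightarrow> real^2 \<Rightarrow> real" where
  "kernel_hess e i j p = (if i = j then 1 else 0) * (ln (rho e p) + 1) +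
     2 * (vec_nth p i * (vec_nth p j * inverse (rho e p)))"

definition kernel_grad_lap :: "real \<Rightarrow> 2 \<Rightarrow> real^2 \<Rightarrow> real" where
  "kernel_grad_lap e i p = 4 * (vec_nth p i * inverse (rho e p)) +
     4 * e\<^sup>2 * (vec_nth p i * (inverse (rho e p) * inverse (rho e p)))"

lemma rho_nonneg: "0 \<le> rho e p"
  by (simp add: rho_def)

lemma rho_pos: "e \<noteq> 0 \<or> p \<noteq> 0 \<Longrightarrow> 0 < rho e p"
  by (auto simp: rho_def add_pos_nonneg add_nonneg_pos)

lemma kernel_0: "kernel 0 p = tps_kernel (norm p)"
  by (cases "p = 0") (simp_all add: kernel_def tps_kernel_def rho_def ln_realpow)

lemma kernel_hess_commute: "kernel_hess e i j p = kernel_hess e j i p"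
  by (simp add: kernel_hess_def mult_ac)

context
  fixes e :: real assumes e: "e \<noteq> 0"
begin

lemma smooth_rho: "smooth (rho e)"
  unfolding rho_def[abs_def] by (intro smooth_add smooth_norm_sq smooth_const)

lemma rho_pos': "0 < rho e p"
  using e by (simp add: rho_pos)

lemma smooth_inverse_rho: "smooth (\<lambda>p. inverse (rho e p))"
  using less_imp_neq[OF rho_pos'] by (intro smooth_inverse smooth_rho) (metis)

lemma smooth_ln_rho: "smooth (\<lambda>p. ln (rho e p))"
  by (intro smooth_ln smooth_rho rho_pos')

lemmas smooth_kernel_intros = smooth_add smooth_mult smooth_const smooth_coord smooth_inverse_rho
  smooth_ln_rho smooth_rho

lemma smooth_kernel: "smooth (kernel e)"
  and smooth_kernel_grad: "smooth (kernel_grad e i)"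
  and smooth_kernel_hess: "smooth (kernel_hess e i j)"
  and smooth_kernel_grad_lap: "smooth (kernel_grad_lap e i)"
  unfolding kernel_def[abs_def] kernel_grad_def[abs_def] kernel_hess_def[abs_def] kernel_grad_lap_def[abs_def]
  by (intro smooth_kernel_intros)+

lemma partial_rho: "partial i (rho e) = (\<lambda>p. 2 * vec_nth p i)"
proof -
  have rho: "rho e = (\<lambda>p. vec_nth p 1 * vec_nth p 1 + vec_nth p 2 * vec_nth p 2 + e\<^sup>2)"
    unfolding rho_def[abs_def] norm2_sq ..
  show ?thesis
    unfolding rho using exhaust_2[of i]
    by (auto simp: partial_smooth_add partial_smooth_mult partial_coord smooth_add smooth_mult fun_eq_iff)
qed

lemma partial_ln_rho: "partial i (\<lambda>p. ln (rho e p)) = (\<lambda>p. 2 * (vec_nth p i * inverse (rho e p)))"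
  by (rule ext)
    (simp add: partial_ln(1)[OF smooth_imp_differentiable[OF smooth_rho] rho_pos'] partial_rho)

lemma partial_inverse_rho:
  "partial i (\<lambda>p. inverse (rho e p)) = (\<lambda>p. - 2 * (vec_nth p i * (inverse (rho e p) * inverse (rho e p))))"
  using less_imp_neq[OF rho_pos']
  by (intro ext) (subst partial_inverse(1)[OF smooth_imp_differentiable[OF smooth_rho]],
      auto simp: partial_rho)

lemmas partial_kernel_simps = partial_smooth_add partial_smooth_mult partial_coord partial_rho
  partial_ln_rho partial_inverse_rho smooth_kernel_intros

lemma partial_kernel: "partial i (kernel e) = kernel_grad e i"
  using rho_pos' less_imp_neq[OF rho_pos', THEN not_sym]
  unfolding kernel_def[abs_def] kernel_grad_def[abs_def]
  by (intro ext) (simp only: partial_kernel_simps partial_const, simp add: field_simps)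

lemma partial_kernel_grad: "partial j (kernel_grad e i) = kernel_hess e i j"
  unfolding kernel_grad_def[abs_def] kernel_hess_def[abs_def]
  by (intro ext) (simp add: partial_kernel_simps)

lemma rho_sq: "vec_nth p 1 * vec_nth p 1 + vec_nth p 2 * vec_nth p 2 = rho e p - e\<^sup>2"
  by (simp add: rho_def norm2_sq)

lemma partial_kernel_hess:
  "partial k (kernel_hess e i j) p = (if i = j then 1 else 0) * (2 * (vec_nth p k * inverse (rho e p))) +
     2 * ((if i = k then 1 else 0) * (vec_nth p j * inverse (rho e p)) +
       (if j = k then 1 else 0) * (vec_nth p i * inverse (rho e p)) -
       2 * (vec_nth p i * vec_nth p j * vec_nth p k * (inverse (rho e p) * inverse (rho e p))))"
  unfolding kernel_hess_def[abs_def]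
  by (simp add: partial_kernel_simps algebra_simps)

lemma div_kernel_hess: "(\<Sum>j\<in>UNIV. partial j (kernel_hess e i j) p) = kernel_grad_lap e i p"
proof -
  let ?r = "inverse (rho e p)"
  have r: "rho e p * ?r = 1" using less_imp_neq[OF rho_pos', THEN not_sym] by simp
  have "(\<Sum>j\<in>UNIV. partial j (kernel_hess e i j) p) = 8 * (vec_nth p i * ?r) -
      4 * (vec_nth p i * (?r * ?r)) * (vec_nth p 1 * vec_nth p 1 + vec_nth p 2 * vec_nth p 2)"
    using exhaust_2[of i] unfolding partial_kernel_hess sum_2 by (auto simp: algebra_simps)
  also have "\<dots> = 8 * (vec_nth p i * ?r) - 4 * (vec_nth p i * ?r) * (rho e p * ?r) + 4 * e\<^sup>2 * (vec_nth p i * (?r * ?r))"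
    unfolding rho_sq by (simp add: algebra_simps)
  finally show ?thesis unfolding r kernel_grad_lap_def by simp
qed

text \<open>After |p|^2 is replaced by rho - e^2, each rho cancels against an inverse. The terms of
  order 1 / rho and e^2 / rho^2 then cancel among themselves, and only 16 e^4 / rho^3
  remains.\<close>

lemma div_kernel_grad_lap: "(\<Sum>i\<in>UNIV. partial i (kernel_grad_lap e i) p) = 16 * e ^ 4 / (rho e p) ^ 3"
proof -
  let ?r = "inverse (rho e p)"
  have r: "rho e p * ?r = 1" using less_imp_neq[OF rho_pos', THEN not_sym] by simp
  have g: "partial i (kernel_grad_lap e i) p = 4 * (?r - 2 * (vec_nth p i * vec_nth p i) * (?r * ?r)) +
      4 * e\<^sup>2 * (?r * ?r - 4 * (vec_nth p i * vec_nth p i) * (?r * ?r * ?r))" for i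
    unfolding kernel_grad_lap_def[abs_def]
    by (simp add: partial_kernel_simps algebra_simps)
  have "(\<Sum>i\<in>UNIV. partial i (kernel_grad_lap e i) p) =
      8 * ?r - 8 * (?r * ?r) * (vec_nth p 1 * vec_nth p 1 + vec_nth p 2 * vec_nth p 2) +
      8 * e\<^sup>2 * (?r * ?r) - 16 * e\<^sup>2 * (?r * ?r * ?r) * (vec_nth p 1 * vec_nth p 1 + vec_nth p 2 * vec_nth p 2)"
    unfolding sum_2 g by (simp add: algebra_simps)
  also have "\<dots> = 8 * ?r - 8 * ?r * (rho e p * ?r) + 8 * e\<^sup>2 * (?r * ?r) + 8 * e\<^sup>2 * (?r * ?r)
      - 16 * e\<^sup>2 * (?r * ?r) * (rho e p * ?r) + 16 * (e\<^sup>2 * e\<^sup>2) * (?r * ?r * ?r)"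
    unfolding rho_sq by (simp add: algebra_simps)
  also have "\<dots> = 16 * (e\<^sup>2 * e\<^sup>2) * (?r * ?r * ?r)" unfolding r by (simp add: algebra_simps)
  finally show ?thesis by (simp add: field_simps eval_nat_numeral)
qed

end

subsection \<open>Decay of kernel combinations annihilating affine functions\<close>

(* First-order expansion in the position y r, with error of second order in d = 1 / norm p. *)
definition affine_expansion :: "nat \<Rightarrow> (nat \<Rightarrow> real^2) \<Rightarrow> real \<Rightarrow> real \<Rightarrow> (nat \<Rightarrow> real) \<Rightarrow> bool" where
  "affine_expansion n y d C F \<longleftrightarrow> (\<exists>c L. \<bar>c\<bar> \<le> C \<and> norm L \<le> C * d \<and> (\<forall>r<n. \<bar>F r - c - L \<bullet> y r\<bar> \<le> C * d\<^sup>2))"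

text \<open>The moment conditions on the weights remove the constant and the linear part of the
  expansion, so only the errors of order d^2 survive.\<close>

lemma affine_expansion_cancel:
  assumes "affine_expansion n y d C F" and \<beta>: "(\<Sum>r<n. \<beta> r) = 0" "(\<Sum>r<n. \<beta> r *\<^sub>R y r) = 0"
  shows "\<bar>\<Sum>r<n. \<beta> r * F r\<bar> \<le> (\<Sum>r<n. \<bar>\<beta> r\<bar>) * (C * d\<^sup>2)"
proof -
  obtain c L where F: "\<forall>r<n. \<bar>F r - c - L \<bullet> y r\<bar> \<le> C * d\<^sup>2"
    using assms(1) unfolding affine_expansion_def by blast
  have "(\<Sum>r<n. \<beta> r * F r) = (\<Sum>r<n. \<beta> r * (F r - c - L \<bullet> y r)) + c * (\<Sum>r<n. \<beta> r) + L \<bullet> (\<Sum>r<n. \<beta> r *\<^sub>R y r)"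
    by (simp add: sum_distrib_left inner_sum_right algebra_simps flip: sum.distrib)
  then have "\<bar>\<Sum>r<n. \<beta> r * F r\<bar> = \<bar>\<Sum>r<n. \<beta> r * (F r - c - L \<bullet> y r)\<bar>" using \<beta> by simp
  also have "\<dots> \<le> (\<Sum>r<n. \<bar>\<beta> r\<bar> * (C * d\<^sup>2))"
    using F by (intro order_trans[OF sum_abs] sum_mono) (auto simp: abs_mult intro!: mult_left_mono)
  finally show ?thesis by (simp add: sum_distrib_right)
qed

lemma affine_expansion_mult:
  assumes F: "affine_expansion n y d C F" and G: "affine_expansion n y d D G"
    and y: "\<And>r. r < n \<Longrightarrow> norm (y r) \<le> Y" and d: "0 \<le> d" "d \<le> 1" and Y: "0 \<le> Y"
  shows "affine_expansion n y d (C * D * (Y\<^sup>2 + 2 * Y + 3)) (\<lambda>r. F r * G r)"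
proof -
  obtain c L where c: "\<bar>c\<bar> \<le> C" "norm L \<le> C * d" "\<And>r. r < n \<Longrightarrow> \<bar>F r - c - L \<bullet> y r\<bar> \<le> C * d\<^sup>2"
    using F unfolding affine_expansion_def by blast
  obtain c' L' where c': "\<bar>c'\<bar> \<le> D" "norm L' \<le> D * d" "\<And>r. r < n \<Longrightarrow> \<bar>G r - c' - L' \<bullet> y r\<bar> \<le> D * d\<^sup>2"
    using G unfolding affine_expansion_def by blast
  have C: "0 \<le> C" "0 \<le> D" using c(1) c'(1) by linarith+
  have CD: "0 \<le> C * D" using C by simp
  have d2: "d\<^sup>2 \<le> 1" using d by (simp add: power_le_one)
  let ?E = "C * D * (Y\<^sup>2 + 2 * Y + 3)"
  have E: "a * (C * D) \<le> ?E" if "a \<le> 3" for a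
  proof -
    have "a \<le> Y\<^sup>2 + 2 * Y + 3" using that Y zero_le_power2[of Y] by linarith
    then have "a * (C * D) \<le> (Y\<^sup>2 + 2 * Y + 3) * (C * D)" by (rule mult_right_mono[OF _ CD])
    then show ?thesis by (simp only: mult.commute[of "C * D"])
  qed
  show ?thesis
    unfolding affine_expansion_def
  proof (intro exI[of _ "c * c'"] exI[of _ "c *\<^sub>R L' + c' *\<^sub>R L"] conjI allI impI)
    have "\<bar>c * c'\<bar> \<le> C * D" unfolding abs_mult by (rule mult_mono[OF c(1) c'(1)]) (use C in auto)
    with E[of 1] show "\<bar>c * c'\<bar> \<le> ?E" by simp
    have "norm (c *\<^sub>R L' + c' *\<^sub>R L) \<le> \<bar>c\<bar> * norm L' + \<bar>c'\<bar> * norm L"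
      by (rule norm_triangle_le) simp
    also have "\<dots> \<le> C * (D * d) + D * (C * d)"
      by (intro add_mono mult_mono c c') (use C in auto)
    also have "\<dots> = 2 * (C * D) * d" by (simp add: algebra_simps)
    also have "\<dots> \<le> ?E * d" using E[of 2] d by (intro mult_right_mono) auto
    finally show "norm (c *\<^sub>R L' + c' *\<^sub>R L) \<le> ?E * d" .
    fix r assume r: "r < n"
    let ?l = "L \<bullet> y r" and ?l' = "L' \<bullet> y r"
    have l: "\<bar>?l\<bar> \<le> C * Y * d"
    proof -
      have "\<bar>?l\<bar> \<le> norm L * norm (y r)" by (rule Cauchy_Schwarz_ineq2)
      also have "\<dots> \<le> (C * d) * Y" using c(2) y[OF r] C d by (intro mult_mono) auto
      finally show ?thesis by (simp add: mult_ac)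
    qed
    have l': "\<bar>?l'\<bar> \<le> D * Y * d"
    proof -
      have "\<bar>?l'\<bar> \<le> norm L' * norm (y r)" by (rule Cauchy_Schwarz_ineq2)
      also have "\<dots> \<le> (D * d) * Y" using c'(2) y[OF r] C d by (intro mult_mono) auto
      finally show ?thesis by (simp add: mult_ac)
    qed
    let ?e = "F r - c - ?l" and ?e' = "G r - c' - ?l'"
    have cl: "\<bar>c + ?l\<bar> \<le> C * (1 + Y)"
    proof -
      have "C * Y * d \<le> C * Y * 1" using d C Y by (intro mult_left_mono) auto
      with l c(1) show ?thesis by (simp add: distrib_left)
    qed
    have Gb: "\<bar>G r\<bar> \<le> D * (2 + Y)"
    proof -
      have "D * Y * d \<le> D * Y * 1" "D * d\<^sup>2 \<le> D * 1" using d d2 C Y by (intro mult_left_mono; simp)+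
      with l' c'(1) c'(3)[OF r] show ?thesis by (simp add: distrib_left)
    qed
    \<comment> \<open>The three terms contribute Y^2, 1 + Y and 2 + Y times C D d^2, whence the
      factor Y^2 + 2 Y + 3.\<close>
    have "F r * G r - c * c' - (c *\<^sub>R L' + c' *\<^sub>R L) \<bullet> y r = ?l * ?l' + (c + ?l) * ?e' + ?e * G r"
      by (simp add: inner_add_left algebra_simps)
    also have "\<bar>\<dots>\<bar> \<le> \<bar>?l\<bar> * \<bar>?l'\<bar> + \<bar>c + ?l\<bar> * \<bar>?e'\<bar> + \<bar>?e\<bar> * \<bar>G r\<bar>"
      unfolding abs_mult[symmetric] by linarith
    also have "\<dots> \<le> (C * Y * d) * (D * Y * d) + (C * (1 + Y)) * (D * d\<^sup>2) + (C * d\<^sup>2) * (D * (2 + Y))"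
      by (intro add_mono mult_mono l l' cl Gb c(3)[OF r] c'(3)[OF r]) (use C Y d in auto)
    also have "\<dots> = ?E * d\<^sup>2" by (simp add: algebra_simps power2_eq_square)
    finally show "\<bar>F r * G r - c * c' - (c *\<^sub>R L' + c' *\<^sub>R L) \<bullet> y r\<bar> \<le> ?E * d\<^sup>2" .
  qed
qed

text \<open>The small quantity u in rho(p - y) = |p|^2 (1 + u), in which the far-field expansions
  are made.\<close>

definition rel_dev :: "(nat \<Rightarrow> real^2) \<Rightarrow> real \<Rightarrow> real^2 \<Rightarrow> nat \<Rightarrow> real" where
  "rel_dev y e p r = rho e (p - y r) / (norm p)\<^sup>2 - 1"

text \<open>Three contributions: 2 from the linear part, Y^2 + 1 from the remainder of
  \<open>rel_dev\<close>, and 2 (Y + 1)^4 from a Taylor remainder 2 u^2 with |u| \<le> (Y + 1)^2 /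
  |p|.\<close>

definition expansion_const :: "real \<Rightarrow> real" where
  "expansion_const Y = 2 + (Y\<^sup>2 + 1) + 2 * (Y + 1) ^ 4"

context
  fixes n :: nat and y :: "nat \<Rightarrow> real^2" and Y :: real
  assumes Y: "0 \<le> Y" and y: "\<forall>r<n. norm (y r) \<le> Y"
begin

lemma centre_norm_le: "r < n \<Longrightarrow> norm (y r) \<le> Y"
  using y by blast

context
  fixes e :: real and p :: "real^2"
  assumes e: "0 \<le> e" "e \<le> 1" and p: "2 * (Y + 1)\<^sup>2 \<le> norm p"
begin

lemma norm_p: "2 \<le> norm p" "Y \<le> norm p" "0 < norm p" "0 \<le> 1 / norm p" "1 / norm p \<le> 1"
proof -
  have "(Y + 1)\<^sup>2 = Y\<^sup>2 + 2 * Y + 1" by (simp add: power2_sum)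
  then have "2 * (Y\<^sup>2 + 2 * Y + 1) \<le> norm p" using p by simp
  then have N: "2 * Y\<^sup>2 + 4 * Y + 2 \<le> norm p" by simp
  have *: "2 \<le> norm p" using N Y zero_le_power2[of Y] by linarith
  have "Y \<le> norm p" using N Y zero_le_power2[of Y] by linarith
  then show "2 \<le> norm p" "Y \<le> norm p" using * by simp_all
  show **: "0 < norm p" using * by linarith
  then show "0 \<le> 1 / norm p" by simp
  show "1 / norm p \<le> 1" using * ** by (intro divide_le_eq_1_pos[THEN iffD2]; linarith)
qed

lemma rel_dev_eq:
  "rel_dev y e p r = (- 2 / (norm p)\<^sup>2) *\<^sub>R p \<bullet> y r + ((norm (y r))\<^sup>2 + e\<^sup>2) * (1 / norm p)\<^sup>2"
proof -
  have "(norm (p - y r))\<^sup>2 = (norm p)\<^sup>2 - 2 * (p \<bullet> y r) + (norm (y r))\<^sup>2"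
    by (simp add: power2_norm_eq_inner inner_diff inner_commute)
  with norm_p show ?thesis
    by (simp add: rel_dev_def rho_def power_one_over add_divide_distrib diff_divide_distrib)
qed

lemma rel_dev_rem:
  assumes "r < n"
  shows "\<bar>rel_dev y e p r - (- 2 / (norm p)\<^sup>2) *\<^sub>R p \<bullet> y r\<bar> \<le> (Y\<^sup>2 + 1) * (1 / norm p)\<^sup>2"
proof -
  have "(norm (y r))\<^sup>2 + e\<^sup>2 \<le> Y\<^sup>2 + 1"
    using centre_norm_le[OF assms] e by (intro add_mono power_mono power_le_one) auto
  then have "((norm (y r))\<^sup>2 + e\<^sup>2) * (1 / norm p)\<^sup>2 \<le> (Y\<^sup>2 + 1) * (1 / norm p)\<^sup>2"
    by (rule mult_right_mono) simp
  moreover have "0 \<le> ((norm (y r))\<^sup>2 + e\<^sup>2) * (1 / norm p)\<^sup>2" by (intro mult_nonneg_nonneg) auto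
  ultimately show ?thesis unfolding rel_dev_eq by simp
qed

lemma norm_linear_part: "norm ((- 2 / (norm p)\<^sup>2) *\<^sub>R p) = 2 * (1 / norm p)"
  using norm_p by (simp add: power2_eq_square)

text \<open>Linear part and remainder add up to (2 Y + Y^2 + 1) / |p|. The threshold 2 (Y + 1)^2 on
  |p| makes this at most 1/2, the range of the Taylor bounds for 1 / (1 + u) and ln (1 + u).\<close>

lemma rel_dev_bound:
  assumes "r < n"
  shows "\<bar>rel_dev y e p r\<bar> \<le> (Y + 1)\<^sup>2 * (1 / norm p)" "\<bar>rel_dev y e p r\<bar> \<le> 1 / 2"
proof -
  let ?L = "(- 2 / (norm p)\<^sup>2) *\<^sub>R p" and ?d = "1 / norm p"
  have "\<bar>?L \<bullet> y r\<bar> \<le> norm ?L * norm (y r)" by (rule Cauchy_Schwarz_ineq2)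
  also have "\<dots> \<le> 2 * ?d * Y"
    unfolding norm_linear_part using centre_norm_le[OF assms] norm_p by (intro mult_left_mono) auto
  finally have 1: "\<bar>?L \<bullet> y r\<bar> \<le> 2 * ?d * Y" .
  have "?d\<^sup>2 \<le> ?d * 1" unfolding power2_eq_square using norm_p by (intro mult_left_mono)
  then have "(Y\<^sup>2 + 1) * ?d\<^sup>2 \<le> (Y\<^sup>2 + 1) * ?d" by (intro mult_left_mono) auto
  then have "\<bar>rel_dev y e p r\<bar> \<le> 2 * ?d * Y + (Y\<^sup>2 + 1) * ?d"
    using 1 rel_dev_rem[OF assms] by linarith
  also have "\<dots> = (Y + 1)\<^sup>2 * ?d" by (simp add: power2_sum algebra_simps)
  finally show *: "\<bar>rel_dev y e p r\<bar> \<le> (Y + 1)\<^sup>2 * ?d" .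
  have "(Y + 1)\<^sup>2 * ?d \<le> 1 / 2" using p norm_p by (simp add: field_simps)
  with * show "\<bar>rel_dev y e p r\<bar> \<le> 1 / 2" by linarith
qed

text \<open>First-order Taylor expansion of f in u, combined with the fact that u is linear in the
  centre up to order 1 / |p|^2.\<close>

lemma affine_expansion_rel_dev_comp:
  assumes f: "\<And>u. \<bar>u\<bar> \<le> 1 / 2 \<Longrightarrow> \<bar>f u - f0 - f1 * u\<bar> \<le> 2 * u\<^sup>2" and "\<bar>f0\<bar> \<le> 1" "\<bar>f1\<bar> \<le> 1"
  shows "affine_expansion n y (1 / norm p) (2 + (Y\<^sup>2 + 1) + 2 * (Y + 1) ^ 4) (\<lambda>r. f (rel_dev y e p r))"
proof -
  let ?L = "(- 2 / (norm p)\<^sup>2) *\<^sub>R p" and ?d = "1 / norm p" and ?C = "2 + (Y\<^sup>2 + 1) + 2 * (Y + 1) ^ 4"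
  have C: "2 \<le> ?C" using Y by (simp add: add_nonneg_nonneg)
  show ?thesis
    unfolding affine_expansion_def
  proof (intro exI[of _ f0] exI[of _ "f1 *\<^sub>R ?L"] conjI allI impI)
    show "\<bar>f0\<bar> \<le> ?C" using C assms(2) by linarith
    have "norm (f1 *\<^sub>R ?L) = \<bar>f1\<bar> * (2 * ?d)" unfolding norm_scaleR[of f1] norm_linear_part ..
    also have "\<dots> \<le> 1 * (2 * ?d)" using assms(3) norm_p by (intro mult_right_mono) auto
    also have "\<dots> \<le> ?C * ?d" using mult_right_mono[OF C norm_p(4)] by simp
    finally show "norm (f1 *\<^sub>R ?L) \<le> ?C * ?d" .
    fix r assume r: "r < n"
    let ?u = "rel_dev y e p r"
    have "(\<bar>?u\<bar>)\<^sup>2 \<le> ((Y + 1)\<^sup>2 * ?d)\<^sup>2" by (intro power_mono rel_dev_bound r) simp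
    then have u2: "?u\<^sup>2 \<le> (Y + 1) ^ 4 * ?d\<^sup>2" by (simp add: power_divide flip: power_mult)
    have "\<bar>f1 * (?u - ?L \<bullet> y r)\<bar> \<le> 1 * ((Y\<^sup>2 + 1) * ?d\<^sup>2)"
      unfolding abs_mult by (rule mult_mono[OF assms(3) rel_dev_rem[OF r]]) auto
    moreover have "f ?u - f0 - (f1 *\<^sub>R ?L) \<bullet> y r = (f ?u - f0 - f1 * ?u) + f1 * (?u - ?L \<bullet> y r)"
      unfolding inner_scaleR_left[of f1] by (simp only: right_diff_distrib)
    ultimately have "\<bar>f ?u - f0 - (f1 *\<^sub>R ?L) \<bullet> y r\<bar> \<le> 2 * ((Y + 1) ^ 4 * ?d\<^sup>2) + (Y\<^sup>2 + 1) * ?d\<^sup>2"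
      using f[OF rel_dev_bound(2)[OF r]] u2 by linarith
    also have "\<dots> \<le> ?C * ?d\<^sup>2" by (simp add: algebra_simps)
    finally show "\<bar>f ?u - f0 - (f1 *\<^sub>R ?L) \<bullet> y r\<bar> \<le> ?C * ?d\<^sup>2" .
  qed
qed

lemma rho_eq_rel_dev: "rho e (p - y r) = (norm p)\<^sup>2 * (1 + rel_dev y e p r)"
  using norm_p by (simp add: rel_dev_def)

lemma rho_lower: "r < n \<Longrightarrow> (norm p)\<^sup>2 / 2 \<le> rho e (p - y r)"
proof -
  assume "r < n"
  then have "1 / 2 \<le> 1 + rel_dev y e p r" using rel_dev_bound(2)[of r] by (simp add: abs_le_iff)
  then show ?thesis unfolding rho_eq_rel_dev using mult_left_mono[of "1/2" "1 + rel_dev y e p r" "(norm p)\<^sup>2"] by simp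
qed

lemma expansion_inverse: "affine_expansion n y (1 / norm p) (expansion_const Y) (\<lambda>r. (norm p)\<^sup>2 * inverse (rho e (p - y r)))"
proof -
  have "\<bar>inverse (1 + u) - 1 - (- 1) * u\<bar> \<le> 2 * u\<^sup>2" if "\<bar>u\<bar> \<le> 1 / 2" for u :: real
  proof -
    have u: "1 / 2 \<le> 1 + u" using that by (simp add: abs_le_iff)
    then have "inverse (1 + u) - 1 - (- 1) * u = u\<^sup>2 * inverse (1 + u)"
      by (simp add: field_simps power2_eq_square)
    moreover have "inverse (1 + u) \<le> 2" "0 \<le> inverse (1 + u)" using u by (simp_all add: field_simps)
    ultimately show ?thesis using mult_left_mono[of "inverse (1 + u)" 2 "u\<^sup>2"] by (simp add: abs_mult mult.commute)
  qed
  from affine_expansion_rel_dev_comp[OF this]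
  have "affine_expansion n y (1 / norm p) (expansion_const Y) (\<lambda>r. inverse (1 + rel_dev y e p r))"
    by (simp add: expansion_const_def)
  moreover have "(norm p)\<^sup>2 * inverse (rho e (p - y r)) = inverse (1 + rel_dev y e p r)" for r
    unfolding rho_eq_rel_dev inverse_mult_distrib mult.assoc[symmetric] using norm_p by simp
  ultimately show ?thesis by simp
qed

lemma expansion_ln: "affine_expansion n y (1 / norm p) (expansion_const Y) (\<lambda>r. ln (1 + rel_dev y e p r))"
proof -
  have "\<bar>ln (1 + u) - 0 - 1 * u\<bar> \<le> 2 * u\<^sup>2" if "\<bar>u\<bar> \<le> 1 / 2" for u :: real
    using abs_ln_one_plus_x_minus_x_bound[OF that] by simp
  from affine_expansion_rel_dev_comp[OF this] show ?thesis by (simp add: expansion_const_def)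
qed

text \<open>Exactly affine in the centre. Division by |p| brings the leading term to order 1, the
  normalisation in which expansions are multiplied.\<close>

lemma expansion_coord: "affine_expansion n y (1 / norm p) 1 (\<lambda>r. vec_nth (p - y r) i / norm p)"
  unfolding affine_expansion_def
proof (intro exI[of _ "vec_nth p i / norm p"] exI[of _ "(- 1 / norm p) *\<^sub>R axis i 1"] conjI allI impI)
  show "\<bar>vec_nth p i / norm p\<bar> \<le> 1" using component_le_norm_cart[of p i] norm_p by (simp add: field_simps)
  show "norm ((- 1 / norm p) *\<^sub>R (axis i 1 :: real^2)) \<le> 1 * (1 / norm p)" by (simp add: norm_axis_1)
  show "\<bar>vec_nth (p - y r) i / norm p - vec_nth p i / norm p - (- 1 / norm p) *\<^sub>R axis i 1 \<bullet> y r\<bar> \<le> 1 * (1 / norm p)\<^sup>2" for r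
    by (simp add: inner_axis' diff_divide_distrib)
qed

lemma expansion_coord_inverse:
  "affine_expansion n y (1 / norm p) (1 * expansion_const Y * (Y\<^sup>2 + 2 * Y + 3))
    (\<lambda>r. vec_nth (p - y r) i / norm p * ((norm p)\<^sup>2 * inverse (rho e (p - y r))))"
  by (rule affine_expansion_mult[OF expansion_coord expansion_inverse centre_norm_le norm_p(4,5) Y])

lemma expansion_coord_coord_inverse:
  "affine_expansion n y (1 / norm p) (1 * (1 * expansion_const Y * (Y\<^sup>2 + 2 * Y + 3)) * (Y\<^sup>2 + 2 * Y + 3))
    (\<lambda>r. vec_nth (p - y r) j / norm p * (vec_nth (p - y r) i / norm p * ((norm p)\<^sup>2 * inverse (rho e (p - y r)))))"
  by (rule affine_expansion_mult[OF expansion_coord expansion_coord_inverse centre_norm_le norm_p(4,5) Y])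

end

end

text \<open>Weights and centres are left general: besides the interpolation points, the uniqueness
  argument uses a combination with one additional centre.\<close>

definition spline_hess :: "nat \<Rightarrow> (nat \<Rightarrow> real) \<Rightarrow> (nat \<Rightarrow> real^2) \<Rightarrow> real \<Rightarrow> 2 \<Rightarrow> 2 \<Rightarrow> real^2 \<Rightarrow> real" where
  "spline_hess n \<beta> y e i j p = (\<Sum>r<n. \<beta> r * kernel_hess e i j (p - y r))"

definition spline_grad_lap :: "nat \<Rightarrow> (nat \<Rightarrow> real) \<Rightarrow> (nat \<Rightarrow> real^2) \<Rightarrow> real \<Rightarrow> 2 \<Rightarrow> real^2 \<Rightarrow> real" where
  "spline_grad_lap n \<beta> y e i p = (\<Sum>r<n. \<beta> r * kernel_grad_lap e i (p - y r))"

definition spline_bilap :: "nat \<Rightarrow> (nat \<Rightarrow> real) \<Rightarrow> (nat \<Rightarrow> real^2) \<Rightarrow> real \<Rightarrow> real^2 \<Rightarrow> real" where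
  "spline_bilap n \<beta> y e p = (\<Sum>r<n. \<beta> r * (16 * e ^ 4 / (rho e (p - y r)) ^ 3))"

lemma spline_hess_commute: "spline_hess n \<beta> y e i j = spline_hess n \<beta> y e j i"
  unfolding spline_hess_def[abs_def] kernel_hess_commute[of e i j] ..

lemma smooth_spline_hess: "e \<noteq> 0 \<Longrightarrow> smooth (spline_hess n \<beta> y e i j)"
  unfolding spline_hess_def[abs_def] by (intro smooth_sum smooth_cmult smooth_shift smooth_kernel_hess)

lemma smooth_spline_grad_lap: "e \<noteq> 0 \<Longrightarrow> smooth (spline_grad_lap n \<beta> y e i)"
  unfolding spline_grad_lap_def[abs_def] by (intro smooth_sum smooth_cmult smooth_shift smooth_kernel_grad_lap)

lemma partial_combination:
  assumes "smooth u"
  shows "partial j (\<lambda>p. \<Sum>r<n. \<beta> r * u (p - y r)) p = (\<Sum>r<n. \<beta> r * partial j u (p - y r))"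
  by (simp add: partial_sum smooth_cmult smooth_shift partial_cmult partial_shift assms)

lemma div_spline_hess:
  assumes "e \<noteq> 0"
  shows "(\<Sum>j\<in>UNIV. partial j (spline_hess n \<beta> y e i j) p) = spline_grad_lap n \<beta> y e i p"
  unfolding spline_hess_def[abs_def] spline_grad_lap_def partial_combination[OF smooth_kernel_hess[OF assms]]
  by (subst sum.swap) (simp add: div_kernel_hess[OF assms] flip: sum_distrib_left)

lemma div_spline_grad_lap:
  assumes "e \<noteq> 0"
  shows "(\<Sum>i\<in>UNIV. partial i (spline_grad_lap n \<beta> y e i) p) = spline_bilap n \<beta> y e p"
  unfolding spline_grad_lap_def[abs_def] spline_bilap_def partial_combination[OF smooth_kernel_grad_lap[OF assms]]
  by (subst sum.swap) (simp add: div_kernel_grad_lap[OF assms] flip: sum_distrib_left)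

lemma borel_rho [measurable]: "rho e \<in> borel_measurable borel"
  unfolding rho_def[abs_def] by measurable

lemma borel_vec_nth [measurable]: "(\<lambda>p :: real^2. vec_nth p i) \<in> borel_measurable borel"
  by (rule smooth_borel[OF smooth_coord])

lemma borel_kernel_hess [measurable]: "kernel_hess e i j \<in> borel_measurable borel"
  unfolding kernel_hess_def[abs_def] by measurable

lemma borel_spline_hess [measurable]: "spline_hess n \<beta> y e i j \<in> borel_measurable borel"
  unfolding spline_hess_def[abs_def] by measurable

lemma spline_hess_tendsto:
  assumes e: "en \<longlonglongrightarrow> 0" and p: "\<And>r. r < n \<Longrightarrow> p \<noteq> y r"
  shows "(\<lambda>k. spline_hess n \<beta> y (en k) i j p) \<longlonglongrightarrow> spline_hess n \<beta> y 0 i j p"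
  unfolding spline_hess_def
proof (intro tendsto_sum tendsto_mult tendsto_const)
  fix r assume "r \<in> {..<n}"
  then have "0 < rho 0 (p - y r)" using p[of r] by (intro rho_pos) auto
  moreover have "(\<lambda>k. rho (en k) (p - y r)) \<longlonglongrightarrow> rho 0 (p - y r)"
    unfolding rho_def by (intro tendsto_intros e)
  ultimately show "(\<lambda>k. kernel_hess (en k) i j (p - y r)) \<longlonglongrightarrow> kernel_hess 0 i j (p - y r)"
    unfolding kernel_hess_def by (intro tendsto_intros) auto
qed

text \<open>The logarithm is bounded above by ln r \<le> r - 1, and below through the power
  |q|^-1/2, whose square is integrable near 0. The bound does not involve e.\<close>

lemma kernel_hess_local_bound:
  assumes e: "0 \<le> e" "e \<le> 1" and q: "q \<noteq> 0" "norm q \<le> M"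
  shows "\<bar>kernel_hess e i j q\<bar> \<le> ((M\<^sup>2 + 3) * sqrt M + 4) * inverse (sqrt (norm q))"
proof -
  let ?s = "inverse (sqrt (norm q))"
  have qp: "0 < norm q" "0 < sqrt (norm q)" using q by simp_all
  have rq: "(norm q)\<^sup>2 \<le> rho e q" by (simp add: rho_def)
  have rp: "0 < rho e q" using q by (intro rho_pos) simp
  have "rho e q \<le> M\<^sup>2 + 1\<^sup>2"
    unfolding rho_def using e q by (intro add_mono power_mono) auto
  then have up: "ln (rho e q) \<le> M\<^sup>2" using ln_le_minus_one[OF rp] by simp
  have "2 * ln (norm q) = ln ((norm q)\<^sup>2)" using qp by (simp add: ln_realpow)
  also have "\<dots> \<le> ln (rho e q)" using rq qp rp by (simp add: ln_mono)
  finally have "2 * ln (norm q) \<le> ln (rho e q)" .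
  \<comment> \<open>Passing to s = |q|^-1/2 before using ln s \<le> s is what yields the exponent
    1/2.\<close>
  moreover have "ln (norm q) = - 2 * ln ?s"
  proof -
    have "ln (norm q) = ln ((sqrt (norm q))\<^sup>2)" by simp
    also have "\<dots> = 2 * ln (sqrt (norm q))" using qp(2) by (subst ln_realpow) simp_all
    finally show ?thesis using qp(2) by (simp only: ln_inverse)
  qed
  moreover have "ln ?s \<le> ?s" using ln_le_minus_one[of ?s] qp by simp
  ultimately have "- 4 * ?s \<le> ln (rho e q)" by linarith
  moreover have "0 \<le> M\<^sup>2" "0 \<le> ?s" using qp by simp_all
  ultimately have ln: "\<bar>ln (rho e q)\<bar> \<le> M\<^sup>2 + 4 * ?s" using up by linarith
  have "\<bar>vec_nth q i * (vec_nth q j * inverse (rho e q))\<bar> \<le> 1"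
  proof -
    have "\<bar>vec_nth q i\<bar> * \<bar>vec_nth q j\<bar> \<le> norm q * norm q"
      by (intro mult_mono component_le_norm_cart) auto
    also have "\<dots> \<le> rho e q" using rq by (simp add: power2_eq_square)
    finally show ?thesis using rp by (simp add: abs_mult field_simps)
  qed
  moreover have "\<bar>(if i = j then 1 else 0) * (ln (rho e q) + 1)\<bar> \<le> \<bar>ln (rho e q)\<bar> + 1"
    using abs_triangle_ineq[of "ln (rho e q)" 1] by auto
  ultimately have "\<bar>kernel_hess e i j q\<bar> \<le> (M\<^sup>2 + 3) + 4 * ?s"
    using ln unfolding kernel_hess_def by linarith
  \<comment> \<open>Since |q| \<le> M, the factor sqrt M |q|^-1/2 is at least 1 and absorbs the
    additive constant.\<close>
  also have "M\<^sup>2 + 3 \<le> (M\<^sup>2 + 3) * (sqrt M * ?s)"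
  proof -
    have "1 \<le> sqrt M * ?s" using q qp by (simp add: field_simps)
    then have "(M\<^sup>2 + 3) * 1 \<le> (M\<^sup>2 + 3) * (sqrt M * ?s)" by (rule mult_left_mono) simp
    then show ?thesis by simp
  qed
  finally show ?thesis by (simp add: algebra_simps)
qed

context
  fixes n :: nat and \<beta> :: "nat \<Rightarrow> real" and y :: "nat \<Rightarrow> real^2" and Y :: real
  assumes Y: "0 \<le> Y" and y: "\<forall>r<n. norm (y r) \<le> Y"
    and \<beta>0: "(\<Sum>r<n. \<beta> r) = 0" and \<beta>1: "(\<Sum>r<n. \<beta> r *\<^sub>R y r) = 0"
begin

lemma centre_norm_bound: "r < n \<Longrightarrow> norm (y r) \<le> Y"
  using y by blast

text \<open>ln rho splits into ln |p|^2, which is common to all centres and removed by the vanishing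
  sum of the weights, and ln (1 + u), which has an affine expansion, as has p_i p_j / rho.
  Cancellation then gains two powers of 1 / |p|, uniformly in e.\<close>

lemma spline_hess_decay:
  "\<exists>C\<ge>0. \<forall>e p i j. 0 \<le> e \<longrightarrow> e \<le> 1 \<longrightarrow> 2 * (Y + 1)\<^sup>2 \<le> norm p \<longrightarrow>
     \<bar>spline_hess n \<beta> y e i j p\<bar> \<le> C * (1 / norm p)\<^sup>2"
proof -
  let ?S = "Y\<^sup>2 + 2 * Y + 3" and ?B = "\<Sum>r<n. \<bar>\<beta> r\<bar>"
  let ?K = "1 * (1 * expansion_const Y * ?S) * ?S"
  have ec: "0 \<le> expansion_const Y" "0 \<le> ?K" using Y by (simp_all add: expansion_const_def)
  have B: "0 \<le> ?B" by (simp add: sum_nonneg)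
  show ?thesis
  proof (intro exI[of _ "?B * expansion_const Y + 2 * (?B * ?K)"] conjI allI impI)
    show "0 \<le> ?B * expansion_const Y + 2 * (?B * ?K)" using ec B by simp
    fix e :: real and p :: "real^2" and i j :: 2 assume e: "0 \<le> e" "e \<le> 1" and p: "2 * (Y + 1)\<^sup>2 \<le> norm p"
    note prem = Y y e p
    have np: "0 < norm p" by (rule norm_p(3)[OF prem])
    let ?D = "if i = j then 1 else 0 :: real"
    let ?F = "\<lambda>r. vec_nth (p - y r) i / norm p * (vec_nth (p - y r) j / norm p * ((norm p)\<^sup>2 * inverse (rho e (p - y r))))"
    let ?L = "\<lambda>r. ln (1 + rel_dev y e p r)"
    have split: "kernel_hess e i j (p - y r) = ?D * (ln ((norm p)\<^sup>2) + 1) + ?D * ?L r + 2 * ?F r" if "r < n" for r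
    proof -
      have "0 < 1 + rel_dev y e p r" using rel_dev_bound(2)[OF prem that] by (simp add: abs_le_iff)
      then have "ln (rho e (p - y r)) = ln ((norm p)\<^sup>2) + ?L r"
        unfolding rho_eq_rel_dev[OF prem, of r] using np by (intro ln_mult_pos) auto
      moreover have "vec_nth (p - y r) i * (vec_nth (p - y r) j * inverse (rho e (p - y r))) = ?F r"
        using np by (simp add: power2_eq_square)
      ultimately show ?thesis unfolding kernel_hess_def by (simp add: distrib_left)
    qed
    have "spline_hess n \<beta> y e i j p = (\<Sum>r<n. ?D * (ln ((norm p)\<^sup>2) + 1) * \<beta> r + ?D * (\<beta> r * ?L r) + 2 * (\<beta> r * ?F r))"
      unfolding spline_hess_def by (intro sum.cong refl) (simp add: split distrib_left del: mult_eq_0_iff, simp add: algebra_simps)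
    also have "\<dots> = ?D * (ln ((norm p)\<^sup>2) + 1) * (\<Sum>r<n. \<beta> r) + ?D * (\<Sum>r<n. \<beta> r * ?L r) + 2 * (\<Sum>r<n. \<beta> r * ?F r)"
      by (simp only: sum.distrib sum_distrib_left)
    finally have eq: "spline_hess n \<beta> y e i j p = ?D * (\<Sum>r<n. \<beta> r * ?L r) + 2 * (\<Sum>r<n. \<beta> r * ?F r)"
      using \<beta>0 by simp
    have 1: "\<bar>\<Sum>r<n. \<beta> r * ?L r\<bar> \<le> ?B * (expansion_const Y * (1 / norm p)\<^sup>2)"
      by (rule affine_expansion_cancel[OF expansion_ln[OF prem] \<beta>0 \<beta>1])
    have 2: "\<bar>\<Sum>r<n. \<beta> r * ?F r\<bar> \<le> ?B * (?K * (1 / norm p)\<^sup>2)"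
      by (rule affine_expansion_cancel[OF expansion_coord_coord_inverse[OF prem] \<beta>0 \<beta>1])
    have "\<bar>?D * (\<Sum>r<n. \<beta> r * ?L r)\<bar> \<le> \<bar>\<Sum>r<n. \<beta> r * ?L r\<bar>" by simp
    with 1 2 have "\<bar>spline_hess n \<beta> y e i j p\<bar> \<le> ?B * (expansion_const Y * (1 / norm p)\<^sup>2) + 2 * (?B * (?K * (1 / norm p)\<^sup>2))"
      unfolding eq by linarith
    then show "\<bar>spline_hess n \<beta> y e i j p\<bar> \<le> (?B * expansion_const Y + 2 * (?B * ?K)) * (1 / norm p)\<^sup>2"
      by (simp only: distrib_right mult.assoc)
  qed
qed

text \<open>The leading term has order 1 / |p| per centre and gains two powers by cancellation; the
  term with the factor e^2 has order |p|^-3 centre by centre.\<close>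

lemma spline_grad_lap_decay:
  "\<exists>C\<ge>0. \<forall>e p i. 0 \<le> e \<longrightarrow> e \<le> 1 \<longrightarrow> 2 * (Y + 1)\<^sup>2 \<le> norm p \<longrightarrow>
     \<bar>spline_grad_lap n \<beta> y e i p\<bar> \<le> C * (1 / norm p) ^ 3"
proof -
  let ?S = "Y\<^sup>2 + 2 * Y + 3" and ?B = "\<Sum>r<n. \<bar>\<beta> r\<bar>"
  let ?K = "1 * expansion_const Y * ?S"
  have ec: "0 \<le> ?K" using Y by (simp add: expansion_const_def)
  have B: "0 \<le> ?B" by (simp add: sum_nonneg)
  show ?thesis
  proof (intro exI[of _ "4 * (?B * ?K) + 32 * ?B"] conjI allI impI)
    show "0 \<le> 4 * (?B * ?K) + 32 * ?B" using ec B by simp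
    fix e :: real and p :: "real^2" and i :: 2 assume e: "0 \<le> e" "e \<le> 1" and p: "2 * (Y + 1)\<^sup>2 \<le> norm p"
    note prem = Y y e p
    have np: "0 < norm p" by (rule norm_p(3)[OF prem])
    let ?d = "1 / norm p"
    let ?F = "\<lambda>r. vec_nth (p - y r) i / norm p * ((norm p)\<^sup>2 * inverse (rho e (p - y r)))"
    let ?G = "\<lambda>r. e\<^sup>2 * (vec_nth (p - y r) i * (inverse (rho e (p - y r)) * inverse (rho e (p - y r))))"
    have split: "kernel_grad_lap e i (p - y r) = 4 * (?d * ?F r) + 4 * ?G r" for r
      unfolding kernel_grad_lap_def using np by (simp add: power2_eq_square)
    have "spline_grad_lap n \<beta> y e i p = (\<Sum>r<n. 4 * ?d * (\<beta> r * ?F r) + 4 * (\<beta> r * ?G r))"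
      unfolding spline_grad_lap_def split by (intro sum.cong refl) (simp only: distrib_left mult_ac)
    also have "\<dots> = 4 * ?d * (\<Sum>r<n. \<beta> r * ?F r) + 4 * (\<Sum>r<n. \<beta> r * ?G r)"
      by (simp only: sum.distrib sum_distrib_left)
    finally have eq: "spline_grad_lap n \<beta> y e i p = 4 * ?d * (\<Sum>r<n. \<beta> r * ?F r) + 4 * (\<Sum>r<n. \<beta> r * ?G r)" .
    have "\<bar>\<Sum>r<n. \<beta> r * ?F r\<bar> \<le> ?B * (?K * ?d\<^sup>2)"
      by (rule affine_expansion_cancel[OF expansion_coord_inverse[OF prem] \<beta>0 \<beta>1])
    then have "\<bar>4 * ?d * (\<Sum>r<n. \<beta> r * ?F r)\<bar> \<le> 4 * ?d * (?B * (?K * ?d\<^sup>2))"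
      unfolding abs_mult using np by (intro mult_mono) auto
    also have "\<dots> = 4 * (?B * ?K) * ?d ^ 3" by (simp add: power2_eq_square power3_eq_cube)
    finally have 1: "\<bar>4 * ?d * (\<Sum>r<n. \<beta> r * ?F r)\<bar> \<le> 4 * (?B * ?K) * ?d ^ 3" .
    \<comment> \<open>The 8 collects |p_i - y_i| \<le> 2 |p| and 1 / rho \<le> 2 / |p|^2, the latter
      used twice.\<close>
    have G: "\<bar>?G r\<bar> \<le> 8 * ?d ^ 3" if r: "r < n" for r
    proof -
      let ?w = "inverse (rho e (p - y r))"
      have "?w \<le> inverse ((norm p)\<^sup>2 / 2)" using rho_lower[OF prem r] np by (intro le_imp_inverse_le) auto
      also have "\<dots> = 2 * ?d\<^sup>2" using np by (simp add: field_simps)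
      finally have w: "?w \<le> 2 * ?d\<^sup>2" .
      have w0: "0 \<le> ?w" using rho_nonneg by simp
      have "\<bar>vec_nth (p - y r) i\<bar> \<le> norm p + norm (y r)"
        using component_le_norm_cart[of "p - y r" i] norm_triangle_ineq4[of p "y r"] by linarith
      then have q: "\<bar>vec_nth (p - y r) i\<bar> \<le> 2 * norm p" using centre_norm_bound[OF r] norm_p(2)[OF prem] by linarith
      have "e\<^sup>2 \<le> 1" using e by (intro power_le_one)
      then have "\<bar>e\<^sup>2\<bar> * (\<bar>vec_nth (p - y r) i\<bar> * (\<bar>?w\<bar> * \<bar>?w\<bar>)) \<le> 1 * (2 * norm p * (2 * ?d\<^sup>2 * (2 * ?d\<^sup>2)))"
        using w w0 q by (intro mult_mono mult_nonneg_nonneg) auto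
      also have "\<dots> = 8 * ?d ^ 3" using np by (simp add: field_simps eval_nat_numeral)
      finally show ?thesis by (simp only: abs_mult)
    qed
    have "\<bar>\<Sum>r<n. \<beta> r * ?G r\<bar> \<le> (\<Sum>r<n. \<bar>\<beta> r\<bar> * (8 * ?d ^ 3))"
      by (intro order_trans[OF sum_abs] sum_mono) (unfold abs_mult[of "\<beta> _"], intro mult_left_mono G, auto)
    also have "\<dots> = 8 * ?B * ?d ^ 3" by (simp only: sum_distrib_right[symmetric])
    finally have "\<bar>\<Sum>r<n. \<beta> r * ?G r\<bar> \<le> 8 * ?B * ?d ^ 3" .
    with 1 have "\<bar>spline_grad_lap n \<beta> y e i p\<bar> \<le> 4 * (?B * ?K) * ?d ^ 3 + 4 * (8 * ?B * ?d ^ 3)"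
      unfolding eq by linarith
    then show "\<bar>spline_grad_lap n \<beta> y e i p\<bar> \<le> (4 * (?B * ?K) + 32 * ?B) * ?d ^ 3"
      by (simp add: distrib_right)
  qed
qed

text \<open>Inverse square roots of the distance dominate around the centres, the decay function far
  away. The same majorant gives membership in L2 and the domination for the limit e to 0.\<close>

lemma spline_hess_dominated:
  "\<exists>D. in_L2 D \<and> (\<forall>e p i j. 0 \<le> e \<longrightarrow> e \<le> 1 \<longrightarrow> (\<forall>r<n. p \<noteq> y r) \<longrightarrow> \<bar>spline_hess n \<beta> y e i j p\<bar> \<le> D p)"
proof -
  obtain C where C: "0 \<le> C" "\<forall>e p i j. 0 \<le> e \<longrightarrow> e \<le> 1 \<longrightarrow> 2 * (Y + 1)\<^sup>2 \<le> norm p \<longrightarrow>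
     \<bar>spline_hess n \<beta> y e i j p\<bar> \<le> C * (1 / norm p)\<^sup>2"
    using spline_hess_decay by blast
  \<comment> \<open>Every point below the decay threshold lies within \<open>M\<close> of every
    centre.\<close>
  define M where "M = 2 * (Y + 1)\<^sup>2 + Y"
  have "0 < (Y + 1)\<^sup>2" using Y by simp
  then have M: "0 < M" using Y unfolding M_def by linarith
  let ?K = "(M\<^sup>2 + 3) * sqrt M + 4"
  let ?s = "\<lambda>r p. indicator (cball (y r) M) p * inverse (sqrt (norm (p - y r)))"
  let ?D = "\<lambda>p. (\<Sum>r<n. (\<bar>\<beta> r\<bar> * ?K) * ?s r p) + 2 * C * inverse (1 + (norm p)\<^sup>2)"
  have s0: "0 \<le> ?s r p" for r p by simp
  show ?thesis
  proof (intro exI[of _ ?D] conjI allI impI)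
    show "in_L2 ?D" by (intro in_L2_add in_L2_sum in_L2_cmult in_L2_local_singularity in_L2_decay M)
    fix e :: real and p :: "real^2" and i j :: 2 assume e: "0 \<le> e" "e \<le> 1" and p: "\<forall>r<n. p \<noteq> y r"
    have near: "0 \<le> (\<Sum>r<n. (\<bar>\<beta> r\<bar> * ?K) * ?s r p)"
      using M by (intro sum_nonneg mult_nonneg_nonneg[OF _ s0]) auto
    show "\<bar>spline_hess n \<beta> y e i j p\<bar> \<le> ?D p"
    proof (cases "2 * (Y + 1)\<^sup>2 \<le> norm p")
      case True
      have np: "1 \<le> norm p" using norm_p(1)[OF Y y e True] by linarith
      then have "1 \<le> (norm p)\<^sup>2" by (simp add: one_le_power)
      moreover have "1 / N \<le> 2 * inverse (1 + N)" if "1 \<le> N" for N :: real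
        using that by (simp add: field_simps)
      ultimately have "(1 / norm p)\<^sup>2 \<le> 2 * inverse (1 + (norm p)\<^sup>2)" by (simp only: power_one_over)
      then have "C * (1 / norm p)\<^sup>2 \<le> C * (2 * inverse (1 + (norm p)\<^sup>2))" using C(1) by (rule mult_left_mono)
      moreover have "\<bar>spline_hess n \<beta> y e i j p\<bar> \<le> C * (1 / norm p)\<^sup>2" using C(2) e True by blast
      ultimately show ?thesis using near by simp
    next
      case False
      have b: "\<bar>\<beta> r * kernel_hess e i j (p - y r)\<bar> \<le> (\<bar>\<beta> r\<bar> * ?K) * ?s r p" if r: "r < n" for r
      proof -
        have "norm (p - y r) \<le> norm p + norm (y r)" by (rule norm_triangle_ineq4)
        then have m: "norm (p - y r) \<le> M" using False centre_norm_bound[OF r] by (simp add: M_def)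
        then have ind: "indicator (cball (y r) M) p = (1::real)" by (simp add: dist_norm norm_minus_commute)
        have "\<bar>kernel_hess e i j (p - y r)\<bar> \<le> ?K * inverse (sqrt (norm (p - y r)))"
          using p r m by (intro kernel_hess_local_bound e) auto
        then have "\<bar>\<beta> r\<bar> * \<bar>kernel_hess e i j (p - y r)\<bar> \<le> \<bar>\<beta> r\<bar> * (?K * inverse (sqrt (norm (p - y r))))"
          by (rule mult_left_mono) simp
        then show ?thesis unfolding ind by (simp only: abs_mult mult_1_left mult.assoc)
      qed
      have "\<bar>spline_hess n \<beta> y e i j p\<bar> \<le> (\<Sum>r<n. (\<bar>\<beta> r\<bar> * ?K) * ?s r p)"
        unfolding spline_hess_def by (intro order_trans[OF sum_abs] sum_mono b) simp
      moreover have "0 \<le> 2 * C * inverse (1 + (norm p)\<^sup>2)" using C(1) by (simp add: add_nonneg_nonneg)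
      ultimately show ?thesis by linarith
    qed
  qed
qed

lemma AE_not_centre: "AE p in lebesgue. \<forall>r<n. p \<noteq> y r"
proof -
  have "negligible (y ` {..<n})" by (rule negligible_finite) simp
  then have "y ` {..<n} \<in> null_sets lebesgue" by (simp add: negligible_iff_null_sets)
  then show ?thesis by (rule AE_I') auto
qed

lemma in_L2_spline_hess:
  assumes "0 \<le> e" "e \<le> 1"
  shows "in_L2 (spline_hess n \<beta> y e i j)"
proof -
  obtain D where D: "in_L2 D" "\<forall>e p i j. 0 \<le> e \<longrightarrow> e \<le> 1 \<longrightarrow> (\<forall>r<n. p \<noteq> y r) \<longrightarrow> \<bar>spline_hess n \<beta> y e i j p\<bar> \<le> D p"
    using spline_hess_dominated by blast
  show ?thesis
  proof (rule in_L2_bound[OF D(1) borel_imp_lebesgue_measurable[OF borel_spline_hess]])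
    show "AE p in lebesgue. \<bar>spline_hess n \<beta> y e i j p\<bar> \<le> \<bar>D p\<bar>"
      using AE_not_centre
    proof eventually_elim
      case (elim p)
      then have "\<bar>spline_hess n \<beta> y e i j p\<bar> \<le> D p" using D(2) assms by blast
      then show ?case by linarith
    qed
  qed
qed

lemma LINT_spline_hess_tendsto:
  assumes u: "in_L2 u" and e: "\<And>k. 0 \<le> en k" "\<And>k. en k \<le> 1" "en \<longlonglongrightarrow> 0"
  shows "(\<lambda>k. LINT p|lebesgue. u p * spline_hess n \<beta> y (en k) i j p) \<longlonglongrightarrow>
    (LINT p|lebesgue. u p * spline_hess n \<beta> y 0 i j p)"
proof -
  obtain D where D: "in_L2 D" "\<forall>e p i j. 0 \<le> e \<longrightarrow> e \<le> 1 \<longrightarrow> (\<forall>r<n. p \<noteq> y r) \<longrightarrow> \<bar>spline_hess n \<beta> y e i j p\<bar> \<le> D p"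
    using spline_hess_dominated by blast
  show ?thesis
  proof (rule integral_dominated_convergence)
    show "integrable lebesgue (\<lambda>p. \<bar>u p * D p\<bar>)"
      by (intro integrable_abs in_L2_integrable_mult u D)
    show "(\<lambda>p. u p * spline_hess n \<beta> y e i j p) \<in> borel_measurable lebesgue" for e
      by (intro borel_measurable_times in_L2_measurable u borel_imp_lebesgue_measurable borel_spline_hess)
    then show "(\<lambda>p. u p * spline_hess n \<beta> y e i j p) \<in> borel_measurable lebesgue" for e .
    show "AE p in lebesgue. (\<lambda>k. u p * spline_hess n \<beta> y (en k) i j p) \<longlonglongrightarrow> u p * spline_hess n \<beta> y 0 i j p"
      using AE_not_centre by eventually_elim (intro tendsto_mult tendsto_const spline_hess_tendsto e, blast)
    show "AE p in lebesgue. norm (u p * spline_hess n \<beta> y (en k) i j p) \<le> \<bar>u p * D p\<bar>" for k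
      using AE_not_centre
    proof eventually_elim
      case (elim p)
      then have "\<bar>spline_hess n \<beta> y (en k) i j p\<bar> \<le> D p" using D(2) e by blast
      then have "\<bar>u p\<bar> * \<bar>spline_hess n \<beta> y (en k) i j p\<bar> \<le> \<bar>u p\<bar> * \<bar>D p\<bar>" by (intro mult_left_mono) auto
      then show ?case by (simp add: abs_mult)
    qed
  qed
qed

end

section \<open>Kernel combinations represent point evaluations\<close>

lemma partial_eq_0_open:
  assumes "open S" "p \<in> S" "\<And>q. q \<in> S \<Longrightarrow> u q = c"
  shows "partial i u p = 0"
proof -
  have "(u has_derivative (\<lambda>v. 0)) (at p)"
    by (rule has_derivative_transform_within_open[OF has_derivative_const[of c] assms(1,2)]) (simp add: assms(3))
  then show ?thesis by (simp add: partial_eq)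
qed

lemma continuous_bounded_cball:
  fixes u :: "real^2 \<Rightarrow> real"
  assumes "continuous_on UNIV u"
  shows "\<exists>B. \<forall>p\<in>cball 0 R. \<bar>u p\<bar> \<le> B"
proof -
  have "bounded (u ` cball 0 R)"
    by (rule compact_imp_bounded[OF compact_continuous_image[OF continuous_on_subset[OF assms subset_UNIV] compact_cball]])
  then show ?thesis by (auto simp: bounded_iff)
qed

lemma test_function_bounded:
  assumes "test_function \<psi>"
  shows "\<exists>B. \<forall>p. \<bar>\<psi> p\<bar> \<le> B"
proof -
  obtain R where R: "\<And>p. R < norm p \<Longrightarrow> \<psi> p = 0"
    by (rule test_function_bound[OF assms]) (rule that)
  obtain B where B: "\<forall>p\<in>cball 0 R. \<bar>\<psi> p\<bar> \<le> B"
    using continuous_bounded_cball[OF smooth_continuous[OF test_function_smooth[OF assms]]] by blast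
  have "\<bar>\<psi> p\<bar> \<le> max B 0" for p
  proof (cases "R < norm p")
    case False
    then have "\<bar>\<psi> p\<bar> \<le> B" using B by simp
    then show ?thesis by linarith
  qed (simp add: R)
  then show ?thesis by blast
qed

text \<open>Product rule; the symmetry of \<open>S\<close> merges the two mixed terms into one with
  factor 2.\<close>

lemma double_divergence_cutoff:
  assumes \<chi>: "smooth \<chi>" and S: "\<And>i j. smooth (S i j)" "\<And>i j. S i j = S j i"
  shows "(\<Sum>i\<in>UNIV. \<Sum>j\<in>UNIV. partial i (partial j (\<lambda>p. \<chi> p * S i j p)) p) =
    \<chi> p * (\<Sum>i\<in>UNIV. partial i (\<lambda>p. \<Sum>j\<in>UNIV. partial j (S i j) p) p) +
    ((\<Sum>i\<in>UNIV. \<Sum>j\<in>UNIV. partial i (partial j \<chi>) p * S i j p) +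
     2 * (\<Sum>i\<in>UNIV. partial i \<chi> p * (\<Sum>j\<in>UNIV. partial j (S i j) p)))"
proof -
  have 1: "partial i (partial j (\<lambda>p. \<chi> p * S i j p)) p =
      \<chi> p * partial i (partial j (S i j)) p + partial i \<chi> p * partial j (S i j) p +
      (partial j \<chi> p * partial i (S i j) p + partial i (partial j \<chi>) p * S i j p)" for i j
    by (simp add: partial_smooth_mult partial_smooth_add \<chi> S(1) smooth_mult smooth_partial)
  have 2: "partial i (\<lambda>p. \<Sum>j\<in>UNIV. partial j (S i j) p) p = (\<Sum>j\<in>UNIV. partial i (partial j (S i j)) p)" for i
    by (simp add: partial_sum smooth_partial S(1))
  show ?thesis
    unfolding 1 2 unfolding sum_2 S(2)[of 2 1] by (simp add: algebra_simps)
qed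

section \<open>Cutoffs at radius R and their commutators\<close>

definition cutoff_at :: "real \<Rightarrow> real^2 \<Rightarrow> real" where
  "cutoff_at R p = cutoff (p /\<^sub>R R)"

lemma smooth_cutoff_at: "smooth (cutoff_at R)"
  unfolding cutoff_at_def[abs_def] by (rule smooth_scale[OF smooth_cutoff])

lemma cutoff_at_eq_1: "0 < R \<Longrightarrow> norm p \<le> R \<Longrightarrow> cutoff_at R p = 1"
  unfolding cutoff_at_def by (intro cutoff_eq_1) (simp add: field_simps)

lemma cutoff_at_eq_0: "0 < R \<Longrightarrow> 2 * R < norm p \<Longrightarrow> cutoff_at R p = 0"
  unfolding cutoff_at_def by (intro cutoff_eq_0) (simp add: field_simps)

lemma cutoff_at_bounds: "0 \<le> cutoff_at R p" "cutoff_at R p \<le> 1"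
  by (simp_all add: cutoff_at_def cutoff_bounds)

lemma test_function_cutoff_at: "0 < R \<Longrightarrow> test_function (cutoff_at R)"
  unfolding cutoff_at_def[abs_def] by (rule test_function_cutoff)

lemma partial_cutoff_at:
  "partial i (cutoff_at R) = (\<lambda>p. inverse R * partial i cutoff (p /\<^sub>R R))"
  "partial i (partial j (cutoff_at R)) = (\<lambda>p. (inverse R)\<^sup>2 * partial i (partial j cutoff) (p /\<^sub>R R))"
  unfolding cutoff_at_def[abs_def]
  by (simp_all add: partial_scale partial_cmult smooth_cutoff smooth_partial smooth_scale power2_eq_square mult.assoc)

lemma cutoff_derivatives_bounded:
  "\<exists>B>0. \<forall>i j p. \<bar>partial i cutoff p\<bar> \<le> B \<and> \<bar>partial i (partial j cutoff) p\<bar> \<le> B"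
proof -
  have "test_function (cutoff_at 1)" by (rule test_function_cutoff_at) simp
  then have t: "test_function cutoff" by (simp add: cutoff_at_def[abs_def])
  have "\<forall>i. \<exists>B. \<forall>p. \<bar>partial i cutoff p\<bar> \<le> B"
    by (intro allI test_function_bounded test_function_partial t)
  then obtain B1 where B1: "\<And>i p. \<bar>partial i cutoff p\<bar> \<le> B1 i" by metis
  have "\<forall>i j. \<exists>B. \<forall>p. \<bar>partial i (partial j cutoff) p\<bar> \<le> B"
    by (intro allI test_function_bounded test_function_partial t)
  then obtain B2 where B2: "\<And>i j p. \<bar>partial i (partial j cutoff) p\<bar> \<le> B2 i j" by metis
  have nn: "0 \<le> B1 i" "0 \<le> B2 i j" for i j
    using B1[of i undefined] B2[of i j undefined] by linarith+
  let ?B = "(\<Sum>i\<in>UNIV. B1 i) + (\<Sum>i\<in>UNIV. \<Sum>j\<in>UNIV. B2 i j) + 1"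
  have 1: "B1 i \<le> (\<Sum>i\<in>UNIV. B1 i)" for i
    by (rule member_le_sum) (auto simp: nn)
  have 2: "B2 i j \<le> (\<Sum>i\<in>UNIV. \<Sum>j\<in>UNIV. B2 i j)" for i j
  proof -
    have "B2 i j \<le> (\<Sum>j\<in>UNIV. B2 i j)" by (rule member_le_sum) (auto simp: nn)
    also have "\<dots> \<le> (\<Sum>i\<in>UNIV. \<Sum>j\<in>UNIV. B2 i j)"
      by (rule member_le_sum[where f = "\<lambda>i. \<Sum>j\<in>UNIV. B2 i j"]) (auto simp: nn sum_nonneg)
    finally show ?thesis .
  qed
  have nn': "0 \<le> (\<Sum>i\<in>UNIV. B1 i)" "0 \<le> (\<Sum>i\<in>UNIV. \<Sum>j\<in>UNIV. B2 i j)"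
    by (auto intro!: sum_nonneg simp: nn)
  show ?thesis
  proof (intro exI[of _ ?B] conjI allI)
    show "0 < ?B" using nn' by linarith
    show "\<bar>partial i cutoff p\<bar> \<le> ?B" for i p using B1[of i p] 1[of i] nn' by linarith
    show "\<bar>partial i (partial j cutoff) p\<bar> \<le> ?B" for i j p using B2[of i j p] 2[of i j] nn' by linarith
  qed
qed

(* The terms of the double divergence of cutoff times Hessian in which the cutoff is differentiated. *)
definition commutator :: "nat \<Rightarrow> (nat \<Rightarrow> real) \<Rightarrow> (nat \<Rightarrow> real^2) \<Rightarrow> real \<Rightarrow> real \<Rightarrow> real^2 \<Rightarrow> real" where
  "commutator n \<beta> y e R p =
     (\<Sum>i\<in>UNIV. \<Sum>j\<in>UNIV. partial i (partial j (cutoff_at R)) p * spline_hess n \<beta> y e i j p) +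
     2 * (\<Sum>i\<in>UNIV. partial i (cutoff_at R) p * spline_grad_lap n \<beta> y e i p)"

lemma smooth_commutator: "e \<noteq> 0 \<Longrightarrow> smooth (commutator n \<beta> y e R)"
  unfolding commutator_def[abs_def]
  by (intro smooth_add smooth_sum smooth_cmult smooth_mult smooth_partial smooth_cutoff_at
      smooth_spline_hess smooth_spline_grad_lap)

text \<open>The cutoff is constant on the open disc of radius R and outside the disc of radius 2 R.
  The commutator thus lives on the annulus in between, where the decay estimates apply for large
  R.\<close>

lemma commutator_eq_0:
  assumes "0 < R" "norm p < R \<or> 2 * R < norm p"
  shows "commutator n \<beta> y e R p = 0"
proof -
  have 0: "partial i (cutoff_at R) q = 0" if "norm q < R \<or> 2 * R < norm q" for i q
    using that
  proof
    assume "norm q < R"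
    then show ?thesis
      by (intro partial_eq_0_open[of "ball 0 R" _ _ 1]) (use assms(1) in \<open>auto intro!: cutoff_at_eq_1\<close>)
  qed (rule partial_eq_0[OF cutoff_at_eq_0[OF assms(1)]])
  have "open ({q. norm q < R} \<union> {q :: real^2. 2 * R < norm q})"
    by (intro open_Un open_Collect_less continuous_intros)
  then have "partial i (partial j (cutoff_at R)) p = 0" for i j
    by (rule partial_eq_0_open) (use assms 0 in auto)
  with 0[OF assms(2)] show ?thesis by (simp add: commutator_def)
qed

lemma double_divergence_spline_cutoff:
  assumes "e \<noteq> 0"
  shows "(\<Sum>i\<in>UNIV. \<Sum>j\<in>UNIV. partial i (partial j (\<lambda>p. cutoff_at R p * spline_hess n \<beta> y e i j p)) p) =
    cutoff_at R p * spline_bilap n \<beta> y e p + commutator n \<beta> y e R p"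
  unfolding commutator_def
  by (subst double_divergence_cutoff[OF smooth_cutoff_at smooth_spline_hess[OF assms] spline_hess_commute])
    (simp add: div_spline_hess[OF assms] div_spline_grad_lap[OF assms])

text \<open>The representation identity before both limits: the double divergence of the cut-off
  Hessian consists of cut-off delta kernels and the commutator.\<close>

lemma LINT_cutoff_spline_hess:
  assumes h: "continuous_on UNIV h" "is_weak_hessian h H" and e: "e \<noteq> 0" and R: "0 < R"
  shows "(\<Sum>i\<in>UNIV. \<Sum>j\<in>UNIV. LINT p|lebesgue. entry H i j p * cutoff_at R p * spline_hess n \<beta> y e i j p) =
    (\<Sum>r<n. \<beta> r * (LINT p|lebesgue. h p * cutoff_at R p * (16 * e ^ 4 / ((norm (p - y r))\<^sup>2 + e\<^sup>2) ^ 3))) +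
    (LINT p|lebesgue. h p * commutator n \<beta> y e R p)"
proof -
  let ?\<psi> = "\<lambda>i j p. cutoff_at R p * spline_hess n \<beta> y e i j p"
  let ?k = "\<lambda>r p. 16 * e ^ 4 / ((norm (p - y r))\<^sup>2 + e\<^sup>2) ^ 3"
  have t: "test_function (?\<psi> i j)" for i j
    by (rule test_function_mult[OF test_function_cutoff_at[OF R] smooth_spline_hess[OF e]])
  have tp: "integrable lebesgue (\<lambda>p. h p * partial i (partial j (?\<psi> i j)) p)" for i j
    by (rule test_function_integrable[OF h(1) test_function_partial[OF test_function_partial[OF t]]])
  have c: "continuous_on UNIV (\<lambda>p. h p * cutoff_at R p * ?k r p)" for r
  proof -
    have "(norm (p - y r))\<^sup>2 + e\<^sup>2 \<noteq> 0" for p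
      using e zero_le_power2[of "norm (p - y r)"] zero_less_power2[of e] by linarith
    then show ?thesis
      by (intro continuous_intros h smooth_continuous smooth_cutoff_at) auto
  qed
  have ik: "integrable lebesgue (\<lambda>p. h p * cutoff_at R p * ?k r p)" for r
    by (rule integrable_continuous_cball(2)[OF c, where R = "2 * R"]) (simp add: cutoff_at_eq_0[OF R])
  have ic: "integrable lebesgue (\<lambda>p. h p * commutator n \<beta> y e R p)"
  proof (rule test_function_integrable[OF h(1)])
    show "test_function (commutator n \<beta> y e R)"
      by (rule test_functionI[OF smooth_commutator[OF e], of "2 * R"]) (simp add: commutator_eq_0 R)
  qed
  have "(\<Sum>i\<in>UNIV. \<Sum>j\<in>UNIV. LINT p|lebesgue. entry H i j p * cutoff_at R p * spline_hess n \<beta> y e i j p) =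
      (\<Sum>i\<in>UNIV. \<Sum>j\<in>UNIV. LINT p|lebesgue. h p * partial i (partial j (?\<psi> i j)) p)"
    by (simp only: weak_hessian_partial[OF h(2) t] mult.assoc)
  also have "\<dots> = (LINT p|lebesgue. (\<Sum>i\<in>UNIV. \<Sum>j\<in>UNIV. h p * partial i (partial j (?\<psi> i j)) p))"
    by (simp add: tp)
  also have "\<dots> = (LINT p|lebesgue. (\<Sum>r<n. \<beta> r * (h p * cutoff_at R p * ?k r p)) + h p * commutator n \<beta> y e R p)"
  proof (rule Bochner_Integration.integral_cong[OF refl])
    fix p
    have "(\<Sum>i\<in>UNIV. \<Sum>j\<in>UNIV. h p * partial i (partial j (?\<psi> i j)) p) =
        h p * (\<Sum>i\<in>UNIV. \<Sum>j\<in>UNIV. partial i (partial j (?\<psi> i j)) p)" by (simp only: sum_distrib_left)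
    also have "\<dots> = h p * (cutoff_at R p * spline_bilap n \<beta> y e p + commutator n \<beta> y e R p)"
      by (simp only: double_divergence_spline_cutoff[OF e])
    also have "\<dots> = (\<Sum>r<n. \<beta> r * (h p * cutoff_at R p * ?k r p)) + h p * commutator n \<beta> y e R p"
      unfolding spline_bilap_def rho_def distrib_left sum_distrib_left by (simp only: mult_ac)
    finally show "(\<Sum>i\<in>UNIV. \<Sum>j\<in>UNIV. h p * partial i (partial j (?\<psi> i j)) p) =
      (\<Sum>r<n. \<beta> r * (h p * cutoff_at R p * ?k r p)) + h p * commutator n \<beta> y e R p" .
  qed
  also have "\<dots> = (\<Sum>r<n. \<beta> r * (LINT p|lebesgue. h p * cutoff_at R p * ?k r p)) +
      (LINT p|lebesgue. h p * commutator n \<beta> y e R p)"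
    using ik ic by (simp del: times_divide_eq_right)
  finally show ?thesis .
qed

text \<open>Each derivative of the cutoff costs 1/R; against the decay R^-2 of the Hessian and R^-3
  of the gradient of the Laplacian, both parts have size R^-4. Growth at scale R then gives R^-4 R^3
  sqrt R.\<close>

lemma LINT_commutator_bound:
  assumes h: "continuous_on UNIV h" "is_weak_hessian h H"
    and \<beta>: "(\<Sum>r<n. \<beta> r) = 0" "(\<Sum>r<n. \<beta> r *\<^sub>R y r) = 0"
  shows "\<exists>C R0. \<forall>e R. 0 < e \<longrightarrow> e \<le> 1 \<longrightarrow> R0 \<le> R \<longrightarrow> 1 \<le> R \<longrightarrow>
    \<bar>LINT p|lebesgue. h p * commutator n \<beta> y e R p\<bar> \<le> C * (sqrt R / R)"
proof -
  define Y where "Y = (\<Sum>r<n. norm (y r))"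
  have Y: "0 \<le> Y" by (simp add: Y_def sum_nonneg)
  have y: "\<forall>r<n. norm (y r) \<le> Y"
    unfolding Y_def by (intro allI impI member_le_sum) auto
  obtain C1 where C1: "0 \<le> C1" "\<forall>e p i j. 0 \<le> e \<longrightarrow> e \<le> 1 \<longrightarrow> 2 * (Y + 1)\<^sup>2 \<le> norm p \<longrightarrow>
     \<bar>spline_hess n \<beta> y e i j p\<bar> \<le> C1 * (1 / norm p)\<^sup>2"
    using spline_hess_decay[OF Y y \<beta>] by blast
  obtain C2 where C2: "0 \<le> C2" "\<forall>e p i. 0 \<le> e \<longrightarrow> e \<le> 1 \<longrightarrow> 2 * (Y + 1)\<^sup>2 \<le> norm p \<longrightarrow>
     \<bar>spline_grad_lap n \<beta> y e i p\<bar> \<le> C2 * (1 / norm p) ^ 3"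
    using spline_grad_lap_decay[OF Y y \<beta>] by blast
  obtain B where B: "0 < B" "\<And>i p. \<bar>partial i cutoff p\<bar> \<le> B" "\<And>i j p. \<bar>partial i (partial j cutoff) p\<bar> \<le> B"
    using cutoff_derivatives_bounded by blast
  obtain C3 where C3: "\<forall>\<phi> M t. smooth \<phi> \<longrightarrow> (\<forall>p. 2 < norm p \<longrightarrow> \<phi> p = 0) \<longrightarrow> (\<forall>p. \<bar>\<phi> p\<bar> \<le> M) \<longrightarrow>
      0 < M \<longrightarrow> 1 \<le> t \<longrightarrow> \<bar>LINT p|lebesgue. h p * \<phi> (p /\<^sub>R t)\<bar> \<le> C3 * M * (t ^ 3 * sqrt t)"
    using weak_hessian_growth[OF h] by blast
  \<comment> \<open>Four index pairs contribute B C1 each; two indices with the factor 2 contribute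
    4 B C2; the 1 keeps \<open>M\<close> positive.\<close>
  define M where "M = 4 * (B * C1) + 4 * (B * C2) + 1"
  have M: "0 < M" using B(1) C1(1) C2(1) by (simp add: M_def add_nonneg_pos)
  show ?thesis
  proof (rule exI[of _ "C3 * M"], rule exI[of _ "2 * (Y + 1)\<^sup>2"], intro allI impI)
    fix e R :: real assume e: "0 < e" "e \<le> 1" and R: "2 * (Y + 1)\<^sup>2 \<le> R" "1 \<le> R"
    have R0: "0 < R" using R by linarith
    have bound: "R ^ 4 * \<bar>commutator n \<beta> y e R p\<bar> \<le> M" for p
    proof (cases "norm p < R")
      case True
      then show ?thesis using M by (simp add: commutator_eq_0 R0)
    next
      case False
      then have p: "R \<le> norm p" "2 * (Y + 1)\<^sup>2 \<le> norm p" using R by linarith+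
      have inv: "1 / norm p \<le> inverse R" "0 \<le> 1 / norm p" "0 \<le> inverse R"
        using le_imp_inverse_le[OF p(1) R0] R0 by (simp_all add: inverse_eq_divide)
      have S: "\<bar>spline_hess n \<beta> y e i j p\<bar> \<le> C1 * (inverse R)\<^sup>2" for i j
      proof -
        have "\<bar>spline_hess n \<beta> y e i j p\<bar> \<le> C1 * (1 / norm p)\<^sup>2" using C1(2) e p by auto
        also have "\<dots> \<le> C1 * (inverse R)\<^sup>2" using inv C1(1) by (intro mult_left_mono power_mono) auto
        finally show ?thesis .
      qed
      have V: "\<bar>spline_grad_lap n \<beta> y e i p\<bar> \<le> C2 * (inverse R) ^ 3" for i
      proof -
        have "\<bar>spline_grad_lap n \<beta> y e i p\<bar> \<le> C2 * (1 / norm p) ^ 3" using C2(2) e p by auto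
        also have "\<dots> \<le> C2 * (inverse R) ^ 3" using inv C2(1) by (intro mult_left_mono power_mono) auto
        finally show ?thesis .
      qed
      have t1: "\<bar>partial i (partial j (cutoff_at R)) p * spline_hess n \<beta> y e i j p\<bar> \<le> (B * C1) * (inverse R) ^ 4" for i j
      proof -
        have "\<bar>partial i (partial j (cutoff_at R)) p\<bar> \<le> (inverse R)\<^sup>2 * B"
          unfolding partial_cutoff_at(2) abs_mult using B(3) by (intro mult_mono) auto
        then have "\<bar>partial i (partial j (cutoff_at R)) p\<bar> * \<bar>spline_hess n \<beta> y e i j p\<bar> \<le> ((inverse R)\<^sup>2 * B) * (C1 * (inverse R)\<^sup>2)"
          using S B(1) by (intro mult_mono) auto
        also have "\<dots> = (B * C1) * (inverse R) ^ 4" by (simp add: eval_nat_numeral)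
        finally show ?thesis by (simp only: abs_mult)
      qed
      have t2: "\<bar>partial i (cutoff_at R) p * spline_grad_lap n \<beta> y e i p\<bar> \<le> (B * C2) * (inverse R) ^ 4" for i
      proof -
        have "\<bar>partial i (cutoff_at R) p\<bar> \<le> inverse R * B"
          unfolding partial_cutoff_at(1) abs_mult using B(2) R0 by (intro mult_mono) auto
        then have "\<bar>partial i (cutoff_at R) p\<bar> * \<bar>spline_grad_lap n \<beta> y e i p\<bar> \<le> (inverse R * B) * (C2 * (inverse R) ^ 3)"
          using V B(1) inv by (intro mult_mono) auto
        also have "\<dots> = (B * C2) * (inverse R) ^ 4" by (simp add: eval_nat_numeral)
        finally show ?thesis by (simp only: abs_mult)
      qed
      have "\<bar>\<Sum>i\<in>UNIV. \<Sum>j\<in>UNIV. partial i (partial j (cutoff_at R)) p * spline_hess n \<beta> y e i j p\<bar>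
          \<le> (\<Sum>i\<in>(UNIV :: 2 set). \<Sum>j\<in>(UNIV :: 2 set). (B * C1) * (inverse R) ^ 4)"
        by (intro order_trans[OF sum_abs] sum_mono t1)
      then have 1: "\<bar>\<Sum>i\<in>UNIV. \<Sum>j\<in>UNIV. partial i (partial j (cutoff_at R)) p * spline_hess n \<beta> y e i j p\<bar>
          \<le> 4 * ((B * C1) * (inverse R) ^ 4)" by simp
      have "\<bar>\<Sum>i\<in>UNIV. partial i (cutoff_at R) p * spline_grad_lap n \<beta> y e i p\<bar>
          \<le> (\<Sum>i\<in>(UNIV :: 2 set). (B * C2) * (inverse R) ^ 4)"
        by (intro order_trans[OF sum_abs] sum_mono t2)
      then have 2: "\<bar>\<Sum>i\<in>UNIV. partial i (cutoff_at R) p * spline_grad_lap n \<beta> y e i p\<bar>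
          \<le> 2 * ((B * C2) * (inverse R) ^ 4)" by simp
      have "\<bar>commutator n \<beta> y e R p\<bar> \<le> 4 * ((B * C1) * (inverse R) ^ 4) + 4 * ((B * C2) * (inverse R) ^ 4)"
        unfolding commutator_def using 1 2 by linarith
      also have "\<dots> \<le> M * (inverse R) ^ 4" by (simp add: M_def algebra_simps)
      finally have "R ^ 4 * \<bar>commutator n \<beta> y e R p\<bar> \<le> R ^ 4 * (M * (inverse R) ^ 4)"
        by (rule mult_left_mono) simp
      also have "\<dots> = M" using R0 by (simp add: field_simps)
      finally show ?thesis .
    qed
    \<comment> \<open>Rescaled to the disc of radius 2 and multiplied by R^4, the commutator is a
      weight whose bound \<open>M\<close> is independent of e and R.\<close>
    define \<phi> where "\<phi> v = R ^ 4 * commutator n \<beta> y e R (R *\<^sub>R v)" for v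
    have s: "smooth \<phi>" unfolding \<phi>_def[abs_def]
      using e by (intro smooth_cmult smooth_scale smooth_commutator) simp
    have z: "\<phi> v = 0" if "2 < norm v" for v
      unfolding \<phi>_def using that R0 by (subst commutator_eq_0) (auto simp: field_simps)
    have b: "\<bar>\<phi> v\<bar> \<le> M" for v unfolding \<phi>_def abs_mult using bound[of "R *\<^sub>R v"] by simp
    have "\<bar>LINT p|lebesgue. h p * \<phi> (p /\<^sub>R R)\<bar> \<le> C3 * M * (R ^ 3 * sqrt R)"
      using C3 s z b M R by blast
    also have "(LINT p|lebesgue. h p * \<phi> (p /\<^sub>R R)) = R ^ 4 * (LINT p|lebesgue. h p * commutator n \<beta> y e R p)"
      unfolding integral_mult_right_zero[symmetric] \<phi>_def using R0 by (simp add: mult_ac)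
    finally have "R ^ 4 * \<bar>LINT p|lebesgue. h p * commutator n \<beta> y e R p\<bar> \<le> C3 * M * (R ^ 3 * sqrt R)"
      using R0 by (simp add: abs_mult)
    also have "\<dots> = R ^ 4 * (C3 * M * (sqrt R / R))" using R0 by (simp add: field_simps eval_nat_numeral)
    finally show "\<bar>LINT p|lebesgue. h p * commutator n \<beta> y e R p\<bar> \<le> C3 * M * (sqrt R / R)"
      using R0 by (simp only: mult_le_cancel_left_pos zero_less_power)
  qed
qed

lemma in_L2_cutoff:
  assumes "in_L2 u" "0 < R"
  shows "in_L2 (\<lambda>p. u p * cutoff_at R p)"
proof (rule in_L2_bound[OF assms(1)])
  show "(\<lambda>p. u p * cutoff_at R p) \<in> borel_measurable lebesgue"
    by (intro borel_measurable_times in_L2_measurable assms borel_imp_lebesgue_measurable smooth_borel smooth_cutoff_at)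
  show "AE p in lebesgue. \<bar>u p * cutoff_at R p\<bar> \<le> \<bar>u p\<bar>"
    using cutoff_at_bounds by (intro AE_I2) (simp add: abs_mult mult_left_le)
qed

lemma spline_hess_represents:
  assumes h: "continuous_on UNIV h" "is_weak_hessian h H"
    and \<beta>: "(\<Sum>r<n. \<beta> r) = 0" "(\<Sum>r<n. \<beta> r *\<^sub>R y r) = 0"
  shows "(\<Sum>i\<in>UNIV. \<Sum>j\<in>UNIV. LINT p|lebesgue. entry H i j p * spline_hess n \<beta> y 0 i j p) =
    8 * pi * (\<Sum>r<n. \<beta> r * h (y r))"
proof -
  define Y where "Y = (\<Sum>r<n. norm (y r))"
  have Y: "0 \<le> Y" by (simp add: Y_def sum_nonneg)
  have y: "\<forall>r<n. norm (y r) \<le> Y"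
    unfolding Y_def by (intro allI impI member_le_sum) auto
  obtain C R0 where C: "\<forall>e R. 0 < e \<longrightarrow> e \<le> 1 \<longrightarrow> R0 \<le> R \<longrightarrow> 1 \<le> R \<longrightarrow>
    \<bar>LINT p|lebesgue. h p * commutator n \<beta> y e R p\<bar> \<le> C * (sqrt R / R)"
    using LINT_commutator_bound[OF h \<beta>] by blast
  define en :: "nat \<Rightarrow> real" where "en k = inverse (real (Suc k))" for k
  have en: "0 < en k" "en k \<le> 1" "0 \<le> en k" "en k \<noteq> 0" for k by (simp_all add: en_def inverse_le_1_iff)
  have en0: "en \<longlonglongrightarrow> 0" unfolding en_def[abs_def] by (rule LIMSEQ_inverse_real_of_nat)
  let ?A = "\<lambda>R e. \<Sum>i\<in>UNIV. \<Sum>j\<in>UNIV. LINT p|lebesgue. entry H i j p * cutoff_at R p * spline_hess n \<beta> y e i j p"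
  let ?E = "8 * pi * (\<Sum>r<n. \<beta> r * h (y r))"
  \<comment> \<open>Limit e to 0 at fixed R. The error bound survives because it is independent of
    e, and R \<ge> Y makes the cutoff equal to 1 at every centre.\<close>
  have approx: "\<bar>?A R 0 - ?E\<bar> \<le> C * (sqrt R / R)" if R: "R0 \<le> R" "1 \<le> R" "Y \<le> R" for R
  proof -
    have Rp: "0 < R" using R by linarith
    let ?D = "\<lambda>e. \<Sum>r<n. \<beta> r * (LINT p|lebesgue. h p * cutoff_at R p * (16 * e ^ 4 / ((norm (p - y r))\<^sup>2 + e\<^sup>2) ^ 3))"
    have b: "\<bar>?A R (en k) - ?D (en k)\<bar> \<le> C * (sqrt R / R)" for k
      using C en[of k] R LINT_cutoff_spline_hess[OF h en(4) Rp, of n \<beta> y k] by simp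
    have A: "(\<lambda>k. ?A R (en k)) \<longlonglongrightarrow> ?A R 0"
      by (intro tendsto_sum LINT_spline_hess_tendsto[OF Y y \<beta> in_L2_cutoff[OF weak_hessian_L2[OF h(2)] Rp] en(3) en(2) en0])
    obtain K where K: "\<And>p. \<bar>h p * cutoff_at R p\<bar> \<le> K"
    proof -
      obtain K where K: "\<forall>p\<in>cball 0 (2 * R). \<bar>h p\<bar> \<le> K"
        using continuous_bounded_cball[OF h(1)] by blast
      have "\<bar>h p * cutoff_at R p\<bar> \<le> max K 0" for p
      proof (cases "2 * R < norm p")
        case True
        then show ?thesis by (simp add: cutoff_at_eq_0 Rp)
      next
        case False
        then have "\<bar>h p\<bar> \<le> K" using K by simp
        moreover have "\<bar>h p * cutoff_at R p\<bar> \<le> \<bar>h p\<bar>"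
          using cutoff_at_bounds[of R p] by (simp add: abs_mult mult_left_le)
        ultimately show ?thesis by linarith
      qed
      then show ?thesis by (rule that)
    qed
    have D: "(\<lambda>k. ?D (en k)) \<longlonglongrightarrow> (\<Sum>r<n. \<beta> r * (8 * pi * (h (y r) * cutoff_at R (y r))))"
    proof (intro tendsto_sum tendsto_mult tendsto_const)
      have "continuous_on UNIV (\<lambda>p. h p * cutoff_at R p)"
        by (intro continuous_on_mult h smooth_continuous smooth_cutoff_at)
      from delta_kernel_tendsto[OF this K en(1) en0]
      show "(\<lambda>k. LINT p|lebesgue. h p * cutoff_at R p * (16 * en k ^ 4 / ((norm (p - y r))\<^sup>2 + (en k)\<^sup>2) ^ 3))
         \<longlonglongrightarrow> 8 * pi * (h (y r) * cutoff_at R (y r))" for r .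
    qed
    have "(\<Sum>r<n. \<beta> r * (8 * pi * (h (y r) * cutoff_at R (y r)))) = ?E"
      unfolding sum_distrib_left
    proof (intro sum.cong refl)
      fix r assume "r \<in> {..<n}"
      then have "cutoff_at R (y r) = 1" using y R by (intro cutoff_at_eq_1 Rp) auto
      then show "\<beta> r * (8 * pi * (h (y r) * cutoff_at R (y r))) = 8 * pi * (\<beta> r * h (y r))" by simp
    qed
    with D have D': "(\<lambda>k. ?D (en k)) \<longlonglongrightarrow> ?E" by simp
    show ?thesis
      by (rule LIMSEQ_le_const2[OF tendsto_rabs[OF tendsto_diff[OF A D']]]) (use b in blast)
  qed
  have lim: "(\<lambda>m. ?A (real m) 0) \<longlonglongrightarrow> (\<Sum>i\<in>UNIV. \<Sum>j\<in>UNIV. LINT p|lebesgue. entry H i j p * spline_hess n \<beta> y 0 i j p)"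
  proof (intro tendsto_sum)
    fix i j :: 2
    have S: "in_L2 (spline_hess n \<beta> y 0 i j)" by (rule in_L2_spline_hess[OF Y y \<beta>]) auto
    have i: "integrable lebesgue (\<lambda>p. entry H i j p * spline_hess n \<beta> y 0 i j p)"
      by (rule in_L2_integrable_mult[OF weak_hessian_L2[OF h(2)] S])
    show "(\<lambda>m. LINT p|lebesgue. entry H i j p * cutoff_at (real m) p * spline_hess n \<beta> y 0 i j p) \<longlonglongrightarrow>
       (LINT p|lebesgue. entry H i j p * spline_hess n \<beta> y 0 i j p)"
    proof (rule integral_dominated_convergence)
      show "integrable lebesgue (\<lambda>p. \<bar>entry H i j p * spline_hess n \<beta> y 0 i j p\<bar>)"
        by (rule integrable_abs[OF i])
      show "(\<lambda>p. entry H i j p * spline_hess n \<beta> y 0 i j p) \<in> borel_measurable lebesgue"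
        by (rule borel_measurable_integrable[OF i])
      show "(\<lambda>p. entry H i j p * cutoff_at (real m) p * spline_hess n \<beta> y 0 i j p) \<in> borel_measurable lebesgue" for m
        by (intro borel_measurable_times in_L2_measurable[OF S] in_L2_measurable[OF weak_hessian_L2[OF h(2)]]
            borel_imp_lebesgue_measurable smooth_borel smooth_cutoff_at)
      show "AE p in lebesgue. (\<lambda>m. entry H i j p * cutoff_at (real m) p * spline_hess n \<beta> y 0 i j p)
          \<longlonglongrightarrow> entry H i j p * spline_hess n \<beta> y 0 i j p"
      proof (rule AE_I2, rule tendsto_eventually)
        fix p :: "real^2"
        have "\<forall>\<^sub>F m in sequentially. max 1 (norm p) \<le> real m"
          by (rule eventually_sequentiallyI[of "nat \<lceil>max 1 (norm p)\<rceil>"]) linarith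
        then show "\<forall>\<^sub>F m in sequentially. entry H i j p * cutoff_at (real m) p * spline_hess n \<beta> y 0 i j p =
            entry H i j p * spline_hess n \<beta> y 0 i j p"
          by eventually_elim (subst cutoff_at_eq_1, auto)
      qed
      show "AE p in lebesgue. norm (entry H i j p * cutoff_at (real m) p * spline_hess n \<beta> y 0 i j p)
          \<le> \<bar>entry H i j p * spline_hess n \<beta> y 0 i j p\<bar>" for m
      proof (rule AE_I2)
        fix p :: "real^2"
        have "\<bar>entry H i j p * spline_hess n \<beta> y 0 i j p\<bar> * \<bar>cutoff_at (real m) p\<bar> \<le> \<bar>entry H i j p * spline_hess n \<beta> y 0 i j p\<bar>"
          using cutoff_at_bounds[of "real m" p] by (intro mult_left_le) auto
        then show "norm (entry H i j p * cutoff_at (real m) p * spline_hess n \<beta> y 0 i j p)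
          \<le> \<bar>entry H i j p * spline_hess n \<beta> y 0 i j p\<bar>" by (simp add: abs_mult mult_ac)
      qed
    qed
  qed
  \<comment> \<open>The error sqrt R / R vanishes along integer radii; comparison with the dominated
    limit identifies the two sides.\<close>
  have "(\<lambda>m. ?A (real m) 0 - ?E) \<longlonglongrightarrow> 0"
  proof (rule Lim_null_comparison)
    have "\<forall>\<^sub>F m in sequentially. max (max R0 1) Y \<le> real m"
      by (rule eventually_sequentiallyI[of "nat \<lceil>max (max R0 1) Y\<rceil>"]) linarith
    then show "\<forall>\<^sub>F m in sequentially. norm (?A (real m) 0 - ?E) \<le> C * (sqrt (real m) / real m)"
    proof eventually_elim
      case (elim m)
      then show ?case unfolding real_norm_def by (intro approx) auto
    qed
    have "(\<lambda>m. sqrt (real m) / real m) \<longlonglongrightarrow> 0" by real_asymp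
    from tendsto_mult_right_zero[OF this] show "(\<lambda>m. C * (sqrt (real m) / real m)) \<longlonglongrightarrow> 0" .
  qed
  moreover have "(\<lambda>m. ?A (real m) 0 - ?E) \<longlonglongrightarrow>
      (\<Sum>i\<in>UNIV. \<Sum>j\<in>UNIV. LINT p|lebesgue. entry H i j p * spline_hess n \<beta> y 0 i j p) - ?E"
    by (rule tendsto_diff[OF lim tendsto_const])
  ultimately show ?thesis using LIMSEQ_unique by fastforce
qed

section \<open>Thin-plate splines\<close>

lemma abs_mult_ln_bound: "0 \<le> v \<Longrightarrow> \<bar>v * ln v\<bar> \<le> v\<^sup>2 + (1 :: real)"
proof -
  assume v: "0 \<le> v"
  consider "v = 0" | "0 < v" "v < 1" | "1 \<le> v" using v by linarith
  then show ?thesis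
  proof cases
    case 2
    have "- ln v \<le> inverse v" using ln_le_minus_one[of "inverse v"] 2 by (simp add: ln_inverse)
    then have "v * (- ln v) \<le> v * inverse v" using 2 by (intro mult_left_mono) auto
    then have "v * (- ln v) \<le> 1" using 2 by simp
    moreover have "v * ln v \<le> 0" using 2 by (intro mult_nonneg_nonpos) auto
    moreover have "\<bar>v * ln v\<bar> = - (v * ln v)" by (rule abs_of_nonpos) fact
    moreover have "0 \<le> v\<^sup>2" by simp
    ultimately show ?thesis by linarith
  next
    case 3
    have "ln v \<le> v" using ln_le_minus_one[of v] 3 by simp
    then have "v * ln v \<le> v * v" using 3 by (intro mult_left_mono) auto
    moreover have "\<bar>v * ln v\<bar> = v * ln v" using 3 by (intro abs_of_nonneg) simp
    ultimately show ?thesis unfolding power2_eq_square by linarith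
  qed simp
qed

lemma kernel_bound:
  assumes "0 \<le> e" "e \<le> 1"
  shows "\<bar>kernel e q\<bar> \<le> ((norm q)\<^sup>2 + 1)\<^sup>2 + 1"
proof -
  have "e\<^sup>2 \<le> 1" using assms by (intro power_le_one)
  then have r: "rho e q \<le> (norm q)\<^sup>2 + 1" by (simp add: rho_def)
  have "\<bar>kernel e q\<bar> \<le> \<bar>rho e q * ln (rho e q)\<bar>" by (simp add: kernel_def)
  also have "\<dots> \<le> (rho e q)\<^sup>2 + 1" by (rule abs_mult_ln_bound[OF rho_nonneg])
  also have "\<dots> \<le> ((norm q)\<^sup>2 + 1)\<^sup>2 + 1" using r rho_nonneg by (intro add_mono power_mono) auto
  finally show ?thesis .
qed

text \<open>Near the origin -ln n \<le> 1 / n gives n^2 |ln n| \<le> n for 0 < n < 1; elsewhere all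
  ingredients are continuous.\<close>

lemma continuous_kernel_0: "continuous_on UNIV (kernel 0)"
proof (rule continuous_at_imp_continuous_on, intro ballI)
  fix q :: "real^2"
  show "isCont (kernel 0) q"
  proof (cases "q = 0")
    case False
    then have "0 < rho 0 q" by (intro rho_pos) simp
    then show ?thesis
      unfolding kernel_def[abs_def] rho_def by (intro continuous_intros) auto
  next
    case True
    have "((\<lambda>q :: real^2. kernel 0 q) \<longlongrightarrow> 0) (at 0)"
    proof (rule Lim_null_comparison)
      have "\<forall>\<^sub>F q in at (0 :: real^2). 0 < norm q \<and> norm q < 1"
        by (auto simp: eventually_at intro!: exI[of _ 1])
      then show "\<forall>\<^sub>F q in at (0 :: real^2). norm (kernel 0 q) \<le> norm q"
      proof eventually_elim
        case (elim q)
        let ?n = "norm q"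
        have "- ln ?n \<le> inverse ?n" using ln_le_minus_one[of "inverse ?n"] elim by (simp add: ln_inverse)
        then have "?n\<^sup>2 * (- ln ?n) \<le> ?n\<^sup>2 * inverse ?n" by (intro mult_left_mono) auto
        also have "\<dots> = ?n" using elim by (simp add: power2_eq_square)
        finally have "?n\<^sup>2 * (- ln ?n) \<le> ?n" .
        moreover have "\<bar>ln ?n\<bar> = - ln ?n" using elim by (intro abs_of_nonpos) simp
        ultimately show ?case by (simp only: kernel_0 tps_kernel_def real_norm_def abs_mult abs_power2)
      qed
      show "((\<lambda>q :: real^2. norm q) \<longlongrightarrow> 0) (at 0)" by (intro tendsto_norm_zero tendsto_ident_at)
    qed
    moreover have "kernel 0 (0 :: real^2) = 0" by (simp add: kernel_def rho_def)
    ultimately show ?thesis using True by (simp add: isCont_def)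
  qed
qed

lemma kernel_tendsto:
  assumes e: "en \<longlonglongrightarrow> 0" and q: "q \<noteq> 0"
  shows "(\<lambda>k. kernel (en k) q) \<longlonglongrightarrow> kernel 0 q"
proof -
  have "0 < rho 0 q" using q by (intro rho_pos) simp
  moreover have "(\<lambda>k. rho (en k) q) \<longlonglongrightarrow> rho 0 q"
    unfolding rho_def by (intro tendsto_intros e)
  ultimately show ?thesis unfolding kernel_def by (intro tendsto_intros) auto
qed

text \<open>Only the kernels are regularised and the affine part is kept, so that e = 0 returns the
  spline.\<close>

definition reg_spline :: "nat \<Rightarrow> (nat \<Rightarrow> real^2) \<Rightarrow> real vec \<Rightarrow> real \<Rightarrow> real^2 \<Rightarrow> real" where
  "reg_spline Nr x c e p = (\<Sum>r<Nr. c $ r * kernel e (p - x r))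
     + (c $ (Nr + 1) * vec_nth p 1 + c $ (Nr + 2) * vec_nth p 2 + c $ Nr)"

lemma reg_spline_0: "reg_spline Nr x c 0 = spline Nr x c"
  by (simp add: reg_spline_def spline_def kernel_0 fun_eq_iff add.assoc)

lemma continuous_spline: "continuous_on UNIV (spline Nr x c)"
proof -
  have "continuous_on UNIV (\<lambda>p. kernel 0 (p - x r))" for r
    by (rule continuous_on_compose2[OF continuous_kernel_0]) (auto intro!: continuous_intros)
  moreover have "continuous_on UNIV (\<lambda>p :: real^2. vec_nth p i)" for i
    by (rule smooth_continuous[OF smooth_coord])
  ultimately show ?thesis
    unfolding reg_spline_0[symmetric] reg_spline_def[abs_def]
    by (intro continuous_on_add continuous_on_sum continuous_on_mult continuous_on_const)
qed

lemma smooth_reg_spline: "e \<noteq> 0 \<Longrightarrow> smooth (reg_spline Nr x c e)"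
  unfolding reg_spline_def[abs_def]
  by (intro smooth_add smooth_sum smooth_cmult smooth_shift[OF smooth_kernel] smooth_coord smooth_const)

lemma partial2_reg_spline:
  assumes e: "e \<noteq> 0"
  shows "partial j (partial i (reg_spline Nr x c e)) = spline_hess Nr (\<lambda>r. c $ r) x e i j"
proof -
  have grad: "partial i (reg_spline Nr x c e) = (\<lambda>p. (\<Sum>r<Nr. c $ r * kernel_grad e i (p - x r)) +
      ((if i = 1 then c $ (Nr + 1) else 0) + (if i = 2 then c $ (Nr + 2) else 0)))"
    unfolding reg_spline_def[abs_def]
    using partial_combination[where j = i and \<beta> = "\<lambda>r. c $ r" and y = x and n = Nr, OF smooth_kernel[OF e]] e
    by (simp add: fun_eq_iff partial_smooth_add smooth_add smooth_sum smooth_cmult smooth_shift smooth_kernel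
        partial_cmult partial_coord partial_kernel)
  show ?thesis
    unfolding grad
    using partial_combination[where j = j and \<beta> = "\<lambda>r. c $ r" and y = x and n = Nr, OF smooth_kernel_grad[OF e, of i]] e
    by (simp add: fun_eq_iff partial_smooth_add smooth_sum smooth_cmult smooth_shift smooth_kernel_grad
        spline_hess_def partial_kernel_grad)
qed

definition spline_hessian :: "nat \<Rightarrow> (nat \<Rightarrow> real^2) \<Rightarrow> real vec \<Rightarrow> real^2 \<Rightarrow> real^2^2" where
  "spline_hessian Nr x c p = vec_lambda (\<lambda>i. vec_lambda (\<lambda>j. spline_hess Nr (\<lambda>r. c $ r) x 0 i j p))"

text \<open>For e > 0 the identity is two integrations by parts. Both sides converge: the Hessian
  side by the L2 majorant that the moment conditions provide, the other by a continuous majorant on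
  the support of the test function.\<close>

lemma spline_weak_hessian:
  assumes \<beta>: "(\<Sum>r<Nr. c $ r) = 0" "(\<Sum>r<Nr. c $ r *\<^sub>R x r) = 0"
  shows "is_weak_hessian (spline Nr x c) (spline_hessian Nr x c)"
  unfolding is_weak_hessian_def weak_partial2_def
proof (intro allI conjI impI)
  fix i j :: 2
  define Y where "Y = (\<Sum>r<Nr. norm (x r))"
  have Y: "0 \<le> Y" by (simp add: Y_def sum_nonneg)
  have x: "\<forall>r<Nr. norm (x r) \<le> Y"
    unfolding Y_def by (intro allI impI member_le_sum) auto
  define en :: "nat \<Rightarrow> real" where "en k = inverse (real (Suc k))" for k
  have en: "0 < en k" "en k \<le> 1" "0 \<le> en k" "en k \<noteq> 0" for k by (simp_all add: en_def inverse_le_1_iff)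
  have en0: "en \<longlonglongrightarrow> 0" unfolding en_def[abs_def] by (rule LIMSEQ_inverse_real_of_nat)
  have entry: "entry (spline_hessian Nr x c) i j = spline_hess Nr (\<lambda>r. c $ r) x 0 i j"
    by (simp add: spline_hessian_def)
  show "in_L2 (entry (spline_hessian Nr x c) i j)"
    unfolding entry by (rule in_L2_spline_hess[OF Y x \<beta>]) auto
  fix \<psi> assume \<psi>: "test_function \<psi>"
  let ?g = "partial i (partial j \<psi>)"
  have g: "test_function ?g" by (intro test_function_partial \<psi>)
  have gm: "?g \<in> borel_measurable borel" by (rule smooth_borel[OF test_function_smooth[OF g]])
  have "(\<lambda>k. LINT p|lebesgue. \<psi> p * spline_hess Nr (\<lambda>r. c $ r) x (en k) i j p) \<longlonglongrightarrow>
      (LINT p|lebesgue. \<psi> p * spline_hess Nr (\<lambda>r. c $ r) x 0 i j p)"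
    by (rule LINT_spline_hess_tendsto[OF Y x \<beta> in_L2_test_function[OF \<psi>] en(3) en(2) en0])
  moreover have "(LINT p|lebesgue. \<psi> p * spline_hess Nr (\<lambda>r. c $ r) x (en k) i j p) =
      (LINT p|lebesgue. reg_spline Nr x c (en k) p * ?g p)" for k
    unfolding integration_by_parts2[OF smooth_reg_spline[OF en(4)] \<psi>] partial2_reg_spline[OF en(4)]
    by (simp only: mult.commute)
  ultimately have lim1: "(\<lambda>k. LINT p|lebesgue. reg_spline Nr x c (en k) p * ?g p) \<longlonglongrightarrow>
      (LINT p|lebesgue. \<psi> p * spline_hess Nr (\<lambda>r. c $ r) x 0 i j p)" by simp
  let ?a = "\<lambda>p. c $ (Nr + 1) * vec_nth p 1 + c $ (Nr + 2) * vec_nth p 2 + c $ Nr"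
  \<comment> \<open>A bound for the regularised splines that is continuous and the same for all e in
    [0,1], hence integrable against a test function.\<close>
  let ?G = "\<lambda>p. (\<Sum>r<Nr. \<bar>c $ r\<bar> * (((norm (p - x r))\<^sup>2 + 1)\<^sup>2 + 1)) + \<bar>?a p\<bar>"
  have lim2: "(\<lambda>k. LINT p|lebesgue. reg_spline Nr x c (en k) p * ?g p) \<longlonglongrightarrow>
      (LINT p|lebesgue. spline Nr x c p * ?g p)"
  proof (rule integral_dominated_convergence)
    have "continuous_on UNIV ?G"
      by (intro continuous_intros)
    then show "integrable lebesgue (\<lambda>p. \<bar>?G p * ?g p\<bar>)"
      by (intro integrable_abs test_function_integrable g)
    show "(\<lambda>p. spline Nr x c p * ?g p) \<in> borel_measurable lebesgue"
      by (intro borel_imp_lebesgue_measurable borel_measurable_times gm continuous_imp_borel continuous_spline)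
    show "(\<lambda>p. reg_spline Nr x c (en k) p * ?g p) \<in> borel_measurable lebesgue" for k
      by (intro borel_imp_lebesgue_measurable borel_measurable_times gm smooth_borel smooth_reg_spline en)
    show "AE p in lebesgue. (\<lambda>k. reg_spline Nr x c (en k) p * ?g p) \<longlonglongrightarrow> spline Nr x c p * ?g p"
      using AE_not_centre[OF Y x \<beta>]
    proof eventually_elim
      case (elim p)
      then show ?case
        unfolding reg_spline_0[symmetric] reg_spline_def
        by (intro tendsto_mult tendsto_add tendsto_sum tendsto_const kernel_tendsto en0) auto
    qed
    show "AE p in lebesgue. norm (reg_spline Nr x c (en k) p * ?g p) \<le> \<bar>?G p * ?g p\<bar>" for k
    proof (rule AE_I2)
      fix p
      have "\<bar>\<Sum>r<Nr. c $ r * kernel (en k) (p - x r)\<bar> \<le> (\<Sum>r<Nr. \<bar>c $ r\<bar> * (((norm (p - x r))\<^sup>2 + 1)\<^sup>2 + 1))"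
        by (intro order_trans[OF sum_abs] sum_mono)
          (unfold abs_mult, intro mult_left_mono kernel_bound en, auto)
      then have "\<bar>reg_spline Nr x c (en k) p\<bar> \<le> ?G p"
        unfolding reg_spline_def by linarith
      then have "\<bar>reg_spline Nr x c (en k) p\<bar> \<le> \<bar>?G p\<bar>" by linarith
      then have "\<bar>reg_spline Nr x c (en k) p\<bar> * \<bar>?g p\<bar> \<le> \<bar>?G p\<bar> * \<bar>?g p\<bar>" by (rule mult_right_mono) simp
      then show "norm (reg_spline Nr x c (en k) p * ?g p) \<le> \<bar>?G p * ?g p\<bar>" by (simp only: real_norm_def abs_mult)
    qed
  qed
  show "(LINT p|lebesgue. spline Nr x c p * ?g p) = (LINT p|lebesgue. entry (spline_hessian Nr x c) i j p * \<psi> p)"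
    unfolding LIMSEQ_unique[OF lim2 lim1] by (simp add: spline_hessian_def mult.commute)
qed

lemma spline_sobolev:
  "(\<Sum>r<Nr. c $ r) = 0 \<Longrightarrow> (\<Sum>r<Nr. c $ r *\<^sub>R x r) = 0 \<Longrightarrow> spline Nr x c \<in> sobolev"
  unfolding sobolev_def using continuous_spline spline_weak_hessian by blast

lemma roughness_sum:
  assumes "is_weak_hessian u H"
  shows "roughness u = (\<Sum>i\<in>UNIV. \<Sum>j\<in>UNIV. LINT p|lebesgue. (entry H i j p)\<^sup>2)"
  unfolding roughness_eq[OF assms] norm_matrix_sq
  by (simp add: in_L2_integrable_square[OF weak_hessian_L2[OF assms]])

lemma roughness_nonneg: "0 \<le> roughness u"
  unfolding roughness_def by (intro integral_nonneg_AE) auto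

lemma spline_hessian_represents:
  assumes \<beta>: "(\<Sum>r<Nr. c $ r) = 0" "(\<Sum>r<Nr. c $ r *\<^sub>R x r) = 0"
    and h: "continuous_on UNIV h" "is_weak_hessian h H"
  shows "(\<Sum>i\<in>UNIV. \<Sum>j\<in>UNIV. LINT p|lebesgue. entry H i j p * entry (spline_hessian Nr x c) i j p) =
    8 * pi * (\<Sum>r<Nr. c $ r * h (x r))"
  using spline_hess_represents[where n = Nr and \<beta> = "\<lambda>r. c $ r" and y = x, OF h] \<beta> by (simp add: spline_hessian_def)

lemma roughness_spline:
  assumes \<beta>: "(\<Sum>r<Nr. c $ r) = 0" "(\<Sum>r<Nr. c $ r *\<^sub>R x r) = 0"
  shows "roughness (spline Nr x c) = 8 * pi * (\<Sum>r<Nr. c $ r * spline Nr x c (x r))"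
  using spline_hessian_represents[OF \<beta> continuous_spline spline_weak_hessian[OF \<beta>]]
  by (simp add: roughness_sum[OF spline_weak_hessian[OF \<beta>]] power2_eq_square)

lemma roughness_pythagoras:
  assumes \<beta>: "(\<Sum>r<Nr. c $ r) = 0" "(\<Sum>r<Nr. c $ r *\<^sub>R x r) = 0"
    and g: "continuous_on UNIV g" "is_weak_hessian g G"
    and interp: "\<And>r. r < Nr \<Longrightarrow> g (x r) = spline Nr x c (x r)"
  shows "roughness g = roughness (spline Nr x c) + roughness (\<lambda>p. g p - spline Nr x c p)"
proof -
  let ?S = "spline_hessian Nr x c" and ?D = "\<lambda>p. g p - spline Nr x c p"
  let ?E = "\<lambda>p. G p - ?S p"
  note s = continuous_spline[of Nr x c] spline_weak_hessian[OF \<beta>]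
  have D: "continuous_on UNIV ?D" "is_weak_hessian ?D ?E"
    by (intro continuous_on_diff g s) (rule is_weak_hessian_diff[OF g s])
  \<comment> \<open>The representation identity for g - s, whose values at the points
    \<open>x r\<close> are zero.\<close>
  have "(\<Sum>i\<in>UNIV. \<Sum>j\<in>UNIV. LINT p|lebesgue. entry ?E i j p * entry ?S i j p) = 0"
    unfolding spline_hessian_represents[OF \<beta> D] by (simp add: interp)
  moreover have "(LINT p|lebesgue. (entry G i j p)\<^sup>2) = (LINT p|lebesgue. (entry ?S i j p)\<^sup>2) +
      (LINT p|lebesgue. (entry ?E i j p)\<^sup>2) + 2 * (LINT p|lebesgue. entry ?E i j p * entry ?S i j p)" for i j
  proof -
    have "(LINT p|lebesgue. (entry G i j p)\<^sup>2) =
        (LINT p|lebesgue. (entry ?S i j p)\<^sup>2 + (entry ?E i j p)\<^sup>2 + 2 * (entry ?E i j p * entry ?S i j p))"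
      by (rule Bochner_Integration.integral_cong[OF refl]) (simp add: power2_eq_square algebra_simps)
    also have "\<dots> = (LINT p|lebesgue. (entry ?S i j p)\<^sup>2) + (LINT p|lebesgue. (entry ?E i j p)\<^sup>2) +
        2 * (LINT p|lebesgue. entry ?E i j p * entry ?S i j p)"
      using in_L2_integrable_square[OF weak_hessian_L2[OF s(2), of i j]]
        in_L2_integrable_square[OF weak_hessian_L2[OF D(2), of i j]]
        in_L2_integrable_mult[OF weak_hessian_L2[OF D(2), of i j] weak_hessian_L2[OF s(2), of i j]]
      by (simp only: Bochner_Integration.integral_add Bochner_Integration.integrable_add integrable_mult_right
          integral_mult_right_zero)
    finally show ?thesis .
  qed
  ultimately show ?thesis
    unfolding roughness_sum[OF g(2)] roughness_sum[OF s(2)] roughness_sum[OF D(2)]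
    by (simp only: sum.distrib sum_distrib_left[symmetric])
qed

section \<open>Functions of zero roughness\<close>

lemma roughness_zero_hessian:
  assumes "is_weak_hessian u H" "roughness u = 0"
  shows "AE p in lebesgue. H p = 0"
proof -
  have i: "integrable lebesgue (\<lambda>p. (norm (H p))\<^sup>2)"
    unfolding norm_matrix_sq
    by (intro Bochner_Integration.integrable_sum in_L2_integrable_square weak_hessian_L2[OF assms(1)])
  have "(LINT p|lebesgue. (norm (H p))\<^sup>2) = 0" using assms(2) unfolding roughness_eq[OF assms(1)] .
  then have "AE p in lebesgue. (norm (H p))\<^sup>2 = 0"
    using integral_nonneg_eq_0_iff_AE[OF i] by simp
  then show ?thesis by eventually_elim simp
qed

lemma LINT_entry_mult_zero:
  assumes "is_weak_hessian u H" "AE p in lebesgue. H p = 0"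
  shows "(LINT p|lebesgue. entry H i j p * v p) = 0" "(LINT p|lebesgue. v p * entry H i j p) = 0"
proof -
  have "AE p in lebesgue. entry H i j p * v p = 0" using assms(2) by eventually_elim simp
  then show "(LINT p|lebesgue. entry H i j p * v p) = 0" by (rule integral_eq_zero_AE)
  then show "(LINT p|lebesgue. v p * entry H i j p) = 0" by (simp only: mult.commute)
qed

text \<open>Non-collinear points have the whole plane as affine hull. The weights serve as
  coefficients in the representation identity and to show that an affine function vanishing at the
  points is zero.\<close>

lemma affine_combination_noncollinear:
  fixes x :: "nat \<Rightarrow> real^2"
  assumes inj: "inj_on x {..<Nr}" and col: "\<not> collinear (x ` {..<Nr})"
  shows "\<exists>a. (\<Sum>r<Nr. a r) = 1 \<and> (\<Sum>r<Nr. a r *\<^sub>R x r) = (p :: real^2)"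
proof -
  have "aff_dim (x ` {..<Nr}) = int DIM(real^2)"
    using col aff_dim_le_DIM[of "x ` {..<Nr}"] by (simp add: collinear_aff_dim)
  then have "affine hull (x ` {..<Nr}) = UNIV" by (simp only: aff_dim_eq_full)
  then have "p \<in> {q. \<exists>u. sum u (x ` {..<Nr}) = 1 \<and> (\<Sum>v\<in>x ` {..<Nr}. u v *\<^sub>R v) = q}"
    unfolding affine_hull_finite[OF finite_imageI[OF finite_lessThan]] by (rule ssubst) (rule UNIV_I)
  then obtain u where u: "sum u (x ` {..<Nr}) = 1" "(\<Sum>v\<in>x ` {..<Nr}. u v *\<^sub>R v) = p"
    by blast
  then show ?thesis
    by (intro exI[of _ "\<lambda>r. u (x r)"]) (simp add: sum.reindex[OF inj])
qed

(* The representation identity is applied to the points x r and p, with the affine coordinates of p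
   and -1 as weights. *)
lemma roughness_zero_vanishes:
  fixes x :: "nat \<Rightarrow> real^2" and Nr :: nat
  assumes D: "continuous_on UNIV D" "is_weak_hessian D E" "roughness D = 0"
    and x: "inj_on x {..<Nr}" "\<not> collinear (x ` {..<Nr})" and z: "\<And>r. r < Nr \<Longrightarrow> D (x r) = 0"
  shows "D p = 0"
proof -
  obtain a where a: "(\<Sum>r<Nr. a r) = 1" "(\<Sum>r<Nr. a r *\<^sub>R x r) = p"
    using affine_combination_noncollinear[OF x] by blast
  let ?\<beta> = "a(Nr := - 1)" and ?y = "x(Nr := p)"
  have "(\<Sum>r<Suc Nr. ?\<beta> r) = 0" "(\<Sum>r<Suc Nr. ?\<beta> r *\<^sub>R ?y r) = 0" using a by simp_all
  from spline_hess_represents[OF D(1,2) this]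
  have "0 = 8 * pi * (\<Sum>r<Suc Nr. ?\<beta> r * D (?y r))"
    by (simp only: LINT_entry_mult_zero[OF D(2) roughness_zero_hessian[OF D(2,3)]] sum.neutral_const)
  then show ?thesis using z by simp
qed

text \<open>The Hessian of the spline vanishes almost everywhere, so the representation identity for
  a bump that is 1 at one centre and 0 at the others isolates a single coefficient.\<close>

lemma kernel_form_pos:
  assumes \<beta>: "(\<Sum>r<Nr. c $ r) = 0" "(\<Sum>r<Nr. c $ r *\<^sub>R x r) = 0"
    and inj: "inj_on x {..<Nr}" and zero: "roughness (spline Nr x c) = 0" and r: "r < Nr"
  shows "c $ r = 0"
proof -
  obtain d where d: "0 < d" "\<forall>v\<in>x ` {..<Nr}. v \<noteq> x r \<longrightarrow> d \<le> dist (x r) v"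
    using finite_set_avoid[of "x ` {..<Nr}" "x r"] by blast
  \<comment> \<open>The bump vanishes beyond 2 d / 3, which is less than the distance d to the other
    centres.\<close>
  define u where "u p = cutoff_at (d / 3) (p - x r)" for p :: "real^2"
  have "test_function u"
  proof (rule test_functionI)
    show "smooth u" unfolding u_def[abs_def] by (intro smooth_shift smooth_cutoff_at)
    fix p :: "real^2" assume "2 * (d / 3) + norm (x r) < norm p"
    then have "2 * (d / 3) < norm (p - x r)" using norm_triangle_ineq2[of p "x r"] by linarith
    then show "u p = 0" unfolding u_def using d by (intro cutoff_at_eq_0) auto
  qed
  note u = smooth_continuous[OF test_function_smooth[OF this], of UNIV] test_function_weak_hessian[OF this]
  have "u (x s) = (if s = r then 1 else 0)" if s: "s < Nr" for s
  proof (cases "s = r")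
    case True
    then show ?thesis using d by (simp add: u_def cutoff_at_eq_1)
  next
    case False
    then have "x s \<noteq> x r" using inj r s by (auto dest: inj_onD)
    then have "d \<le> norm (x s - x r)" using d(2) s by (auto simp: dist_norm norm_minus_commute)
    then have "2 * (d / 3) < norm (x s - x r)" using d(1) by linarith
    then show ?thesis unfolding u_def using d False by (simp add: cutoff_at_eq_0)
  qed
  then have "(\<Sum>s<Nr. c $ s * u (x s)) = (\<Sum>s<Nr. if s = r then c $ s else 0)"
    by (intro sum.cong) auto
  also have "\<dots> = c $ r" using r by simp
  finally have "c $ r = (\<Sum>s<Nr. c $ s * u (x s))" by simp
  moreover have "8 * pi * (\<Sum>s<Nr. c $ s * u (x s)) = 0"
    unfolding spline_hessian_represents[OF \<beta> u, symmetric]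
    by (simp only: LINT_entry_mult_zero[OF spline_weak_hessian[OF \<beta>] roughness_zero_hessian[OF spline_weak_hessian[OF \<beta>] zero]]
        sum.neutral_const)
  ultimately show ?thesis by simp
qed

section \<open>Matrix identities\<close>

lemma vnorm_sq: "(vnorm v)\<^sup>2 = (\<Sum>k<dim_vec v. (v $ k)\<^sup>2)"
proof -
  have "scalar_prod v v = (\<Sum>k<dim_vec v. (v $ k)\<^sup>2)"
    by (simp add: scalar_prod_def power2_eq_square lessThan_atLeast0)
  moreover have "0 \<le> (\<Sum>k<dim_vec v. (v $ k)\<^sup>2)" by (simp add: sum_nonneg)
  ultimately show ?thesis by (simp add: vnorm_def)
qed

lemma scalar_prod_sum:
  fixes v w :: "real vec"
  assumes "w \<in> carrier_vec m"
  shows "scalar_prod v w = (\<Sum>i<m. v $ i * w $ i)"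
  using assms by (simp add: scalar_prod_def lessThan_atLeast0)

lemma mult_mat_vec_index_sum:
  fixes A :: "real mat"
  assumes "A \<in> carrier_mat m k" "v \<in> carrier_vec k" "i < m"
  shows "(A *\<^sub>v v) $ i = (\<Sum>j<k. A $$ (i, j) * v $ j)"
  using assms by (auto simp: scalar_prod_def lessThan_atLeast0 intro!: sum.cong)

lemma smult_mat_mult_vec:
  fixes A :: "real mat"
  assumes "A \<in> carrier_mat m k" "v \<in> carrier_vec k"
  shows "(c \<cdot>\<^sub>m A) *\<^sub>v v = c \<cdot>\<^sub>v (A *\<^sub>v v)"
  using assms by (intro eq_vecI) (auto simp: scalar_prod_def sum_distrib_left mult.assoc intro!: sum.cong)

text \<open>The lower blocks have no rows, so the second part of the block product is the empty
  vector.\<close>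

lemma append_cols_mult_vec:
  assumes "A \<in> carrier_mat m k" "B \<in> carrier_mat m l" "u \<in> carrier_vec k" "v \<in> carrier_vec l"
  shows "(A @\<^sub>c B) *\<^sub>v (u @\<^sub>v v) = A *\<^sub>v u + B *\<^sub>v v"
proof -
  have "(A @\<^sub>c B) *\<^sub>v (u @\<^sub>v v) = (A *\<^sub>v u + B *\<^sub>v v) @\<^sub>v (0\<^sub>m 0 k *\<^sub>v u + 0\<^sub>m 0 l *\<^sub>v v)"
    unfolding append_cols_def using assms
    by (subst four_block_mat_mult_vec[of _ m k _ l _ 0]) auto
  also have "\<dots> = A *\<^sub>v u + B *\<^sub>v v" using assms by (intro eq_vecI) auto
  finally show ?thesis .
qed

lemma append_cols_carrier: "A \<in> carrier_mat m k \<Longrightarrow> B \<in> carrier_mat m l \<Longrightarrow> A @\<^sub>c B \<in> carrier_mat m (k + l)"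
  unfolding append_cols_def by (rule carrier_matI) simp_all

lemma append_cols_index:
  assumes "A \<in> carrier_mat m k" "B \<in> carrier_mat m l" "i < m" "j < k + l"
  shows "(A @\<^sub>c B) $$ (i, j) = (if j < k then A $$ (i, j) else B $$ (i, j - k))"
proof -
  note d = carrier_matD[OF assms(1)] carrier_matD[OF assms(2)]
  show ?thesis
    unfolding append_cols_def using assms(3,4) by (subst index_mat_four_block(1)) (simp_all add: d)
qed

lemma diag_block_mat_pair:
  "diag_block_mat [A, B] = four_block_mat A (0\<^sub>m (dim_row A) (dim_col B)) (0\<^sub>m (dim_row B) (dim_col A)) B"
  unfolding diag_block_mat.simps(2)[of A "[B]"] diag_block_mat_singleton Let_def ..

lemma diag_block_mat_mult_vec:
  fixes A :: "real mat"
  assumes "A \<in> carrier_mat m k" "B \<in> carrier_mat m' k'" "u \<in> carrier_vec k" "v \<in> carrier_vec k'"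
  shows "diag_block_mat [A, B] *\<^sub>v (u @\<^sub>v v) = (A *\<^sub>v u) @\<^sub>v (B *\<^sub>v v)"
proof -
  have "diag_block_mat [A, B] *\<^sub>v (u @\<^sub>v v) =
      (A *\<^sub>v u + 0\<^sub>m m k' *\<^sub>v v) @\<^sub>v (0\<^sub>m m' k *\<^sub>v u + B *\<^sub>v v)"
    unfolding diag_block_mat_pair using assms
    by (subst four_block_mat_mult_vec[of _ m k _ k' _ m']) auto
  also have "\<dots> = (A *\<^sub>v u) @\<^sub>v (B *\<^sub>v v)" using assms by (intro eq_vecI) auto
  finally show ?thesis .
qed

lemma sum_div_mod:
  fixes F :: "nat \<Rightarrow> real"
  shows "(\<Sum>l<m * k. F l) = (\<Sum>i<m. \<Sum>r<k. F (i * k + r))"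
proof -
  have eq: "sum F {i * k..<i * k + k} = (\<Sum>r<k. F (i * k + r))" for i
    using sum.shift_bounds_nat_ivl[of F 0 "i * k" k] by (simp add: lessThan_atLeast0 add.commute)
  show ?thesis unfolding sum.nat_group[symmetric] eq ..
qed

lemma block_carrier [simp]: "block Nr \<zeta> \<nu> \<in> carrier_vec Nr"
  by (simp add: block_def)

section \<open>Interpolating splines\<close>

context
  fixes Nr :: nat and x :: "nat \<Rightarrow> real^2" and Q\<^sub>1 Q\<^sub>2 R :: "real mat"
  assumes inj: "inj_on x {..<Nr}" and ncol: "\<not> collinear (x ` {..<Nr})"
    and QR: "QR_decomp (T_mat Nr x) Q\<^sub>1 Q\<^sub>2 R"
begin

lemma Nr_ge_3: "3 \<le> Nr"
proof (rule ccontr)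
  assume "\<not> 3 \<le> Nr"
  then have "card (x ` {..<Nr}) \<le> 2" using card_image_le[of "{..<Nr}" x] by simp
  then show False using ncol collinear_small[of "x ` {..<Nr}"] by simp
qed

lemma T_carrier: "T_mat Nr x \<in> carrier_mat Nr 3"
  by (simp add: T_mat_def)

lemma K_carrier: "K_mat Nr x \<in> carrier_mat Nr Nr"
  by (simp add: K_mat_def)

lemma QR_facts:
  shows Q1_carrier: "Q\<^sub>1 \<in> carrier_mat Nr 3" and Q2_carrier: "Q\<^sub>2 \<in> carrier_mat Nr (Nr - 3)"
    and R_carrier: "R \<in> carrier_mat 3 3"
    and Q_orthogonal: "(Q\<^sub>1 @\<^sub>c Q\<^sub>2)\<^sup>T * (Q\<^sub>1 @\<^sub>c Q\<^sub>2) = 1\<^sub>m Nr"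
    and T_eq: "T_mat Nr x = (Q\<^sub>1 @\<^sub>c Q\<^sub>2) * (R @\<^sub>r 0\<^sub>m (Nr - 3) 3)"
  using QR T_carrier unfolding QR_decomp_def by (auto simp: Let_def)

lemma Q_carrier: "Q\<^sub>1 @\<^sub>c Q\<^sub>2 \<in> carrier_mat Nr Nr"
  using append_cols_carrier[OF Q1_carrier Q2_carrier] Nr_ge_3 by simp

lemma Q_index: "r < Nr \<Longrightarrow> l < Nr - 3 \<Longrightarrow> (Q\<^sub>1 @\<^sub>c Q\<^sub>2) $$ (r, 3 + l) = Q\<^sub>2 $$ (r, l)"
  using append_cols_index[OF Q1_carrier Q2_carrier, of r "3 + l"] by simp

lemma Q2_orthonormal:
  assumes "l < Nr - 3" "l' < Nr - 3"
  shows "(\<Sum>r<Nr. Q\<^sub>2 $$ (r, l) * Q\<^sub>2 $$ (r, l')) = (if l = l' then 1 else 0)"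
proof -
  let ?Q = "Q\<^sub>1 @\<^sub>c Q\<^sub>2"
  have b: "3 + l < Nr" "3 + l' < Nr" using assms by auto
  have "(?Q\<^sup>T * ?Q) $$ (3 + l, 3 + l') = (\<Sum>r<Nr. ?Q $$ (r, 3 + l) * ?Q $$ (r, 3 + l'))"
    using Q_carrier b by (simp add: scalar_prod_def lessThan_atLeast0)
  also have "\<dots> = (\<Sum>r<Nr. Q\<^sub>2 $$ (r, l) * Q\<^sub>2 $$ (r, l'))"
    using assms by (intro sum.cong refl) (simp add: Q_index)
  finally show ?thesis unfolding Q_orthogonal using b by simp
qed

text \<open>Orthogonality turns the QR equation into: the transpose of the full orthogonal factor
  times T is R above zeros. The columns of \<open>Q\<^sub>2\<close> belong to the zero rows.\<close>

lemma Q2_T_orthogonal: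
  assumes "l < Nr - 3" "k < 3"
  shows "(\<Sum>r<Nr. Q\<^sub>2 $$ (r, l) * T_mat Nr x $$ (r, k)) = 0"
proof -
  let ?Q = "Q\<^sub>1 @\<^sub>c Q\<^sub>2" and ?S = "R @\<^sub>r 0\<^sub>m (Nr - 3) 3"
  have b: "3 + l < Nr" using assms by auto
  have S: "?S \<in> carrier_mat Nr 3"
    using carrier_append_rows[OF R_carrier zero_carrier_mat[of "Nr - 3" 3]] Nr_ge_3 by simp
  have QT: "?Q\<^sup>T \<in> carrier_mat Nr Nr" using Q_carrier by simp
  have "?Q\<^sup>T * T_mat Nr x = ?S"
    unfolding T_eq assoc_mult_mat[OF QT Q_carrier S, symmetric] Q_orthogonal using S by simp
  moreover have "?S $$ (3 + l, k) = 0" using assms R_carrier by (simp add: append_rows_def)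
  moreover have "(?Q\<^sup>T * T_mat Nr x) $$ (3 + l, k) = (\<Sum>r<Nr. ?Q $$ (r, 3 + l) * T_mat Nr x $$ (r, k))"
    using Q_carrier T_carrier b assms by (simp add: scalar_prod_def lessThan_atLeast0)
  moreover have "\<dots> = (\<Sum>r<Nr. Q\<^sub>2 $$ (r, l) * T_mat Nr x $$ (r, k))"
    using assms by (intro sum.cong refl) (simp add: Q_index)
  ultimately show ?thesis by simp
qed

context
  fixes \<gamma> \<alpha> :: "real vec"
  assumes \<gamma>: "\<gamma> \<in> carrier_vec (Nr - 3)" and \<alpha>: "\<alpha> \<in> carrier_vec 3"
begin

lemma Q2_mult_index: "r < Nr \<Longrightarrow> (Q\<^sub>2 *\<^sub>v \<gamma>) $ r = (\<Sum>l<Nr - 3. Q\<^sub>2 $$ (r, l) * \<gamma> $ l)"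
  by (rule mult_mat_vec_index_sum[OF Q2_carrier \<gamma>])

lemma Q2_mult_carrier: "Q\<^sub>2 *\<^sub>v \<gamma> \<in> carrier_vec Nr"
  using Q2_carrier \<gamma> by simp

lemma Q2_mult_T:
  assumes "k < 3"
  shows "(\<Sum>r<Nr. (Q\<^sub>2 *\<^sub>v \<gamma>) $ r * T_mat Nr x $$ (r, k)) = 0"
proof -
  have "(\<Sum>r<Nr. (Q\<^sub>2 *\<^sub>v \<gamma>) $ r * T_mat Nr x $$ (r, k)) =
      (\<Sum>r<Nr. \<Sum>l<Nr - 3. \<gamma> $ l * (Q\<^sub>2 $$ (r, l) * T_mat Nr x $$ (r, k)))"
    by (intro sum.cong refl) (simp add: Q2_mult_index sum_distrib_left sum_distrib_right mult_ac)
  also have "\<dots> = (\<Sum>l<Nr - 3. \<gamma> $ l * (\<Sum>r<Nr. Q\<^sub>2 $$ (r, l) * T_mat Nr x $$ (r, k)))"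
    by (subst sum.swap) (simp add: sum_distrib_left)
  also have "\<dots> = 0" using assms by (intro sum.neutral ballI) (simp add: Q2_T_orthogonal)
  finally show ?thesis .
qed

text \<open>Orthonormal columns make the transpose of \<open>Q\<^sub>2\<close> a left
  inverse.\<close>

lemma Q2_mult_zero:
  assumes "\<And>r. r < Nr \<Longrightarrow> (Q\<^sub>2 *\<^sub>v \<gamma>) $ r = 0"
  shows "\<gamma> = 0\<^sub>v (Nr - 3)"
proof (rule eq_vecI)
  fix l assume "l < dim_vec (0\<^sub>v (Nr - 3) :: real vec)"
  then have l: "l < Nr - 3" by simp
  have "0 = (\<Sum>r<Nr. Q\<^sub>2 $$ (r, l) * (Q\<^sub>2 *\<^sub>v \<gamma>) $ r)" using assms by simp
  also have "\<dots> = (\<Sum>r<Nr. \<Sum>l'<Nr - 3. \<gamma> $ l' * (Q\<^sub>2 $$ (r, l) * Q\<^sub>2 $$ (r, l')))"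
    by (intro sum.cong refl) (simp add: Q2_mult_index sum_distrib_left mult_ac)
  also have "\<dots> = (\<Sum>l'<Nr - 3. \<gamma> $ l' * (\<Sum>r<Nr. Q\<^sub>2 $$ (r, l) * Q\<^sub>2 $$ (r, l')))"
    by (subst sum.swap) (simp add: sum_distrib_left)
  also have "\<dots> = (\<Sum>l'<Nr - 3. if l' = l then \<gamma> $ l' else 0)"
    using l by (intro sum.cong refl) (auto simp: Q2_orthonormal)
  also have "\<dots> = \<gamma> $ l" using l by simp
  finally show "\<gamma> $ l = 0\<^sub>v (Nr - 3) $ l" using l by simp
qed (use \<gamma> in auto)

lemma coeffs_index:
  "r < Nr \<Longrightarrow> ((Q\<^sub>2 *\<^sub>v \<gamma>) @\<^sub>v \<alpha>) $ r = (Q\<^sub>2 *\<^sub>v \<gamma>) $ r"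
  "k < 3 \<Longrightarrow> ((Q\<^sub>2 *\<^sub>v \<gamma>) @\<^sub>v \<alpha>) $ (Nr + k) = \<alpha> $ k"
  using Q2_carrier \<alpha> by simp_all

text \<open>The columns of T are the constant 1 and the two coordinates, so orthogonality to them is
  precisely the pair of moment conditions.\<close>

lemma coeffs_conditions:
  "(\<Sum>r<Nr. ((Q\<^sub>2 *\<^sub>v \<gamma>) @\<^sub>v \<alpha>) $ r) = 0"
  "(\<Sum>r<Nr. ((Q\<^sub>2 *\<^sub>v \<gamma>) @\<^sub>v \<alpha>) $ r *\<^sub>R x r) = 0"
proof -
  have T: "T_mat Nr x $$ (r, 0) = 1" "T_mat Nr x $$ (r, 1) = vec_nth (x r) 1"
    "T_mat Nr x $$ (r, 2) = vec_nth (x r) 2" if "r < Nr" for r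
    using that by (simp_all add: T_mat_def)
  show "(\<Sum>r<Nr. ((Q\<^sub>2 *\<^sub>v \<gamma>) @\<^sub>v \<alpha>) $ r) = 0"
    using Q2_mult_T[of 0] by (simp add: coeffs_index T)
  have "(\<Sum>r<Nr. (Q\<^sub>2 *\<^sub>v \<gamma>) $ r * vec_nth (x r) 1) = 0" "(\<Sum>r<Nr. (Q\<^sub>2 *\<^sub>v \<gamma>) $ r * vec_nth (x r) 2) = 0"
    using Q2_mult_T[of 1] Q2_mult_T[of 2] by (simp_all add: T T(2)[unfolded One_nat_def])
  then show "(\<Sum>r<Nr. ((Q\<^sub>2 *\<^sub>v \<gamma>) @\<^sub>v \<alpha>) $ r *\<^sub>R x r) = 0"
    unfolding Finite_Cartesian_Product.vec_eq_iff forall_2 by (simp add: coeffs_index sum_component)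
qed

lemma spline_coeffs_value:
  assumes "i < Nr"
  shows "spline Nr x ((Q\<^sub>2 *\<^sub>v \<gamma>) @\<^sub>v \<alpha>) (x i) = (K_mat Nr x *\<^sub>v (Q\<^sub>2 *\<^sub>v \<gamma>) + T_mat Nr x *\<^sub>v \<alpha>) $ i"
proof -
  have "(K_mat Nr x *\<^sub>v (Q\<^sub>2 *\<^sub>v \<gamma>)) $ i = (\<Sum>r<Nr. (Q\<^sub>2 *\<^sub>v \<gamma>) $ r * tps_kernel (norm (x i - x r)))"
    unfolding mult_mat_vec_index_sum[OF K_carrier Q2_mult_carrier assms]
    using assms by (intro sum.cong refl) (simp add: K_mat_def)
  moreover have "(T_mat Nr x *\<^sub>v \<alpha>) $ i = \<alpha> $ 0 + \<alpha> $ 1 * vec_nth (x i) 1 + \<alpha> $ 2 * vec_nth (x i) 2"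
    unfolding mult_mat_vec_index_sum[OF T_carrier \<alpha> assms]
    using assms by (simp add: T_mat_def eval_nat_numeral)
  ultimately show ?thesis
    using assms coeffs_index(2)[of 0] coeffs_index(2)[of 1] coeffs_index(2)[of 2] K_carrier T_carrier
    by (simp add: spline_def coeffs_index(1))
qed

lemma KQT_mult: "KQT_mat Nr x Q\<^sub>2 *\<^sub>v (\<gamma> @\<^sub>v \<alpha>) = K_mat Nr x *\<^sub>v (Q\<^sub>2 *\<^sub>v \<gamma>) + T_mat Nr x *\<^sub>v \<alpha>"
proof -
  have KQ: "K_mat Nr x * Q\<^sub>2 \<in> carrier_mat Nr (Nr - 3)" using K_carrier Q2_carrier by simp
  show ?thesis
    unfolding KQT_mat_def append_cols_mult_vec[OF KQ T_carrier \<gamma> \<alpha>]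
      assoc_mult_mat_vec[OF K_carrier Q2_carrier \<gamma>] ..
qed

text \<open>The affine part drops out because the kernel coefficients are orthogonal to the columns
  of T; what remains is the quadratic form of the reduced kernel matrix, with the factor 8 pi of the
  representation identity.\<close>

lemma roughness_spline_coeffs:
  "roughness (spline Nr x ((Q\<^sub>2 *\<^sub>v \<gamma>) @\<^sub>v \<alpha>)) =
     8 * pi * scalar_prod ((Q\<^sub>2\<^sup>T * K_mat Nr x * Q\<^sub>2) *\<^sub>v \<gamma>) \<gamma>"
proof -
  let ?b = "Q\<^sub>2 *\<^sub>v \<gamma>"
  have Kb: "K_mat Nr x *\<^sub>v ?b \<in> carrier_vec Nr" using K_carrier Q2_mult_carrier by simp
  have Ta: "T_mat Nr x *\<^sub>v \<alpha> \<in> carrier_vec Nr" using T_carrier \<alpha> by simp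
  have "(\<Sum>r<Nr. ?b $ r * (T_mat Nr x *\<^sub>v \<alpha>) $ r) =
      (\<Sum>r<Nr. \<Sum>k<3. \<alpha> $ k * (?b $ r * T_mat Nr x $$ (r, k)))"
    by (intro sum.cong refl)
      (simp only: lessThan_iff mult_mat_vec_index_sum[OF T_carrier \<alpha>] sum_distrib_left mult_ac)
  also have "\<dots> = (\<Sum>k<3. \<alpha> $ k * (\<Sum>r<Nr. ?b $ r * T_mat Nr x $$ (r, k)))"
    by (subst sum.swap) (simp only: sum_distrib_left)
  also have "\<dots> = 0" by (intro sum.neutral ballI) (simp add: Q2_mult_T)
  finally have orth: "(\<Sum>r<Nr. ?b $ r * (T_mat Nr x *\<^sub>v \<alpha>) $ r) = 0" .
  have "roughness (spline Nr x (?b @\<^sub>v \<alpha>)) =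
      8 * pi * (\<Sum>r<Nr. ?b $ r * (K_mat Nr x *\<^sub>v ?b + T_mat Nr x *\<^sub>v \<alpha>) $ r)"
    unfolding roughness_spline[OF coeffs_conditions]
    by (intro arg_cong[where f = "\<lambda>s. 8 * pi * s"] sum.cong refl) (simp only: lessThan_iff spline_coeffs_value coeffs_index(1))
  also have "(\<Sum>r<Nr. ?b $ r * (K_mat Nr x *\<^sub>v ?b + T_mat Nr x *\<^sub>v \<alpha>) $ r) =
      (\<Sum>r<Nr. ?b $ r * (K_mat Nr x *\<^sub>v ?b) $ r + ?b $ r * (T_mat Nr x *\<^sub>v \<alpha>) $ r)"
    using Kb Ta by (intro sum.cong refl) (simp only: lessThan_iff carrier_vecD index_add_vec(1) distrib_left)
  also have "\<dots> = (\<Sum>r<Nr. ?b $ r * (K_mat Nr x *\<^sub>v ?b) $ r)"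
    unfolding sum.distrib orth by simp
  also have "\<dots> = scalar_prod (K_mat Nr x *\<^sub>v ?b) ?b"
    unfolding scalar_prod_sum[OF Q2_mult_carrier] by (simp only: mult.commute)
  also have "\<dots> = scalar_prod (Q\<^sub>2\<^sup>T *\<^sub>v (K_mat Nr x *\<^sub>v ?b)) \<gamma>"
    by (rule transpose_vec_mult_scalar[OF Q2_carrier \<gamma> Kb, symmetric])
  also have "Q\<^sub>2\<^sup>T *\<^sub>v (K_mat Nr x *\<^sub>v ?b) = (Q\<^sub>2\<^sup>T * K_mat Nr x * Q\<^sub>2) *\<^sub>v \<gamma>"
  proof -
    have Q2T: "Q\<^sub>2\<^sup>T \<in> carrier_mat (Nr - 3) Nr" using Q2_carrier by simp
    have "(Q\<^sub>2\<^sup>T * K_mat Nr x * Q\<^sub>2) *\<^sub>v \<gamma> = (Q\<^sub>2\<^sup>T * K_mat Nr x) *\<^sub>v ?b"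
      by (rule assoc_mult_mat_vec[OF mult_carrier_mat[OF Q2T K_carrier] Q2_carrier \<gamma>])
    also have "\<dots> = Q\<^sub>2\<^sup>T *\<^sub>v (K_mat Nr x *\<^sub>v ?b)"
      by (rule assoc_mult_mat_vec[OF Q2T K_carrier Q2_mult_carrier])
    finally show ?thesis by simp
  qed
  finally show ?thesis .
qed

text \<open>A null vector yields a spline that vanishes at all points and so has zero roughness. Its
  kernel coefficients are then zero, and the remaining affine function vanishes at non-collinear
  points.\<close>

lemma KQT_injective:
  assumes "KQT_mat Nr x Q\<^sub>2 *\<^sub>v (\<gamma> @\<^sub>v \<alpha>) = 0\<^sub>v Nr"
  shows "\<gamma> @\<^sub>v \<alpha> = 0\<^sub>v Nr"
proof -
  let ?c = "(Q\<^sub>2 *\<^sub>v \<gamma>) @\<^sub>v \<alpha>"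
  have z: "spline Nr x ?c (x i) = 0" if "i < Nr" for i
    unfolding spline_coeffs_value[OF that] KQT_mult[symmetric] assms using that by simp
  then have "roughness (spline Nr x ?c) = 0" by (simp add: roughness_spline[OF coeffs_conditions])
  then have b: "?c $ r = 0" if "r < Nr" for r
    by (rule kernel_form_pos[OF coeffs_conditions inj _ that])
  then have "(Q\<^sub>2 *\<^sub>v \<gamma>) $ r = 0" if "r < Nr" for r using that coeffs_index(1)[of r] by simp
  then have \<gamma>0: "\<gamma> = 0\<^sub>v (Nr - 3)" by (rule Q2_mult_zero)
  have lin: "spline Nr x ?c p = \<alpha> $ 0 + \<alpha> $ 1 * vec_nth p 1 + \<alpha> $ 2 * vec_nth p 2" for p
    using b coeffs_index(2)[of 0] coeffs_index(2)[of 1] coeffs_index(2)[of 2] by (simp add: spline_def)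
  have aff: "\<alpha> $ 0 + \<alpha> $ 1 * vec_nth p 1 + \<alpha> $ 2 * vec_nth p 2 = 0" for p :: "real^2"
  proof -
    obtain a where a: "(\<Sum>r<Nr. a r) = 1" "(\<Sum>r<Nr. a r *\<^sub>R x r) = p"
      using affine_combination_noncollinear[OF inj ncol] by blast
    have "\<alpha> $ 0 + \<alpha> $ 1 * vec_nth p 1 + \<alpha> $ 2 * vec_nth p 2 =
        \<alpha> $ 0 * (\<Sum>r<Nr. a r) + \<alpha> $ 1 * vec_nth (\<Sum>r<Nr. a r *\<^sub>R x r) 1 + \<alpha> $ 2 * vec_nth (\<Sum>r<Nr. a r *\<^sub>R x r) 2"
      using a by simp
    also have "\<dots> = (\<Sum>r<Nr. a r * (\<alpha> $ 0 + \<alpha> $ 1 * vec_nth (x r) 1 + \<alpha> $ 2 * vec_nth (x r) 2))"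
      by (simp add: sum_component sum_distrib_left algebra_simps flip: sum.distrib)
    also have "\<dots> = 0" using z by (intro sum.neutral ballI) (simp add: lin)
    finally show ?thesis .
  qed
  have \<alpha>0: "\<alpha> $ 0 = 0" using aff[of 0] by simp
  moreover have "\<alpha> $ 1 = 0" using aff[of "axis 1 1"] \<alpha>0 by (simp add: axis_def)
  moreover have "\<alpha> $ 2 = 0" using aff[of "axis 2 1"] \<alpha>0 by (simp add: axis_def)
  ultimately have "\<alpha> $ k = 0" if "k < 3" for k
    using that by (auto simp: eval_nat_numeral less_Suc_eq)
  then show ?thesis using \<gamma>0 \<alpha> Nr_ge_3 by (intro eq_vecI) auto
qed

end

section \<open>Invertibility of the interpolation matrix and the interpolating spline\<close>

lemma KQT_carrier: "KQT_mat Nr x Q\<^sub>2 \<in> carrier_mat Nr Nr"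
  using append_cols_carrier[OF mult_carrier_mat[OF K_carrier Q2_carrier] T_carrier] Nr_ge_3
  by (simp add: KQT_mat_def)

lemma vec_split_Nr:
  assumes "w \<in> carrier_vec Nr"
  obtains \<gamma> \<alpha> where "\<gamma> \<in> carrier_vec (Nr - 3)" "\<alpha> \<in> carrier_vec 3" "w = \<gamma> @\<^sub>v \<alpha>"
  using assms Nr_ge_3 vec_first_last_append[of w "Nr - 3" 3]
  by (intro that[of "vec_first w (Nr - 3)" "vec_last w 3"]) auto

text \<open>Injectivity excludes determinant zero, so \<open>mat_inverse\<close> returns a value and
  \<open>mat_inv\<close> is the genuine inverse.\<close>

lemma KQT_inverse:
  "KQT_mat Nr x Q\<^sub>2 * mat_inv (KQT_mat Nr x Q\<^sub>2) = 1\<^sub>m Nr" "mat_inv (KQT_mat Nr x Q\<^sub>2) \<in> carrier_mat Nr Nr"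
proof -
  have "det (KQT_mat Nr x Q\<^sub>2) \<noteq> 0"
  proof
    assume "det (KQT_mat Nr x Q\<^sub>2) = 0"
    then obtain w where w: "w \<in> carrier_vec Nr" "w \<noteq> 0\<^sub>v Nr" "KQT_mat Nr x Q\<^sub>2 *\<^sub>v w = 0\<^sub>v Nr"
      using det_0_iff_vec_prod_zero_field[OF KQT_carrier] by blast
    obtain \<gamma> \<alpha> where "\<gamma> \<in> carrier_vec (Nr - 3)" "\<alpha> \<in> carrier_vec 3" "w = \<gamma> @\<^sub>v \<alpha>"
      by (rule vec_split_Nr[OF w(1)])
    with w KQT_injective show False by blast
  qed
  then have "mat_inverse (KQT_mat Nr x Q\<^sub>2) \<noteq> None"
    using mat_inverse(1)[OF KQT_carrier, where b = "()"] det_non_zero_imp_unit[OF KQT_carrier, where b = "()"]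
    by blast
  then obtain B where B: "mat_inverse (KQT_mat Nr x Q\<^sub>2) = Some B" by blast
  then show "KQT_mat Nr x Q\<^sub>2 * mat_inv (KQT_mat Nr x Q\<^sub>2) = 1\<^sub>m Nr" "mat_inv (KQT_mat Nr x Q\<^sub>2) \<in> carrier_mat Nr Nr"
    using mat_inverse(2)[OF KQT_carrier B] by simp_all
qed

context
  fixes z :: "real vec" assumes z: "z \<in> carrier_vec Nr"
begin

text \<open>Links three descriptions of one spline: its sample values \<open>z\<close>, the reduced
  coordinates \<gamma> and \<alpha> given by the inverse matrix, and its full coefficient
  vector.\<close>

lemma coordinates:
  obtains \<gamma> \<alpha> where "\<gamma> \<in> carrier_vec (Nr - 3)" "\<alpha> \<in> carrier_vec 3"
    "mat_inv (KQT_mat Nr x Q\<^sub>2) *\<^sub>v z = \<gamma> @\<^sub>v \<alpha>" "KQT_mat Nr x Q\<^sub>2 *\<^sub>v (\<gamma> @\<^sub>v \<alpha>) = z"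
    "spline_coeffs Nr x Q\<^sub>2 z = (Q\<^sub>2 *\<^sub>v \<gamma>) @\<^sub>v \<alpha>"
proof -
  let ?w = "mat_inv (KQT_mat Nr x Q\<^sub>2) *\<^sub>v z"
  have w: "?w \<in> carrier_vec Nr" using KQT_inverse(2) z by simp
  obtain \<gamma> \<alpha> where ga: "\<gamma> \<in> carrier_vec (Nr - 3)" "\<alpha> \<in> carrier_vec 3" "?w = \<gamma> @\<^sub>v \<alpha>"
    by (rule vec_split_Nr[OF w])
  have 1: "KQT_mat Nr x Q\<^sub>2 *\<^sub>v ?w = z"
    unfolding assoc_mult_mat_vec[OF KQT_carrier KQT_inverse(2) z, symmetric] KQT_inverse(1) using z by simp
  have D: "diag_block_mat [Q\<^sub>2, 1\<^sub>m 3] \<in> carrier_mat (Nr + 3) Nr"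
    unfolding diag_block_mat_pair using four_block_carrier_mat[OF Q2_carrier one_carrier_mat[of 3]] Nr_ge_3 by simp
  have "spline_coeffs Nr x Q\<^sub>2 z = diag_block_mat [Q\<^sub>2, 1\<^sub>m 3] *\<^sub>v (\<gamma> @\<^sub>v \<alpha>)"
    unfolding spline_coeffs_def assoc_mult_mat_vec[OF D KQT_inverse(2) z] ga(3) ..
  also have "\<dots> = (Q\<^sub>2 *\<^sub>v \<gamma>) @\<^sub>v (1\<^sub>m 3 *\<^sub>v \<alpha>)"
    by (rule diag_block_mat_mult_vec[OF Q2_carrier one_carrier_mat ga(1,2)])
  also have "\<dots> = (Q\<^sub>2 *\<^sub>v \<gamma>) @\<^sub>v \<alpha>" using ga(2) by simp
  finally show ?thesis using that ga 1 by simp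
qed

lemma interpolant_conditions:
  "(\<Sum>r<Nr. spline_coeffs Nr x Q\<^sub>2 z $ r) = 0" "(\<Sum>r<Nr. spline_coeffs Nr x Q\<^sub>2 z $ r *\<^sub>R x r) = 0"
proof -
  obtain \<gamma> \<alpha> where ga: "\<gamma> \<in> carrier_vec (Nr - 3)" "\<alpha> \<in> carrier_vec 3"
    "spline_coeffs Nr x Q\<^sub>2 z = (Q\<^sub>2 *\<^sub>v \<gamma>) @\<^sub>v \<alpha>" by (rule coordinates)
  show "(\<Sum>r<Nr. spline_coeffs Nr x Q\<^sub>2 z $ r) = 0" "(\<Sum>r<Nr. spline_coeffs Nr x Q\<^sub>2 z $ r *\<^sub>R x r) = 0"
    unfolding ga(3) by (fact coeffs_conditions[OF ga(1,2)])+
qed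

text \<open>A block of the group-Lasso variable is thereby the vector of samples of its spline,
  which makes the group penalties of the two problems agree.\<close>

lemma interpolant_value:
  assumes "i < Nr"
  shows "spline Nr x (spline_coeffs Nr x Q\<^sub>2 z) (x i) = z $ i"
proof -
  obtain \<gamma> \<alpha> where ga: "\<gamma> \<in> carrier_vec (Nr - 3)" "\<alpha> \<in> carrier_vec 3"
    "KQT_mat Nr x Q\<^sub>2 *\<^sub>v (\<gamma> @\<^sub>v \<alpha>) = z"
    "spline_coeffs Nr x Q\<^sub>2 z = (Q\<^sub>2 *\<^sub>v \<gamma>) @\<^sub>v \<alpha>" by (rule coordinates)
  show ?thesis
    unfolding ga(4) spline_coeffs_value[OF ga(1,2) assms] KQT_mult[OF ga(1,2), symmetric] ga(3) ..
qed

text \<open>By symmetry of \<open>C\<close>, the squared norm of C \<gamma> is the quadratic form of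
  C C at \<gamma>, which is t times the roughness. The zero block discards \<alpha>, as the affine
  part has no roughness.\<close>

lemma interpolant_roughness:
  assumes C: "is_mat_sqrt C ((t * (8 * pi)) \<cdot>\<^sub>m (Q\<^sub>2\<^sup>T * K_mat Nr x * Q\<^sub>2))"
  shows "(vnorm ((diag_block_mat [C, 0\<^sub>m 3 3] * mat_inv (KQT_mat Nr x Q\<^sub>2)) *\<^sub>v z))\<^sup>2 =
     t * roughness (spline Nr x (spline_coeffs Nr x Q\<^sub>2 z))"
    and "diag_block_mat [C, 0\<^sub>m 3 3] * mat_inv (KQT_mat Nr x Q\<^sub>2) \<in> carrier_mat Nr Nr"
proof -
  let ?G = "Q\<^sub>2\<^sup>T * K_mat Nr x * Q\<^sub>2"
  have G: "?G \<in> carrier_mat (Nr - 3) (Nr - 3)"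
    using Q2_carrier K_carrier by (intro mult_carrier_mat[of _ _ Nr]) auto
  have Cc: "C \<in> carrier_mat (Nr - 3) (Nr - 3)" and CT: "C\<^sup>T = C" and CC: "C * C = (t * (8 * pi)) \<cdot>\<^sub>m ?G"
    using C G Q2_carrier unfolding is_mat_sqrt_def by auto
  obtain \<gamma> \<alpha> where ga: "\<gamma> \<in> carrier_vec (Nr - 3)" "\<alpha> \<in> carrier_vec 3"
    "mat_inv (KQT_mat Nr x Q\<^sub>2) *\<^sub>v z = \<gamma> @\<^sub>v \<alpha>"
    "spline_coeffs Nr x Q\<^sub>2 z = (Q\<^sub>2 *\<^sub>v \<gamma>) @\<^sub>v \<alpha>" by (rule coordinates)
  have D: "diag_block_mat [C, 0\<^sub>m 3 3] \<in> carrier_mat Nr Nr"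
    unfolding diag_block_mat_pair using four_block_carrier_mat[OF Cc zero_carrier_mat[of 3 3]] Nr_ge_3 by simp
  then show "diag_block_mat [C, 0\<^sub>m 3 3] * mat_inv (KQT_mat Nr x Q\<^sub>2) \<in> carrier_mat Nr Nr"
    using KQT_inverse(2) by simp
  have Cg: "C *\<^sub>v \<gamma> \<in> carrier_vec (Nr - 3)" using Cc ga by simp
  have "(diag_block_mat [C, 0\<^sub>m 3 3] * mat_inv (KQT_mat Nr x Q\<^sub>2)) *\<^sub>v z = (C *\<^sub>v \<gamma>) @\<^sub>v (0\<^sub>m 3 3 *\<^sub>v \<alpha>)"
    unfolding assoc_mult_mat_vec[OF D KQT_inverse(2) z] ga(3)
    by (rule diag_block_mat_mult_vec[OF Cc zero_carrier_mat ga(1,2)])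
  also have "0\<^sub>m 3 3 *\<^sub>v \<alpha> = 0\<^sub>v 3"
    using ga(2) by (intro eq_vecI) (auto simp: scalar_prod_def)
  finally have "scalar_prod ((diag_block_mat [C, 0\<^sub>m 3 3] * mat_inv (KQT_mat Nr x Q\<^sub>2)) *\<^sub>v z)
      ((diag_block_mat [C, 0\<^sub>m 3 3] * mat_inv (KQT_mat Nr x Q\<^sub>2)) *\<^sub>v z) = scalar_prod (C *\<^sub>v \<gamma>) (C *\<^sub>v \<gamma>)"
    using scalar_prod_append[OF Cg zero_carrier_vec[of 3] Cg zero_carrier_vec[of 3]] by simp
  also have "\<dots> = scalar_prod (C\<^sup>T *\<^sub>v (C *\<^sub>v \<gamma>)) \<gamma>"
    by (rule transpose_vec_mult_scalar[OF Cc ga(1) Cg, symmetric])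
  also have "C\<^sup>T *\<^sub>v (C *\<^sub>v \<gamma>) = (t * (8 * pi)) \<cdot>\<^sub>v (?G *\<^sub>v \<gamma>)"
    unfolding CT assoc_mult_mat_vec[OF Cc Cc ga(1), symmetric] CC by (rule smult_mat_mult_vec[OF G ga(1)])
  also have "scalar_prod \<dots> \<gamma> = (t * (8 * pi)) * scalar_prod (?G *\<^sub>v \<gamma>) \<gamma>"
    by (rule smult_scalar_prod_distrib[of _ "Nr - 3"]) (use G ga in auto)
  also have "\<dots> = t * roughness (spline Nr x (spline_coeffs Nr x Q\<^sub>2 z))"
    unfolding ga(4) roughness_spline_coeffs[OF ga(1,2)] by simp
  finally show "(vnorm ((diag_block_mat [C, 0\<^sub>m 3 3] * mat_inv (KQT_mat Nr x Q\<^sub>2)) *\<^sub>v z))\<^sup>2 =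
     t * roughness (spline Nr x (spline_coeffs Nr x Q\<^sub>2 z))"
  proof -
    assume eq: "scalar_prod ((diag_block_mat [C, 0\<^sub>m 3 3] * mat_inv (KQT_mat Nr x Q\<^sub>2)) *\<^sub>v z)
      ((diag_block_mat [C, 0\<^sub>m 3 3] * mat_inv (KQT_mat Nr x Q\<^sub>2)) *\<^sub>v z) =
      t * roughness (spline Nr x (spline_coeffs Nr x Q\<^sub>2 z))"
    have "0 \<le> scalar_prod v v" for v :: "real vec"
      by (simp add: scalar_prod_def sum_nonneg)
    then show ?thesis unfolding vnorm_def eq[symmetric] by (rule real_sqrt_pow2)
  qed
qed

lemma interpolant_sobolev: "spline Nr x (spline_coeffs Nr x Q\<^sub>2 z) \<in> sobolev"
  by (rule spline_sobolev[OF interpolant_conditions])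

text \<open>By the Pythagorean identity the excess roughness is that of g - s; if it is zero, g - s
  vanishes everywhere because it vanishes at non-collinear points.\<close>

lemma interpolant_minimal:
  assumes g: "g \<in> sobolev" and v: "\<And>r. r < Nr \<Longrightarrow> g (x r) = z $ r"
  shows "roughness (spline Nr x (spline_coeffs Nr x Q\<^sub>2 z)) \<le> roughness g"
    and "roughness g = roughness (spline Nr x (spline_coeffs Nr x Q\<^sub>2 z)) \<Longrightarrow> g = spline Nr x (spline_coeffs Nr x Q\<^sub>2 z)"
proof -
  let ?s = "spline Nr x (spline_coeffs Nr x Q\<^sub>2 z)"
  obtain G where G: "continuous_on UNIV g" "is_weak_hessian g G" using g unfolding sobolev_def by blast
  have iv: "g (x r) = ?s (x r)" if "r < Nr" for r using v[OF that] interpolant_value[OF that] by simp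
  have pyth: "roughness g = roughness ?s + roughness (\<lambda>p. g p - ?s p)"
    by (rule roughness_pythagoras[OF interpolant_conditions G iv])
  then show "roughness ?s \<le> roughness g" using roughness_nonneg[of "\<lambda>p. g p - ?s p"] by linarith
  assume "roughness g = roughness ?s"
  with pyth have 0: "roughness (\<lambda>p. g p - ?s p) = 0" by linarith
  have "g p - ?s p = 0" for p
  proof (rule roughness_zero_vanishes[where D = "\<lambda>p. g p - ?s p", OF _ _ 0 inj ncol])
    show "continuous_on UNIV (\<lambda>p. g p - ?s p)" by (rule continuous_on_diff[OF G(1) continuous_spline])
    show "is_weak_hessian (\<lambda>p. g p - ?s p) (\<lambda>p. G p - spline_hessian Nr x (spline_coeffs Nr x Q\<^sub>2 z) p)"
      by (rule is_weak_hessian_diff[OF G continuous_spline spline_weak_hessian[OF interpolant_conditions]])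
  qed (simp add: iv)
  then show "g = ?s" by (simp add: fun_eq_iff)
qed

end

end

section \<open>The group-Lasso objective\<close>

lemma append_rows_mult_vec:
  fixes A B :: "real mat"
  assumes "A \<in> carrier_mat m k" "B \<in> carrier_mat m' k" "v \<in> carrier_vec k"
  shows "(A @\<^sub>r B) *\<^sub>v v = (A *\<^sub>v v) @\<^sub>v (B *\<^sub>v v)"
proof (rule eq_vecI)
  note d = carrier_matD[OF assms(1)] carrier_matD[OF assms(2)] carrier_vecD[OF assms(3)]
  show "dim_vec ((A @\<^sub>r B) *\<^sub>v v) = dim_vec ((A *\<^sub>v v) @\<^sub>v (B *\<^sub>v v))"
    by (simp add: append_rows_def d)
  fix i assume "i < dim_vec ((A *\<^sub>v v) @\<^sub>v (B *\<^sub>v v))"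
  then have i: "i < m + m'" by (simp add: d)
  have e: "(A @\<^sub>r B) $$ (i, j) = (if i < m then A $$ (i, j) else B $$ (i - m, j))" if "j < k" for j
    unfolding append_rows_def using i that by (subst index_mat_four_block(1)) (simp_all add: d)
  show "((A @\<^sub>r B) *\<^sub>v v) $ i = ((A *\<^sub>v v) @\<^sub>v (B *\<^sub>v v)) $ i"
  proof (cases "i < m")
    case True
    have "((A @\<^sub>r B) *\<^sub>v v) $ i = (\<Sum>j<k. A $$ (i, j) * v $ j)"
      unfolding mult_mat_vec_index_sum[OF carrier_append_rows[OF assms(1,2)] assms(3) i]
      using True by (intro sum.cong refl) (simp add: e)
    then show ?thesis using mult_mat_vec_index_sum[OF assms(1,3) True] True i by (simp add: d)
  next
    case False
    then have im: "i - m < m'" using i by simp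
    have "((A @\<^sub>r B) *\<^sub>v v) $ i = (\<Sum>j<k. B $$ (i - m, j) * v $ j)"
      unfolding mult_mat_vec_index_sum[OF carrier_append_rows[OF assms(1,2)] assms(3) i]
      using False by (intro sum.cong refl) (simp add: e)
    then show ?thesis using mult_mat_vec_index_sum[OF assms(2,3) im] False i by (simp add: d)
  qed
qed

lemma kron_carrier: "A \<in> carrier_mat m k \<Longrightarrow> B \<in> carrier_mat m' k' \<Longrightarrow> A \<otimes>\<^sub>K B \<in> carrier_mat (m * m') (k * k')"
  by (auto simp: kron_def)

lemma pair_index_less: "(i :: nat) < m \<Longrightarrow> r < k \<Longrightarrow> i * k + r < m * k"
proof -
  assume "i < m" "r < k"
  then have "i * k + r < Suc i * k" by simp
  also have "\<dots> \<le> m * k" using \<open>i < m\<close> by (intro mult_le_mono1) simp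
  finally show ?thesis .
qed

lemma kron_mult_vec_index:
  assumes A: "A \<in> carrier_mat m k" and B: "B \<in> carrier_mat l l" and v: "v \<in> carrier_vec (k * l)"
    and i: "i < m" and r: "r < l"
  shows "((A \<otimes>\<^sub>K B) *\<^sub>v v) $ (i * l + r) = (\<Sum>j<k. \<Sum>q<l. A $$ (i, j) * B $$ (r, q) * v $ (j * l + q))"
proof -
  note d = carrier_matD[OF A] carrier_matD[OF B]
  have "((A \<otimes>\<^sub>K B) *\<^sub>v v) $ (i * l + r) = (\<Sum>j<k. \<Sum>q<l. (A \<otimes>\<^sub>K B) $$ (i * l + r, j * l + q) * v $ (j * l + q))"
    unfolding mult_mat_vec_index_sum[OF kron_carrier[OF A B] v pair_index_less[OF i r]] sum_div_mod ..
  also have "\<dots> = (\<Sum>j<k. \<Sum>q<l. A $$ (i, j) * B $$ (r, q) * v $ (j * l + q))"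
    using pair_index_less[OF i r] r
    by (intro sum.cong refl) (simp add: kron_def d pair_index_less)
  finally show ?thesis .
qed

lemma vnorm_append_sq: "(vnorm (u @\<^sub>v v))\<^sup>2 = (vnorm u)\<^sup>2 + (vnorm v)\<^sup>2"
proof -
  have "scalar_prod (u @\<^sub>v v) (u @\<^sub>v v) = scalar_prod u u + scalar_prod v v"
    by (rule scalar_prod_append[of _ "dim_vec u" _ "dim_vec v"]) (auto intro: carrier_vecI)
  moreover have "0 \<le> scalar_prod w w" for w :: "real vec"
    by (simp add: scalar_prod_def sum_nonneg)
  ultimately show ?thesis by (simp add: vnorm_def)
qed

lemma vnorm_smult_sq: "(vnorm (c \<cdot>\<^sub>v v))\<^sup>2 = c\<^sup>2 * (vnorm v)\<^sup>2"
  by (simp add: vnorm_sq power_mult_distrib sum_distrib_left)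

text \<open>The Kronecker factors act blockwise: the upper rows reproduce the basis expansion at
  each point and frequency, the lower rows apply \<open>M\<close> to each block. The squared
  residual therefore splits into the fit and a sum over blocks.\<close>

lemma group_lasso_obj_eq:
  assumes M: "M \<in> carrier_mat Nr Nr" and \<zeta>: "\<zeta> \<in> carrier_vec (Nb * Nr)" and "0 < Nr" "0 < N"
  shows "group_lasso_obj Nr Nb (y_vec Nr N Nb \<phi>)
      ((1 / sqrt (real (Nr * N))) \<cdot>\<^sub>m ((B_mat N Nb b f \<otimes>\<^sub>K 1\<^sub>m Nr) @\<^sub>r (1\<^sub>m Nb \<otimes>\<^sub>K M))) mu \<zeta> =
    1 / 2 * (1 / real (Nr * N) * ((\<Sum>r<Nr. \<Sum>n<N. (\<phi> r n - (\<Sum>\<nu><Nb. block Nr \<zeta> \<nu> $ r * b \<nu> (f n)))\<^sup>2) +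
      (\<Sum>\<nu><Nb. (vnorm (M *\<^sub>v block Nr \<zeta> \<nu>))\<^sup>2))) + mu * (\<Sum>\<nu><Nb. vnorm (block Nr \<zeta> \<nu>))"
proof -
  let ?c = "1 / sqrt (real (Nr * N))"
  let ?P = "B_mat N Nb b f \<otimes>\<^sub>K 1\<^sub>m Nr" and ?S = "1\<^sub>m Nb \<otimes>\<^sub>K M"
  let ?u1 = "data_vec Nr N \<phi> - ?P *\<^sub>v \<zeta>" and ?u2 = "0\<^sub>v (Nb * Nr) - ?S *\<^sub>v \<zeta>"
  have Bc: "B_mat N Nb b f \<in> carrier_mat N Nb" by (simp add: B_mat_def)
  have P: "?P \<in> carrier_mat (N * Nr) (Nb * Nr)" by (rule kron_carrier[OF Bc one_carrier_mat])
  have S: "?S \<in> carrier_mat (Nb * Nr) (Nb * Nr)" by (rule kron_carrier[OF one_carrier_mat M])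
  have blk: "block Nr \<zeta> \<nu> $ r = \<zeta> $ (\<nu> * Nr + r)" if "r < Nr" for \<nu> r using that by (simp add: block_def)
  have Pi: "(?P *\<^sub>v \<zeta>) $ (n * Nr + r) = (\<Sum>\<nu><Nb. block Nr \<zeta> \<nu> $ r * b \<nu> (f n))" if n: "n < N" and r: "r < Nr" for n r
  proof -
    \<comment> \<open>In row n Nr + r the identity factor selects the entry r of every
      block.\<close>
    have "(?P *\<^sub>v \<zeta>) $ (n * Nr + r) =
        (\<Sum>\<nu><Nb. \<Sum>q<Nr. if q = r then B_mat N Nb b f $$ (n, \<nu>) * \<zeta> $ (\<nu> * Nr + q) else 0)"
      unfolding kron_mult_vec_index[OF Bc one_carrier_mat \<zeta> n r]
      using r by (intro sum.cong refl) auto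
    also have "\<dots> = (\<Sum>\<nu><Nb. block Nr \<zeta> \<nu> $ r * b \<nu> (f n))"
      using n r by (intro sum.cong refl) (simp add: blk B_mat_def)
    finally show ?thesis .
  qed
  have Si: "(?S *\<^sub>v \<zeta>) $ (\<nu> * Nr + r) = (M *\<^sub>v block Nr \<zeta> \<nu>) $ r" if n: "\<nu> < Nb" and r: "r < Nr" for \<nu> r
  proof -
    have "(?S *\<^sub>v \<zeta>) $ (\<nu> * Nr + r) = (\<Sum>j<Nb. if j = \<nu> then \<Sum>q<Nr. M $$ (r, q) * \<zeta> $ (j * Nr + q) else 0)"
      unfolding kron_mult_vec_index[OF one_carrier_mat M \<zeta> n r]
      using n by (intro sum.cong refl) auto
    also have "\<dots> = (\<Sum>q<Nr. M $$ (r, q) * block Nr \<zeta> \<nu> $ q)"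
      using n by (simp add: blk)
    finally show ?thesis unfolding mult_mat_vec_index_sum[OF M block_carrier r] .
  qed
  have "y_vec Nr N Nb \<phi> - (?c \<cdot>\<^sub>m (?P @\<^sub>r ?S)) *\<^sub>v \<zeta> = ?c \<cdot>\<^sub>v (?u1 @\<^sub>v ?u2)"
  proof -
    have "(?c \<cdot>\<^sub>m (?P @\<^sub>r ?S)) *\<^sub>v \<zeta> = ?c \<cdot>\<^sub>v ((?P *\<^sub>v \<zeta>) @\<^sub>v (?S *\<^sub>v \<zeta>))"
      unfolding smult_mat_mult_vec[OF carrier_append_rows[OF P S] \<zeta>] append_rows_mult_vec[OF P S \<zeta>] ..
    then show ?thesis
      unfolding y_vec_def using carrier_matD[OF P] carrier_matD[OF S]
      by (intro eq_vecI) (auto simp: data_vec_def right_diff_distrib diff_divide_distrib mult.commute)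
  qed
  then have "(vnorm (y_vec Nr N Nb \<phi> - (?c \<cdot>\<^sub>m (?P @\<^sub>r ?S)) *\<^sub>v \<zeta>))\<^sup>2 = 1 / real (Nr * N) * ((vnorm ?u1)\<^sup>2 + (vnorm ?u2)\<^sup>2)"
    using assms(3,4) by (simp add: vnorm_smult_sq vnorm_append_sq power_divide)
  moreover have "(vnorm ?u1)\<^sup>2 = (\<Sum>r<Nr. \<Sum>n<N. (\<phi> r n - (\<Sum>\<nu><Nb. block Nr \<zeta> \<nu> $ r * b \<nu> (f n)))\<^sup>2)"
  proof -
    have "(vnorm ?u1)\<^sup>2 = (\<Sum>k<N * Nr. (?u1 $ k)\<^sup>2)"
      unfolding vnorm_sq using carrier_matD[OF P] by simp
    also have "\<dots> = (\<Sum>n<N. \<Sum>r<Nr. (?u1 $ (n * Nr + r))\<^sup>2)" by (rule sum_div_mod)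
    also have "\<dots> = (\<Sum>n<N. \<Sum>r<Nr. (\<phi> r n - (\<Sum>\<nu><Nb. block Nr \<zeta> \<nu> $ r * b \<nu> (f n)))\<^sup>2)"
    proof (intro sum.cong refl)
      fix n r assume "n \<in> {..<N}" "r \<in> {..<Nr}"
      then have n: "n < N" and r: "r < Nr" by auto
      have "n * Nr + r < Nr * N" using pair_index_less[OF n r] by (simp only: mult.commute)
      then have "data_vec Nr N \<phi> $ (n * Nr + r) = \<phi> r n" using r by (simp add: data_vec_def)
      then show "(?u1 $ (n * Nr + r))\<^sup>2 = (\<phi> r n - (\<Sum>\<nu><Nb. block Nr \<zeta> \<nu> $ r * b \<nu> (f n)))\<^sup>2"
        using Pi[OF n r] pair_index_less[OF n r] carrier_matD[OF P] by (simp del: index_mult_mat_vec)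
    qed
    also have "\<dots> = (\<Sum>r<Nr. \<Sum>n<N. (\<phi> r n - (\<Sum>\<nu><Nb. block Nr \<zeta> \<nu> $ r * b \<nu> (f n)))\<^sup>2)"
      by (rule sum.swap)
    finally show ?thesis .
  qed
  moreover have "(vnorm ?u2)\<^sup>2 = (\<Sum>\<nu><Nb. (vnorm (M *\<^sub>v block Nr \<zeta> \<nu>))\<^sup>2)"
  proof -
    have "(vnorm ?u2)\<^sup>2 = (\<Sum>k<Nb * Nr. (?u2 $ k)\<^sup>2)"
      unfolding vnorm_sq using carrier_matD[OF S] by simp
    also have "\<dots> = (\<Sum>\<nu><Nb. \<Sum>r<Nr. (?u2 $ (\<nu> * Nr + r))\<^sup>2)" by (rule sum_div_mod)
    also have "\<dots> = (\<Sum>\<nu><Nb. \<Sum>r<Nr. ((M *\<^sub>v block Nr \<zeta> \<nu>) $ r)\<^sup>2)"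
    proof (intro sum.cong refl)
      fix \<nu> r assume "\<nu> \<in> {..<Nb}" "r \<in> {..<Nr}"
      then have n: "\<nu> < Nb" and r: "r < Nr" by auto
      show "(?u2 $ (\<nu> * Nr + r))\<^sup>2 = ((M *\<^sub>v block Nr \<zeta> \<nu>) $ r)\<^sup>2"
        using Si[OF n r] pair_index_less[OF n r] carrier_matD[OF S] by (simp del: index_mult_mat_vec)
    qed
    also have "\<dots> = (\<Sum>\<nu><Nb. (vnorm (M *\<^sub>v block Nr \<zeta> \<nu>))\<^sup>2)"
      unfolding vnorm_sq using carrier_matD[OF M] by simp
    finally show ?thesis .
  qed
  ultimately show ?thesis unfolding group_lasso_obj_def by simp
qed

text \<open>The factor 1/2 on the whole squared residual makes the group-Lasso objective half of the
  field objective, whence \<open>mu_GL = mu / 2\<close>. The kernel is 8 pi times a fundamental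
  solution of the bilaplacian, whence \<open>lam_GL\<close>. For \<open>lam = 0\<close> the field
  objective sees only samples, so the functions themselves are identified under
  \<open>0 < lam\<close>.\<close>

theorem proposition2:
  fixes Nr N Nb :: nat
    and x :: "nat \<Rightarrow> real^2" and f :: "nat \<Rightarrow> real" and b :: "nat \<Rightarrow> real \<Rightarrow> real"
    and \<phi> :: "nat \<Rightarrow> nat \<Rightarrow> real" and lam mu lam_GL mu_GL :: real
    and Q\<^sub>1 Q\<^sub>2 R C :: "real mat"
  assumes "0 < N" and "0 \<le> lam" and "0 \<le> mu"
    and "inj_on x {..<Nr}" and "\<not> collinear (x ` {..<Nr})"
    and "\<And>\<nu>. \<nu> < Nb \<Longrightarrow> in_L2 (b \<nu>) \<and> L2_norm (b \<nu>) = 1"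
    and "QR_decomp (T_mat Nr x) Q\<^sub>1 Q\<^sub>2 R"
    and "lam_GL = 8 * pi * lam" and "mu_GL = mu / 2"
    and "is_mat_sqrt C ((real (Nr * N) * lam_GL) \<cdot>\<^sub>m (Q\<^sub>2\<^sup>T * K_mat Nr x * Q\<^sub>2))"
  shows "(\<forall>\<zeta>. group_lasso_solution Nr Nb (y_vec Nr N Nb \<phi>) (X_mat Nr N Nb x b f Q\<^sub>2 C) mu_GL \<zeta> \<longrightarrow>
            field_solution Nr N Nb x b f \<phi> lam mu (spline_field Nr x Q\<^sub>2 \<zeta>)) \<and>
         (\<forall>g. field_solution Nr N Nb x b f \<phi> lam mu g \<longrightarrow>
            (\<exists>\<zeta>. group_lasso_solution Nr Nb (y_vec Nr N Nb \<phi>) (X_mat Nr N Nb x b f Q\<^sub>2 C) mu_GL \<zeta> \<and>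
                 (\<forall>\<nu><Nb. block Nr \<zeta> \<nu> = vec Nr (\<lambda>r. g \<nu> (x r))) \<and>
                 (0 < lam \<longrightarrow> (\<forall>\<nu><Nb. g \<nu> = spline_field Nr x Q\<^sub>2 \<zeta> \<nu>))))"
proof -
  note prem = assms(4,5,7)
  let ?GL = "group_lasso_obj Nr Nb (y_vec Nr N Nb \<phi>) (X_mat Nr N Nb x b f Q\<^sub>2 C) mu_GL"
  let ?V = "field_obj Nr N Nb x b f \<phi> lam mu"
  let ?s = "spline_field Nr x Q\<^sub>2"
  let ?M = "diag_block_mat [C, 0\<^sub>m 3 3] * mat_inv (KQT_mat Nr x Q\<^sub>2)"
  let ?fit = "\<lambda>\<zeta>. \<Sum>r<Nr. \<Sum>n<N. (\<phi> r n - (\<Sum>\<nu><Nb. block Nr \<zeta> \<nu> $ r * b \<nu> (f n)))\<^sup>2"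
  have Nr: "0 < Nr" using Nr_ge_3[OF prem] by simp
  have C: "is_mat_sqrt C ((real (Nr * N) * lam * (8 * pi)) \<cdot>\<^sub>m (Q\<^sub>2\<^sup>T * K_mat Nr x * Q\<^sub>2))"
    using assms(10) unfolding assms(8) by (simp add: mult_ac)
  have V_eq: "?V g = 1 / real (Nr * N) * ?fit \<zeta> + lam * (\<Sum>\<nu><Nb. roughness (g \<nu>)) + mu * (\<Sum>\<nu><Nb. vnorm (block Nr \<zeta> \<nu>))"
    if "\<And>\<nu> r. \<nu> < Nb \<Longrightarrow> r < Nr \<Longrightarrow> g \<nu> (x r) = block Nr \<zeta> \<nu> $ r" for g \<zeta>
  proof -
    have "vec Nr (\<lambda>r. g \<nu> (x r)) = block Nr \<zeta> \<nu>" if "\<nu> < Nb" for \<nu>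
      using \<open>\<And>\<nu> r. \<nu> < Nb \<Longrightarrow> r < Nr \<Longrightarrow> g \<nu> (x r) = block Nr \<zeta> \<nu> $ r\<close>[OF that]
      by (intro eq_vecI) (auto simp: block_def)
    with that show ?thesis unfolding field_obj_def by simp
  qed
  have s_value: "?s \<zeta> \<nu> (x r) = block Nr \<zeta> \<nu> $ r" if "r < Nr" for \<zeta> \<nu> r
    unfolding spline_field_def by (rule interpolant_value[OF prem block_carrier that])
  have s_sobolev: "?s \<zeta> \<nu> \<in> sobolev" for \<zeta> \<nu>
    unfolding spline_field_def by (rule interpolant_sobolev[OF prem block_carrier])
  \<comment> \<open>The core of the equivalence: up to the factor 1/2, the group-Lasso problem is
    the field problem restricted to interpolating splines.\<close>
  have GL_eq: "?GL \<zeta> = 1 / 2 * ?V (?s \<zeta>)" if \<zeta>: "\<zeta> \<in> carrier_vec (Nb * Nr)" for \<zeta>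
  proof -
    have r: "(vnorm (?M *\<^sub>v block Nr \<zeta> \<nu>))\<^sup>2 = real (Nr * N) * lam * roughness (?s \<zeta> \<nu>)" for \<nu>
      unfolding spline_field_def by (rule interpolant_roughness(1)[OF prem block_carrier C])
    have "?GL \<zeta> = 1 / 2 * (1 / real (Nr * N) * (?fit \<zeta> +
        (\<Sum>\<nu><Nb. (vnorm (?M *\<^sub>v block Nr \<zeta> \<nu>))\<^sup>2))) + mu_GL * (\<Sum>\<nu><Nb. vnorm (block Nr \<zeta> \<nu>))"
      unfolding X_mat_def
      by (rule group_lasso_obj_eq[OF interpolant_roughness(2)[OF prem block_carrier C] \<zeta> Nr assms(1)])
    also have "\<dots> = 1 / 2 * (1 / real (Nr * N) * ?fit \<zeta> + lam * (\<Sum>\<nu><Nb. roughness (?s \<zeta> \<nu>)) +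
        mu * (\<Sum>\<nu><Nb. vnorm (block Nr \<zeta> \<nu>)))"
      unfolding r sum_distrib_left[symmetric] assms(9) using Nr assms(1) by (simp add: field_simps)
    also have "\<dots> = 1 / 2 * ?V (?s \<zeta>)" using V_eq[of "?s \<zeta>" \<zeta>] s_value by simp
    finally show ?thesis .
  qed
  \<comment> \<open>The stacking inverse to \<open>block\<close>: index k stands for block k div Nr
    and point k mod Nr.\<close>
  define samples where "samples g = vec (Nb * Nr) (\<lambda>k. g (k div Nr) (x (k mod Nr)))" for g :: "nat \<Rightarrow> real^2 \<Rightarrow> real"
  have samples: "samples g \<in> carrier_vec (Nb * Nr)" for g by (simp add: samples_def)
  have block_samples: "block Nr (samples g) \<nu> = vec Nr (\<lambda>r. g \<nu> (x r))" if "\<nu> < Nb" for g \<nu>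
    unfolding block_def samples_def using that Nr by (intro eq_vecI) (auto simp: pair_index_less)
  then have samples_value: "g \<nu> (x r) = block Nr (samples g) \<nu> $ r" if "\<nu> < Nb" "r < Nr" for g \<nu> r
    using that by simp
  \<comment> \<open>Passing from g to the spline through its samples leaves the fit and the group
    penalty unchanged, so only roughness enters.\<close>
  have gap: "?V g - ?V (?s (samples g)) = lam * (\<Sum>\<nu><Nb. roughness (g \<nu>) - roughness (?s (samples g) \<nu>))" for g
    using V_eq[of g "samples g"] V_eq[of "?s (samples g)" "samples g"] samples_value s_value
    by (simp add: sum_subtractf right_diff_distrib)
  have rough: "roughness (?s (samples g) \<nu>) \<le> roughness (g \<nu>)" if "\<nu> < Nb" "g \<nu> \<in> sobolev" for g \<nu>
    unfolding spline_field_def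
    by (rule interpolant_minimal(1)[OF prem block_carrier that(2)]) (rule samples_value[OF that(1)])
  have V_le: "?V (?s (samples g)) \<le> ?V g" if "\<forall>\<nu><Nb. g \<nu> \<in> sobolev" for g
  proof -
    have "0 \<le> lam * (\<Sum>\<nu><Nb. roughness (g \<nu>) - roughness (?s (samples g) \<nu>))"
      using that rough assms(2) by (intro mult_nonneg_nonneg sum_nonneg) auto
    with gap[of g] show ?thesis by linarith
  qed
  show ?thesis
  proof (intro conjI allI impI)
    fix \<zeta> assume "group_lasso_solution Nr Nb (y_vec Nr N Nb \<phi>) (X_mat Nr N Nb x b f Q\<^sub>2 C) mu_GL \<zeta>"
    then have \<zeta>: "\<zeta> \<in> carrier_vec (Nb * Nr)" "\<And>\<eta>. \<eta> \<in> carrier_vec (Nb * Nr) \<Longrightarrow> ?GL \<zeta> \<le> ?GL \<eta>"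
      unfolding group_lasso_solution_def is_arg_min_def by (auto simp: not_less)
    \<comment> \<open>Optimality of \<zeta> compares its spline with the spline through the samples
      of g, and the latter does not exceed g.\<close>
    have le: "?V (?s \<zeta>) \<le> ?V g" if "\<forall>\<nu><Nb. g \<nu> \<in> sobolev" for g
      using V_le[OF that] \<zeta>(2)[OF samples[of g]] GL_eq[OF \<zeta>(1)] GL_eq[OF samples[of g]] by linarith
    show "field_solution Nr N Nb x b f \<phi> lam mu (?s \<zeta>)"
      unfolding field_solution_def is_arg_min_def
    proof (intro conjI)
      show "\<forall>\<nu><Nb. ?s \<zeta> \<nu> \<in> sobolev" by (simp add: s_sobolev)
      show "\<not> (\<exists>g. (\<forall>\<nu><Nb. g \<nu> \<in> sobolev) \<and> ?V g < ?V (?s \<zeta>))" using le leD by blast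
    qed
  next
    fix g assume "field_solution Nr N Nb x b f \<phi> lam mu g"
    then have g: "\<forall>\<nu><Nb. g \<nu> \<in> sobolev" "\<And>h. \<forall>\<nu><Nb. h \<nu> \<in> sobolev \<Longrightarrow> ?V g \<le> ?V h"
      unfolding field_solution_def is_arg_min_def by (auto simp: not_less)
    have V_s: "?V g \<le> ?V (?s \<eta>)" for \<eta> by (rule g(2)) (simp add: s_sobolev)
    show "\<exists>\<zeta>. group_lasso_solution Nr Nb (y_vec Nr N Nb \<phi>) (X_mat Nr N Nb x b f Q\<^sub>2 C) mu_GL \<zeta> \<and>
        (\<forall>\<nu><Nb. block Nr \<zeta> \<nu> = vec Nr (\<lambda>r. g \<nu> (x r))) \<and>
        (0 < lam \<longrightarrow> (\<forall>\<nu><Nb. g \<nu> = ?s \<zeta> \<nu>))"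
    proof (intro exI[of _ "samples g"] conjI allI impI)
      \<comment> \<open>Conversely, optimality of g compares it with every spline field, and the
        spline through its samples costs no more than g itself.\<close>
      have "?GL (samples g) \<le> ?GL \<eta>" if "\<eta> \<in> carrier_vec (Nb * Nr)" for \<eta>
        using V_le[OF g(1)] V_s[of \<eta>] GL_eq[OF that] GL_eq[OF samples[of g]] by linarith
      then show "group_lasso_solution Nr Nb (y_vec Nr N Nb \<phi>) (X_mat Nr N Nb x b f Q\<^sub>2 C) mu_GL (samples g)"
        unfolding group_lasso_solution_def is_arg_min_def using samples by (auto simp: not_less)
      show "block Nr (samples g) \<nu> = vec Nr (\<lambda>r. g \<nu> (x r))" if "\<nu> < Nb" for \<nu>
        by (rule block_samples[OF that])
      fix \<nu> assume lam: "0 < lam" and \<nu>: "\<nu> < Nb"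
      \<comment> \<open>Optimality of g makes the weighted excess roughness nonpositive. With
        \<open>0 < lam\<close> and nonnegative summands every excess vanishes, and uniqueness of the
        least rough interpolant applies.\<close>
      have "lam * (\<Sum>\<nu><Nb. roughness (g \<nu>) - roughness (?s (samples g) \<nu>)) \<le> 0"
        using gap[of g] V_s[of "samples g"] by linarith
      moreover have nn: "0 \<le> roughness (g \<nu>) - roughness (?s (samples g) \<nu>)" if "\<nu> < Nb" for \<nu>
        using rough[OF that] g(1) that by simp
      then have "0 \<le> (\<Sum>\<nu><Nb. roughness (g \<nu>) - roughness (?s (samples g) \<nu>))" by (intro sum_nonneg) auto
      ultimately have "(\<Sum>\<nu><Nb. roughness (g \<nu>) - roughness (?s (samples g) \<nu>)) = 0"
        using lam by (simp add: mult_le_0_iff)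
      then have "roughness (g \<nu>) - roughness (?s (samples g) \<nu>) = 0"
        using sum_nonneg_eq_0_iff[of "{..<Nb}" "\<lambda>\<nu>. roughness (g \<nu>) - roughness (?s (samples g) \<nu>)"] nn \<nu> by auto
      then have "roughness (g \<nu>) = roughness (spline Nr x (spline_coeffs Nr x Q\<^sub>2 (block Nr (samples g) \<nu>)))"
        by (simp add: spline_field_def)
      with g(1) \<nu> show "g \<nu> = ?s (samples g) \<nu>"
        unfolding spline_field_def
        by (intro interpolant_minimal(2)[OF prem block_carrier _ samples_value[OF \<nu>]]) auto
    qed
  qed
qed

end
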